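(* Fix $c\in[1/2,1)$ and $\varepsilon>0$. Almost surely the following holds: there is a constant $B$ (depending on $c$, $\varepsilon$ and the outcome of the random choices) such that for all sufficiently large $x$ and all admissible finite sets $\mathcal H\subset\mathbb Z$ with $|\mathcal H|\le (\log x)^c$ and $\mathcal H\subset\big[0,\exp\big(\frac{(\log x)^{1-c}}{\log\log x}\big)\big]$, \[ \Big|\,|\{n\le x: n+h\in\mathcal R\text{ for all }h\in\mathcal H\}| - \mathfrak S(\mathcal H)\int_2^x\frac{dt}{(\log t)^{|\mathcal H|}}\Big| \le B\, x^{1-\frac{1-c}{8c^2-2c}+\varepsilon}. \]
   Context: Random model: for each prime $p$ choose a residue class $a_p \bmod p$ uniformly at random, jointly independently over $p$. For $z\ge2$ let $\mathcal S_z\defeq\mathbb Z\setminus\bigcup_{p\le z}\{n:n\equiv a_p\bmod p\}$, $\Theta_z\defeq\prod_{p\le z}(1-1/p)$, and for $t\ge e^2$ let $z(t)$ be the largest prime $z$ with $\Theta_z^{-1}\le\log t$. Put $\mathcal R\defeq\{n\in\mathbb N:n\ge e^2,\ n\in\mathcal S_{z(n)}\}$. For a finite set $\mathcal H\subset\mathbb Z$, the singular series is $\mathfrak S(\mathcal H)\defeq\prod_p\big(1-\frac{|\mathcal H\bmod p|}{p}\big)\big(1-\frac1p\big)^{-|\mathcal H|}$, where $|\mathcal H\bmod p|$ is the number of residue classes mod $p$ met by $\mathcal H$; $\mathcal H$ is admissible if $|\mathcal H\bmod p|<p$ for every prime $p$. *)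

theory Defs
  imports "HOL-Probability.Probability" "HOL-Number_Theory.Cong"
    "HOL-Computational_Algebra.Primes"
begin

text \<open>Throughout, \<open>a p\<close> is an integer representing the residue class removed modulo the prime \<open>p\<close>;
  the values of \<open>a\<close> at non-primes play no role.\<close>

definition sieved :: "(nat \<Rightarrow> int) \<Rightarrow> real \<Rightarrow> int set" where
  "sieved a z = UNIV - (\<Union>p\<in>{p. prime p \<and> real p \<le> z}. {n. [n = a p] (mod int p)})"

definition Theta :: "real \<Rightarrow> real" where
  "Theta z = (\<Prod>p | prime (p::nat) \<and> real p \<le> z. 1 - 1 / real p)"

text \<open>Only meaningful for \<open>t \<ge> exp 2\<close>, where the prime \<open>2\<close> qualifies; the qualifying primes are bounded because \<open>Theta\<close> tends to \<open>0\<close>.\<close>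

definition sieve_level :: "real \<Rightarrow> nat" where
  "sieve_level t = (GREATEST z. prime z \<and> inverse (Theta (real z)) \<le> ln t)"

text \<open>A set of natural numbers, typed as integers so that shifts by integers can be tested for
  membership; the condition \<open>n \<ge> exp 2\<close> excludes nonpositive \<open>n\<close>.\<close>

definition random_set :: "(nat \<Rightarrow> int) \<Rightarrow> int set" where
  "random_set a =
     {n. real_of_int n \<ge> exp 2 \<and> n \<in> sieved a (real (sieve_level (real_of_int n)))}"

definition num_residues :: "int set \<Rightarrow> nat \<Rightarrow> nat" where
  "num_residues H p = card ((\<lambda>h. h mod int p) ` H)"

definition admissible :: "int set \<Rightarrow> bool" where
  "admissible H \<longleftrightarrow> (\<forall>p. prime p \<longrightarrow> num_residues H p < p)"

text \<open>The product over primes is written as a product over all naturals with factor \<open>1\<close> at non-primes.\<close>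

definition singular_series :: "int set \<Rightarrow> real" where
  "singular_series H =
     (\<Prod>p. if prime p
           then (1 - real (num_residues H p) / real p) * inverse ((1 - 1 / real p) ^ card H)
           else 1)"

end

theory Submission
  imports Defs "HOL-Real_Asymp.Real_Asymp"
begin

text \<open>
  The proof is a second moment computation. Let \<open>N\<close> be the length of an interval on which the
  events that \<open>n + H\<close> survives the sieve are counted. Their covariances are products over primes of
  \<open>1 + \<rho>\<^sub>p(n - m)\<close>, where \<open>\<rho>\<^sub>p\<close> has period \<open>p\<close> and mean \<open>0\<close>. Expanding this product only up to the
  point where the product \<open>d\<close> of the chosen primes exceeds \<open>N\<close>, the terms with \<open>d \<le> N\<close> cancel over
  complete periods, and the remainder terms carry a large prime \<open>p > N / d\<close> for which \<open>\<rho>\<^sub>p(n - m)\<close>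
  is small on average, since few primes divide a given nonzero integer. Both contribute at most \<open>N\<close>
  times a sum of \<open>(8 |H|\<^sup>2)\<^bsup>\<omega>(d)\<^esup> / d\<close> over \<open>d \<le> N\<close>, which by Rankin's trick is
  \<open>x\<^bsup>2c - 1 + o(1)\<^esup>\<close> because \<open>|H| \<le> (log x)\<^sup>c\<close>. The variance is thus linear in \<open>N\<close>, and Chebyshev's
  inequality on all dyadic intervals up to \<open>x\<close>, a union bound over the \<open>x\<^bsup>o(1)\<^esup>\<close> tuples, and
  Borel--Cantelli give fluctuations \<open>x\<^bsup>c + o(1)\<^esup>\<close>; this suffices since \<open>8c\<^sup>2 - 2c \<ge> 1\<close>.
  The expected count is within \<open>x\<^bsup>1/2 + o(1)\<^esup>\<close> of the main term because the first prime
  after \<open>z(t)\<close> is at least \<open>\<surd>t\<close>, i.e. the constant in the Mertens product is less than \<open>2\<close>.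
\<close>

section \<open>Mertens-type bounds for the sieving density\<close>

text \<open>The product of all sieving primes is far longer than any interval in question, so
  complete periods are available only for small moduli; the survival probabilities in front of the
  correlations keep the unexpanded factors bounded by 1. The elements of \<open>n + H\<close> are
  sieved to slightly different levels, so the count is not a single second moment; it is trapped
  between two counts with one level for each \<open>n\<close>, and both are controlled. Scales are
  \<open>X = 4 ^ J\<close>, so that \<open>sqrt X = 2 ^ J\<close> is an integer. Counting starts
  there: the level is well behaved from that point on, \<open>H\<close> is shorter than the square
  root of the starting point, and all that lies below costs only X^(1/2 + o(1)). No prime number
  theorem enters the bound for the Mertens product. With nothing more than
  \<open>ln t + ln 4\<close> as a bound for the sum of \<open>ln p / p\<close>, comparing the Euler
  product at 1 with the one at \<open>1 + 2 / ln q\<close> gives the constant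
  \<open>exp (136 / 100) / 2\<close>, just below 2.\<close>

lemma prod_distinct_primes_dvd:
  fixes n :: nat
  assumes "finite P" "\<And>p. p \<in> P \<Longrightarrow> prime p" "\<And>p. p \<in> P \<Longrightarrow> p ^ e p dvd n"
  shows "(\<Prod>p\<in>P. p ^ e p) dvd n"
  using assms
proof (induction P rule: finite_induct)
  case (insert p P)
  have "coprime (p ^ e p) (\<Prod>q\<in>P. q ^ e q)"
  proof (rule prod_coprime_right)
    fix q assume "q \<in> P"
    with insert have "coprime p q" by (intro primes_coprime) auto
    thus "coprime (p ^ e p) (q ^ e q)" by simp
  qed
  with insert show ?case by (auto intro!: divides_mult)
qed auto

text \<open>Erdos's induction. An even \<open>n > 2\<close> is not prime, so nothing changes from
  \<open>n - 1\<close>; for \<open>n = 2 * m + 1\<close> the primes above \<open>m + 1\<close> all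
  divide the binomial coefficient \<open>(2 * m + 1) choose m\<close>, which is at most
  \<open>4 ^ m\<close>.\<close>

lemma primorial_le: "(\<Prod>p | prime p \<and> p \<le> n. p) \<le> 4 ^ n" for n :: nat
proof (induction n rule: less_induct)
  case (less n)
  consider "n = 0" | "n = 1" | "n = 2" | m where "n = 2 * m" "m \<ge> 2" | m where "n = 2 * m + 1" "m \<ge> 1"
  proof -
    have "n = 2 * (n div 2) \<or> n = 2 * (n div 2) + 1" by presburger
    moreover have "n div 2 = 0 \<or> n div 2 = 1 \<or> n div 2 \<ge> 2" by linarith
    ultimately have "n = 0 \<or> n = 1 \<or> n = 2 \<or> (n = 2 * (n div 2) \<and> n div 2 \<ge> 2) \<or> (n = 2 * (n div 2) + 1 \<and> n div 2 \<ge> 1)" by linarith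
    thus ?thesis using that by blast
  qed
  thus ?case
  proof cases
    case 1
    hence *: "{p. prime p \<and> p \<le> n} = {}" by auto
    show ?thesis unfolding * by simp
  next
    case 2
    hence *: "{p. prime p \<and> p \<le> n} = {}" by (auto dest: prime_ge_2_nat)
    show ?thesis unfolding * by simp
  next
    case 3
    hence *: "{p. prime p \<and> p \<le> n} = {2}" by (auto dest: prime_ge_2_nat)
    show ?thesis unfolding * using 3 by simp
  next
    case (4 m)
    have "\<not> prime n" using 4 by (auto dest: prime_product)
    hence "prime p \<and> p \<le> n \<longleftrightarrow> prime p \<and> p \<le> n - 1" for p
      by (cases "p = n") auto
    hence "{p. prime p \<and> p \<le> n} = {p. prime p \<and> p \<le> n - 1}" by simp
    also have "\<Prod>\<dots> \<le> 4 ^ (n - 1)" using 4 by (intro less.IH) auto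
    also have "\<dots> \<le> 4 ^ n" by (intro power_increasing) auto
    finally show ?thesis .
  next
    case (5 m)
    let ?A = "{p. prime p \<and> p \<le> m + 1}" and ?B = "{p. prime p \<and> m + 1 < p \<and> p \<le> 2 * m + 1}"
    have "{p. prime p \<and> p \<le> n} = ?A \<union> ?B" using 5 by auto
    hence "(\<Prod>p | prime p \<and> p \<le> n. p) = \<Prod>?A * \<Prod>?B"
      by (subst prod.union_disjoint[symmetric]) auto
    also have "\<Prod>?A \<le> 4 ^ (m + 1)" using 5 by (intro less.IH) auto
    also have "\<Prod>?B \<le> 4 ^ m"
    proof -
      have "(\<Prod>p\<in>?B. p ^ 1) dvd (2 * m + 1) choose m"
      proof (rule prod_distinct_primes_dvd)
        fix p assume p: "p \<in> ?B"
        have "fact m * fact (m + 1) * ((2 * m + 1) choose m) = (fact (2 * m + 1) :: nat)"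
          using binomial_fact_lemma[of m "2 * m + 1"] by simp
        moreover have "p dvd fact (2 * m + 1)" using p by (subst prime_dvd_fact_iff) auto
        ultimately have "p dvd fact m * fact (m + 1) * ((2 * m + 1) choose m)" by simp
        moreover have "\<not> p dvd fact m" "\<not> p dvd fact (m + 1)"
          using p by (subst prime_dvd_fact_iff; force)+
        ultimately show "p ^ 1 dvd (2 * m + 1) choose m" using p by (auto simp: prime_dvd_mult_iff)
      qed auto
      hence "\<Prod>?B \<le> (2 * m + 1) choose m" by (intro dvd_imp_le) auto
      \<comment> \<open>The coefficient occurs twice in its row, at \<open>m\<close> and at
        \<open>m + 1\<close>, and the row sums to \<open>2 ^ (2 * m + 1)\<close>.\<close>
      also have "2 * ((2 * m + 1) choose m) \<le> 2 ^ (2 * m + 1)"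
      proof -
        have "((2 * m + 1) choose m) + ((2 * m + 1) choose (m + 1)) = (\<Sum>k\<in>{m, m + 1}. (2 * m + 1) choose k)" by simp
        also have "\<dots> \<le> (\<Sum>k\<le>2 * m + 1. (2 * m + 1) choose k)" by (intro sum_mono2) auto
        also have "\<dots> = 2 ^ (2 * m + 1)" by (rule choose_row_sum)
        finally show ?thesis using binomial_symmetric[of m "2 * m + 1"] by simp
      qed
      hence "(2 * m + 1) choose m \<le> 4 ^ m" by (simp add: power_mult)
      finally show ?thesis .
    qed
    finally show ?thesis using 5 by (simp add: mult_mono power_add mult_2)
  qed
qed

lemma sum_ln_prime_le:
  fixes n :: nat
  shows "(\<Sum>p | prime p \<and> p \<le> n. ln (real p)) \<le> n * ln 4"
proof -
  have "(\<Sum>p | prime p \<and> p \<le> n. ln (real p)) = ln (\<Prod>p | prime p \<and> p \<le> n. real p)"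
    by (rule ln_prod[symmetric]) (auto dest: prime_gt_0_nat)
  also have "(\<Prod>p | prime p \<and> p \<le> n. real p) = real (\<Prod>p | prime p \<and> p \<le> n. p)" by simp
  also have "ln \<dots> \<le> ln (real (4 ^ n))"
  proof (subst ln_le_cancel_iff)
    show "0 < real (\<Prod>p | prime p \<and> p \<le> n. p)"
      unfolding of_nat_prod by (intro prod_pos) (auto dest: prime_gt_0_nat)
  next
    show "real (\<Prod>p | prime p \<and> p \<le> n. p) \<le> real (4 ^ n)"
      using primorial_le[of n] of_nat_le_iff by blast
  qed auto
  also have "\<dots> = n * ln 4" by (simp add: ln_realpow)
  finally show ?thesis .
qed

text \<open>Each of the \<open>n div p\<close> complete blocks of \<open>p\<close> consecutive
  factors contains a multiple of \<open>p\<close>; this is the first term of Legendre's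
  formula.\<close>

lemma prime_power_div_dvd_fact:
  fixes n p :: nat
  shows "p ^ (n div p) dvd fact n"
proof (cases "p = 0")
  case False
  have "p ^ (k) dvd fact (p * k)" for k
  proof (induction k)
    case (Suc k)
    have "p * Suc k = Suc (p * k + (p - 1))" using False by simp
    hence "(fact (p * Suc k) :: nat) = p * Suc k * fact (p * k + (p - 1))"
      by (metis fact_Suc of_nat_id)
    moreover have "p ^ k dvd fact (p * k + (p - 1))"
      using Suc fact_dvd[of "p * k" "p * k + (p - 1)"] dvd_trans by (metis le_add1)
    ultimately show ?case by (auto simp: mult_dvd_mono)
  qed auto
  from this[of "n div p"] show ?thesis
    by (rule dvd_trans) (auto intro: fact_dvd)
qed auto

text \<open>Upper half of Mertens' first theorem: the logarithm of \<open>fact n\<close> is at most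
  \<open>n * ln n\<close> and at least the sum of \<open>(n div p) * ln p\<close>. Replacing
  \<open>n div p\<close> by \<open>n / p - 1\<close> costs Chebyshev's theta function, at most
  \<open>n * ln 4\<close>.\<close>

lemma sum_ln_prime_div_le:
  fixes n :: nat
  assumes "n \<ge> 1"
  shows "(\<Sum>p | prime p \<and> p \<le> n. ln (real p) / real p) \<le> ln n + ln 4"
proof -
  let ?P = "{p. prime p \<and> p \<le> n}"
  have "(\<Prod>p\<in>?P. p ^ (n div p)) dvd fact n"
    by (intro prod_distinct_primes_dvd prime_power_div_dvd_fact) auto
  hence "(\<Prod>p\<in>?P. p ^ (n div p)) \<le> fact n" by (intro dvd_imp_le) auto
  also have "(fact n :: nat) \<le> n ^ n" using fact_le_power[of n, where 'a=nat] by simp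
  finally have "real (\<Prod>p\<in>?P. p ^ (n div p)) \<le> real (n ^ n)" by (rule of_nat_mono)
  hence "ln (\<Prod>p\<in>?P. real p ^ (n div p)) \<le> ln (real n ^ n)"
    using assms by (subst ln_le_cancel_iff) (auto intro!: prod_pos dest: prime_gt_0_nat)
  also have "ln (\<Prod>p\<in>?P. real p ^ (n div p)) = (\<Sum>p\<in>?P. real (n div p) * ln (real p))"
    by (subst ln_prod) (auto simp: ln_realpow dest: prime_gt_0_nat)
  also have "ln (real n ^ n) = n * ln n" using assms by (simp add: ln_realpow)
  finally have 1: "(\<Sum>p\<in>?P. real (n div p) * ln (real p)) \<le> n * ln n" .
  have "n * (\<Sum>p\<in>?P. ln (real p) / real p) - (\<Sum>p\<in>?P. ln (real p)) = (\<Sum>p\<in>?P. (real n / real p - 1) * ln (real p))"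
    by (simp add: sum_distrib_left sum_subtractf algebra_simps)
  also have "\<dots> \<le> (\<Sum>p\<in>?P. real (n div p) * ln (real p))"
  proof (rule sum_mono)
    fix p assume "p \<in> ?P"
    hence "p \<ge> 1" by (auto dest: prime_gt_0_nat)
    have "real n = real (n div p) * real p + real (n mod p)"
      by (metis div_mult_mod_eq of_nat_add of_nat_mult)
    moreover have "real (n mod p) \<le> real p" using \<open>p \<ge> 1\<close> by simp
    ultimately have "real n / real p - 1 \<le> real (n div p)" using \<open>p \<ge> 1\<close> by (simp add: field_simps)
    thus "(real n / real p - 1) * ln (real p) \<le> real (n div p) * ln (real p)"
      using \<open>p \<ge> 1\<close> by (intro mult_right_mono) auto
  qed
  finally have "n * (\<Sum>p\<in>?P. ln (real p) / real p) \<le> n * (ln n + ln 4)"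
    using 1 sum_ln_prime_le[of n] by (simp add: algebra_simps)
  thus ?thesis using assms by simp
qed

lemma sum_ln_prime_div_le_real:
  assumes "t \<ge> (1 :: real)"
  shows "(\<Sum>p | prime p \<and> real p \<le> t. ln (real p) / real p) \<le> ln t + ln 4"
proof -
  have "{p. prime p \<and> real p \<le> t} = {p. prime p \<and> p \<le> nat \<lfloor>t\<rfloor>}"
    using assms by (auto simp: le_nat_floor) linarith
  moreover have "nat \<lfloor>t\<rfloor> \<ge> 1" using assms by linarith
  moreover have "ln (real (nat \<lfloor>t\<rfloor>)) \<le> ln t" using assms by (subst ln_le_cancel_iff) auto
  ultimately show ?thesis using sum_ln_prime_div_le[of "nat \<lfloor>t\<rfloor>"] by simp
qed

section \<open>The zeta function to the right of 1 and finite Euler products\<close>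

lemma summable_nat_powr: "s > 0 \<Longrightarrow> summable (\<lambda>n. real n powr (-1 - s))"
  using summable_real_powr_iff[of "-1-s"] by simp

text \<open>Comparison of zeta(1 + s) with the integral of \<open>t powr (-1 - s)\<close>, carried
  out by telescoping \<open>n powr (-s)\<close>.\<close>

lemma suminf_nat_powr_le:
  assumes s: "(s::real) > 0"
  shows "(\<Sum>n. real n powr (-1 - s)) \<le> 1 + 1 / s"
proof -
  have step: "real (Suc n) powr (-1 - s) \<le> (1 / s) * (real n powr (-s) - real (Suc n) powr (-s))" if "n \<ge> 1" for n
  proof -
    have "\<exists>z. z > real n \<and> z < real (Suc n) \<and> 
       real (Suc n) powr (-s) - real n powr (-s) = (real (Suc n) - real n) * (-s * z powr (-s - 1))"
      using that by (intro MVT2) (auto intro!: derivative_eq_intros simp: powr_diff)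
    then obtain z where z: "z > real n" "z < real (Suc n)"
       "real (Suc n) powr (-s) - real n powr (-s) = -s * z powr (-s - 1)" by auto
    have "real (Suc n) powr (-1 - s) \<le> z powr (-1 - s)"
      using z s that by (intro powr_mono2') auto
    hence "s * real (Suc n) powr (-1 - s) \<le> s * z powr (-1 - s)"
      using s by (intro mult_left_mono) auto
    moreover have "-s - 1 = -1 - s" by simp
    ultimately have "s * real (Suc n) powr (-1 - s) \<le> real n powr (-s) - real (Suc n) powr (-s)"
      using z(3) by (metis add.commute diff_add_cancel diff_minus_eq_add minus_diff_eq mult_minus_left minus_equation_iff)
    thus ?thesis using s by (simp add: field_simps)
  qed
  \<comment> \<open>The term at 0 vanishes because \<open>0 powr _ = 0\<close>, the term at 1 is the
    leading 1 on the right, and the telescoping starts at 2.\<close>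
  have "(\<Sum>n<Suc (Suc N). real n powr (-1 - s)) \<le> 1 + (1 / s) * (1 - real (Suc N) powr (-s))" for N
  proof (induction N)
    case (Suc N)
    have "(\<Sum>n<Suc (Suc (Suc N)). real n powr (-1 - s)) = (\<Sum>n<Suc (Suc N). real n powr (-1 - s)) + real (Suc (Suc N)) powr (-1 - s)" by simp
    also have "\<dots> \<le> 1 + (1 / s) * (1 - real (Suc N) powr (-s)) + (1 / s) * (real (Suc N) powr (-s) - real (Suc (Suc N)) powr (-s))"
      by (intro add_mono Suc.IH step) auto
    finally show ?case by (simp only: right_diff_distrib)
  qed (use s in simp)
  also have "1 + (1 / s) * (1 - real (Suc N) powr (-s)) \<le> 1 + 1 / s" for N
    using s by (simp add: field_simps)
  finally have *: "(\<Sum>n<Suc (Suc N). real n powr (-1 - s)) \<le> 1 + 1 / s" for N .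
  show ?thesis
  proof (rule suminf_le_const[OF summable_nat_powr[OF s]])
    fix N
    have "(\<Sum>n<N. real n powr (-1 - s)) \<le> (\<Sum>n<Suc (Suc N). real n powr (-1 - s))"
      by (intro sum_mono2) auto
    thus "(\<Sum>n<N. real n powr (-1 - s)) \<le> 1 + 1 / s" using *[of N] by linarith
  qed
qed

text \<open>The sieve of Eratosthenes on zeta(1 + s): among the integers free of primes in
  \<open>P\<close>, the multiples of a further prime \<open>p\<close> carry exactly the share
  \<open>p powr (-1 - s)\<close>, because multiplying by \<open>p\<close> creates no divisor in
  \<open>P\<close>.\<close>

lemma prod_euler_factor_mult_suminf:
  assumes s: "(s::real) > 0" and "finite P" "\<And>p. p \<in> P \<Longrightarrow> prime p"
  shows "(\<Sum>n. if \<exists>p\<in>P. p dvd n then 0 else real n powr (-1 - s)) =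
           (\<Prod>p\<in>P. 1 - real p powr (-1 - s)) * (\<Sum>n. real n powr (-1 - s))"
  using assms(2,3)
proof (induction P rule: finite_induct)
  case (insert p P)
  let ?f = "\<lambda>n. if \<exists>q\<in>P. q dvd n then 0 else real n powr (-1 - s)"
  let ?h = "\<lambda>n. if p dvd n then ?f n else 0"
  have p: "prime p" using insert by auto
  have summ: "summable ?f"
    by (rule summable_comparison_test'[OF summable_nat_powr[OF s], of 0]) auto
  have "?f (p * n) = real p powr (-1 - s) * ?f n" for n
  proof -
    have "q dvd p * n \<longleftrightarrow> q dvd n" if "q \<in> P" for q
      using insert that p by (metis insertI1 insertI2 prime_dvd_mult_iff primes_dvd_imp_eq)
    thus ?thesis by (simp add: powr_mult)
  qed
  hence "(\<lambda>n. ?h (p * n)) sums (real p powr (-1 - s) * suminf ?f)"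
    using summable_sums[OF summ] by (auto intro: sums_mult)
  moreover have "strict_mono (\<lambda>n. p * n)" using p by (auto intro!: strict_monoI simp: prime_gt_0_nat)
  ultimately have h: "?h sums (real p powr (-1 - s) * suminf ?f)"
    by (subst (asm) sums_mono_reindex) (auto elim!: dvdE)
  have "(\<lambda>n. ?f n - ?h n) sums (suminf ?f - real p powr (-1 - s) * suminf ?f)"
    by (intro sums_diff h summable_sums summ)
  also have "(\<lambda>n. ?f n - ?h n) = (\<lambda>n. if \<exists>q\<in>insert p P. q dvd n then 0 else real n powr (-1 - s))"
    by auto
  finally have "(\<Sum>n. if \<exists>q\<in>insert p P. q dvd n then 0 else real n powr (-1 - s)) = (1 - real p powr (-1 - s)) * suminf ?f"
    by (simp add: sums_iff algebra_simps)
  thus ?case using insert by simp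
qed auto

text \<open>The integer 1 survives every sieving, so the sifted series is at least 1.\<close>

lemma prod_euler_factor_ge:
  assumes s: "(s::real) > 0" and P: "finite P" "\<And>p. p \<in> P \<Longrightarrow> prime p"
  shows "1 \<le> (\<Prod>p\<in>P. 1 - real p powr (-1 - s)) * (1 + 1 / s)"
proof -
  let ?f = "\<lambda>n. if \<exists>q\<in>P. q dvd n then 0 else real n powr (-1 - s)"
  have summ: "summable ?f"
    by (rule summable_comparison_test'[OF summable_nat_powr[OF s], of 0]) auto
  have "1 \<notin> P" using P(2) not_prime_1 by blast
  hence "1 = (\<Sum>n\<in>{1}. ?f n)" by simp
  also have "\<dots> \<le> suminf ?f" by (rule sum_le_suminf[OF summ]) auto
  also have "\<dots> = (\<Prod>p\<in>P. 1 - real p powr (-1 - s)) * (\<Sum>n. real n powr (-1 - s))"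
    by (rule prod_euler_factor_mult_suminf[OF s P])
  also have "\<dots> \<le> (\<Prod>p\<in>P. 1 - real p powr (-1 - s)) * (1 + 1 / s)"
  proof (intro mult_left_mono suminf_nat_powr_le[OF s] prod_nonneg)
    fix p assume "p \<in> P"
    hence "real p \<ge> 1" using prime_gt_0_nat[OF P(2)] by (simp add: Suc_le_eq)
    hence "real p powr (-1 - s) \<le> real p powr 0" using s by (intro powr_mono) auto
    thus "0 \<le> 1 - real p powr (-1 - s)" using \<open>real p \<ge> 1\<close> by simp
  qed
  finally show ?thesis .
qed

section \<open>Partial summation over primes against a decreasing weight\<close>

lemma step_function_majorant:
  fixes W :: "real \<Rightarrow> real" and J :: nat
  assumes anti: "\<And>u v. 0 \<le> u \<Longrightarrow> u \<le> v \<Longrightarrow> v \<le> 1 \<Longrightarrow> W v \<le> W u"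
    and J: "J > 0" and u: "0 \<le> u" "u \<le> 1"
  shows "W u \<le> W 1 + (\<Sum>i<J. (W (i / J) - W (Suc i / J)) * (if u \<le> Suc i / J then 1 else 0))"
proof -
  \<comment> \<open>\<open>k\<close> is the cell of mesh \<open>1 / J\<close> containing
    \<open>u\<close>; exactly the indices from \<open>k\<close> on have indicator 1, and their
    decrements telescope to \<open>W (k / J) - W 1\<close>.\<close>
  define k where "k = (LEAST i. u \<le> Suc i / J)"
  have ex: "u \<le> Suc (J - 1) / J" using J u by simp
  have k1: "u \<le> Suc k / J" unfolding k_def by (rule LeastI[of _ "J - 1"]) (rule ex)
  have kJ: "k < J" using Least_le[of "\<lambda>i. u \<le> Suc i / J", OF ex] J unfolding k_def by linarith
  have k2: "k / J \<le> u"
  proof (cases k)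
    case (Suc k')
    have "\<not> u \<le> Suc k' / J" using not_less_Least[of k' "\<lambda>i. u \<le> Suc i / J"] Suc unfolding k_def by simp
    thus ?thesis using Suc by simp
  qed (use u in auto)
  have "W u \<le> W (k / J)" using k2 u by (intro anti) auto
  also have "W (k / J) = W 1 + (\<Sum>i=k..<J. W (i / J) - W (Suc i / J))"
  proof -
    have "(\<Sum>i=k..<J. W (Suc i / J) - W (i / J)) = W (J / J) - W (k / J)"
      using kJ by (intro sum_Suc_diff'[of k J "\<lambda>i. W (i / J)"]) auto
    hence "(\<Sum>i=k..<J. W (i / J) - W (Suc i / J)) = W (k / J) - W (J / J)"
      unfolding sum_subtractf by linarith
    thus ?thesis using J by simp
  qed
  also have "(\<Sum>i=k..<J. W (i / J) - W (Suc i / J)) = (\<Sum>i=k..<J. (W (i / J) - W (Suc i / J)) * (if u \<le> Suc i / J then 1 else 0))"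
  proof (rule sum.cong)
    fix i assume "i \<in> {k..<J}"
    hence "Suc k / J \<le> Suc i / J" by (intro divide_right_mono) auto
    hence "u \<le> Suc i / J" using k1 by linarith
    thus "W (i / J) - W (Suc i / J) = (W (i / J) - W (Suc i / J)) * (if u \<le> Suc i / J then 1 else 0)" by simp
  qed auto
  also have "\<dots> \<le> (\<Sum>i<J. (W (i / J) - W (Suc i / J)) * (if u \<le> Suc i / J then 1 else 0))"
  proof (rule sum_mono2)
    fix i assume "i \<in> {..<J} - {k..<J}"
    hence "W (Suc i / J) \<le> W (i / J)" using J by (intro anti) (auto simp: divide_simps)
    thus "0 \<le> (W (i / J) - W (Suc i / J)) * (if u \<le> Suc i / J then 1 else 0)" by simp
  qed auto
  finally show ?thesis by simp
qed

text \<open>Discrete Abel summation: the weight is majorised by a nonnegative combination of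
  indicators of initial segments, and each segment is estimated by
  \<open>sum_ln_prime_div_le_real\<close>. The main term becomes the left Riemann sum of
  \<open>W\<close> with \<open>J\<close> cells; the errors \<open>ln 4\<close> add up with total
  coefficient \<open>W 0\<close>.\<close>

lemma sum_ln_prime_weighted_le:
  fixes W :: "real \<Rightarrow> real" and J :: nat
  assumes anti: "\<And>u v. 0 \<le> u \<Longrightarrow> u \<le> v \<Longrightarrow> v \<le> 1 \<Longrightarrow> W v \<le> W u"
    and W1: "W 1 \<ge> 0" and J: "J > 0" and q: "q \<ge> (2 :: nat)"
  shows "(\<Sum>p | prime p \<and> p \<le> q. ln (real p) / real p * W (ln (real p) / ln (real q)))
           \<le> ln q * ((\<Sum>i<J. W (i / J)) / J) + ln 4 * W 0"
proof -
  let ?P = "{p. prime p \<and> p \<le> q}" and ?a = "\<lambda>p::nat. ln (real p) / real p" and ?L = "ln (real q)"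
  let ?D = "\<lambda>i. W (i / J) - W (Suc i / J)"
  have L: "?L > 0" using q by simp
  have D: "?D i \<ge> 0" if "i < J" for i using anti[of "i / J" "Suc i / J"] that J by (auto simp: divide_simps)
  have A: "(\<Sum>p\<in>?P. ?a p * (if ln (real p) / ?L \<le> v then 1 else 0)) \<le> v * ?L + ln 4" if v: "0 \<le> v" "v \<le> 1" for v
  proof -
    have "(\<Sum>p\<in>?P. ?a p * (if ln (real p) / ?L \<le> v then 1 else 0)) = (\<Sum>p | prime p \<and> real p \<le> real q powr v. ?a p)"
    proof (rule sum.mono_neutral_cong_right)
      have "real q powr v \<le> real q powr 1" using v q by (intro powr_mono) auto
      thus "{p. prime p \<and> real p \<le> real q powr v} \<subseteq> ?P" using q by auto
    next
      have eq: "ln (real p) / ?L \<le> v \<longleftrightarrow> real p \<le> real q powr v" if "prime p" for p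
      proof -
        have p: "real p > 0" using that prime_gt_0_nat by auto
        have "real p \<le> real q powr v \<longleftrightarrow> ln (real p) \<le> ln (real q powr v)"
          using p q by (subst ln_le_cancel_iff) auto
        also have "ln (real q powr v) = v * ?L" using q by (simp add: ln_powr)
        finally show ?thesis using L by (simp add: field_simps)
      qed
      show "\<forall>i\<in>?P - {p. prime p \<and> real p \<le> real q powr v}. ?a i * (if ln (real i) / ?L \<le> v then 1 else 0) = 0"
        using eq by auto
      fix p assume "p \<in> {p. prime p \<and> real p \<le> real q powr v}"
      thus "?a p * (if ln (real p) / ?L \<le> v then 1 else 0) = ?a p" using eq by auto
    qed auto
    also have "\<dots> \<le> ln (real q powr v) + ln 4" using v q by (intro sum_ln_prime_div_le_real) (simp add: ge_one_powr_ge_zero)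
    also have "ln (real q powr v) = v * ?L" using q by (simp add: ln_powr)
    finally show ?thesis .
  qed
  have "(\<Sum>p\<in>?P. ?a p * W (ln (real p) / ?L)) \<le> 
          (\<Sum>p\<in>?P. ?a p * (W 1 + (\<Sum>i<J. ?D i * (if ln (real p) / ?L \<le> Suc i / J then 1 else 0))))"
  proof (rule sum_mono)
    fix p assume "p \<in> ?P"
    hence p: "p \<ge> 1" "p \<le> q" using prime_gt_0_nat[of p] by auto
    hence "0 \<le> ln (real p) / ?L" "ln (real p) / ?L \<le> 1" "?a p \<ge> 0" using L by auto
    thus "?a p * W (ln (real p) / ?L) \<le> ?a p * (W 1 + (\<Sum>i<J. ?D i * (if ln (real p) / ?L \<le> Suc i / J then 1 else 0)))"
      by (intro mult_left_mono step_function_majorant anti J)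
  qed
  also have "\<dots> = W 1 * (\<Sum>p\<in>?P. ?a p) + (\<Sum>i<J. ?D i * (\<Sum>p\<in>?P. ?a p * (if ln (real p) / ?L \<le> Suc i / J then 1 else 0)))"
    unfolding distrib_left sum.distrib sum_distrib_left by (subst (2) sum.swap) (simp add: mult_ac)
  also have "\<dots> \<le> W 1 * (?L + ln 4) + (\<Sum>i<J. ?D i * (Suc i / J * ?L + ln 4))"
  proof (intro add_mono sum_mono mult_left_mono A W1 D)
    show "(\<Sum>p\<in>?P. ?a p) \<le> ?L + ln 4" using sum_ln_prime_div_le[of q] q by simp
  qed (use J in \<open>auto simp: divide_simps\<close>)
  also have "\<dots> = ?L * (W 1 + (\<Sum>i<J. ?D i * (Suc i / J))) + ln 4 * (W 1 + (\<Sum>i<J. ?D i))"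
    unfolding distrib_left sum.distrib sum_distrib_left by (simp add: algebra_simps sum_distrib_left)
  also have "(\<Sum>i<n. ?D i) = W 0 - W (n / J)" for n :: nat by (induction n) auto
  also have "(\<Sum>i<n. ?D i * (Suc i / J)) = (\<Sum>i<n. W (i / J)) / J - W (n / J) * (n / J)" for n :: nat
   
    using J by (induction n) (auto simp: field_simps)
  finally show ?thesis using J by simp
qed

text \<open>A Taylor polynomial majorant of \<open>(1 - exp (-2 * u)) / u\<close>; the \<open>2\<close> comes from comparing with
  the zeta function at \<open>1 + 2 / ln q\<close>.\<close>

definition weight_poly :: "real \<Rightarrow> real" where
  "weight_poly u = 2 - 2 * u + 4 / 3 * u ^ 2 - 2 / 3 * u ^ 3 + 4 / 15 * u ^ 4"

lemma weight_poly_antimono: assumes "0 \<le> u" "u \<le> v" "v \<le> 1" shows "weight_poly v \<le> weight_poly u"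
proof (rule DERIV_nonpos_imp_nonincreasing[OF assms(2)])
  fix x :: real assume x: "u \<le> x" "x \<le> v"
  have "(weight_poly has_real_derivative (-2 + 8 / 3 * x - 2 * x ^ 2 + 16 / 15 * x ^ 3)) (at x)"
    unfolding weight_poly_def by (auto intro!: derivative_eq_intros simp: power3_eq_cube power2_eq_square)
  moreover have "-2 + 8 / 3 * x - 2 * x ^ 2 + 16 / 15 * x ^ 3 \<le> 0"
  proof -
    have "0 \<le> x" "x \<le> 1" using x assms by auto
    hence "x ^ 3 \<le> x ^ 2" by (simp add: power3_eq_cube power2_eq_square mult_left_le)
    \<comment> \<open>With \<open>x ^ 3\<close> replaced by \<open>x ^ 2\<close> there remains
      \<open>-2 + 8 / 3 * x - 14 / 15 * x ^ 2\<close>; this square completes it and shows that it is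
      at most \<open>-2 / 21\<close>.\<close>
    moreover have "0 \<le> (14 * x - 20) ^ 2" by simp
    hence "14 * x ^ 2 \<ge> 40 * x - 200 / 7" by (simp add: power2_eq_square algebra_simps)
    ultimately show ?thesis by linarith
  qed
  ultimately show "\<exists>y. (weight_poly has_real_derivative y) (at x) \<and> y \<le> 0" by blast
qed

text \<open>The expansion of \<open>exp (-x)\<close> with remainder of order 6 has a nonnegative
  remainder, so the Taylor polynomial of degree 5 is a lower bound; put
  \<open>x = 2 * u\<close>.\<close>

lemma one_minus_exp_le_weight_poly:
  assumes "0 \<le> u" shows "1 - exp (-2 * u) \<le> u * weight_poly u"
proof -
  have "exp (-x) \<ge> 1 - x + x^2/2 - x^3/6 + x^4/24 - x^5/120" if "x \<ge> 0" for x :: real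
  proof -
    obtain t where "exp (-x) = (\<Sum>m<6. (-x) ^ m / fact m) + exp t / fact 6 * (-x) ^ 6"
      using Maclaurin_exp_le[of "-x" 6] by blast
    moreover have "exp t / fact 6 * (-x) ^ 6 \<ge> 0" by (intro mult_nonneg_nonneg zero_le_even_power) auto
    ultimately have "exp (-x) \<ge> (\<Sum>m<6. (-x) ^ m / fact m)" by linarith
    thus ?thesis by (simp add: eval_nat_numeral field_simps)
  qed
  from this[of "2 * u"] show ?thesis using assms
    by (simp add: weight_poly_def field_simps eval_nat_numeral)
qed

text \<open>The integral of \<open>weight_poly\<close> over the unit interval is about 1.331. Twenty
  cells bring the left Riemann sum below 1.36; the room is small, as \<open>ln 4\<close> is about
  1.386.\<close>

lemma weight_poly_average: "(\<Sum>i<20. weight_poly (real i / 20)) / 20 \<le> 136 / 100"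
  by (simp add: weight_poly_def eval_nat_numeral)

text \<open>Since \<open>136 / 100 = 64 * (17 / 800)\<close>, the quadratic bound is applied to an
  argument small enough for it to be sharp. The value 4 is what makes
  \<open>exp (136 / 100) / 2\<close> less than 2.\<close>

lemma exp_136: "exp (136 / 100 :: real) < 4"
proof -
  have "exp (136 / 100) = exp (17 / 800 :: real) ^ 64" by (simp flip: exp_of_nat_mult)
  also have "exp (17 / 800 :: real) \<le> 1 + 17 / 800 + (17 / 800) ^ 2"
    by (rule exp_bound) auto
  hence "exp (17 / 800 :: real) ^ 64 \<le> (1 + 17 / 800 + (17 / 800) ^ 2) ^ 64"
    by (intro power_mono) auto
  also have "\<dots> < 4" by (simp add: power_divide)
  finally show ?thesis .
qed

lemma summable_ln_div: "summable (\<lambda>n. ln (real n) / (real n * (real n - 1)))"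
proof (rule summable_comparison_test_ev)
  show "eventually (\<lambda>n. norm (ln (real n) / (real n * (real n - 1))) \<le> real n powr (-1 - 1/2)) sequentially"
    unfolding real_norm_def by real_asymp
qed (rule summable_nat_powr, simp)

lemma Theta_nat: "Theta (real q) = (\<Prod>p | prime p \<and> p \<le> q. 1 - 1 / real p)"
  unfolding Theta_def by simp

lemma Theta_pos: "Theta (real q) > 0"
  unfolding Theta_nat
proof (intro prod_pos)
  fix p assume "p \<in> {p. prime p \<and> p \<le> q}"
  hence "p \<ge> 2" using prime_ge_2_nat by auto
  thus "0 < 1 - 1 / real p" by simp
qed

text \<open>Mertens' constant here is \<open>exp euler_mascheroni\<close>, about \<open>1.78\<close>; only a bound of at most \<open>2\<close> is
  needed to push the next prime after \<open>sieve_level t\<close> beyond \<open>sqrt t\<close>.\<close>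

lemma eventually_inverse_Theta_le:
  "eventually (\<lambda>q::nat. inverse (Theta (real q)) \<le> 2 * ln (real q)) sequentially"
proof -
  define Z where "Z = (\<Sum>n. ln (real n) / (real n * (real n - 1)))"
  define C where "C = 2 * ln 4 + 2 * Z"
  have bound: "inverse (Theta (real q)) \<le> (1 + ln q / 2) * exp (136 / 100 + C / ln q)" if q: "q \<ge> 2" for q :: nat
  proof -
    define L where "L = ln (real q)"
    \<comment> \<open>This choice turns the zeta bound \<open>1 + 1 / s\<close> into
      \<open>1 + ln q / 2\<close>, half a logarithm, at the cost of the correction factors
      \<open>?r\<close>.\<close>
    define s where "s = 2 / L"
    let ?P = "{p. prime p \<and> p \<le> q}"
    have L: "L > 0" using q by (simp add: L_def)
    have s: "s > 0" using L by (simp add: s_def)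
    have p2: "real p \<ge> 2" if "p \<in> ?P" for p using that prime_ge_2_nat[of p] by auto
    \<comment> \<open>The quotient of the Euler factors at \<open>1 + s\<close> and at 1. It equals
      \<open>1 + e / (p - 1)\<close> with \<open>e = 1 - p powr (-s)\<close>, which is small for
      primes small against \<open>q\<close>. The part \<open>e / p\<close> is summed with
      \<open>weight_poly\<close>, the rest is absorbed by the convergent series
      \<open>Z\<close>.\<close>
    let ?r = "\<lambda>p::nat. (1 - real p powr (-1 - s)) / (1 - 1 / real p)"
    have rb: "?r p \<le> exp (ln (real p) / real p * weight_poly (ln (real p) / L) / L + 2 / L * (ln (real p) / (real p * (real p - 1))))" 
      "?r p > 0" if "p \<in> ?P" for p
    proof -
      have p: "real p \<ge> 2" using p2 that by auto
      define e where "e = 1 - real p powr (-s)"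
      have "real p powr (-s) = exp (-2 * (ln (real p) / L))" using p by (simp add: powr_def s_def)
      hence e1: "e \<le> ln (real p) / L * weight_poly (ln (real p) / L)" unfolding e_def
        using one_minus_exp_le_weight_poly[of "ln (real p) / L"] p L by simp
      have "weight_poly (ln (real p) / L) \<le> weight_poly 0" using p L that by (intro weight_poly_antimono) (auto simp: L_def)
      hence "ln (real p) / L * weight_poly (ln (real p) / L) \<le> ln (real p) / L * 2"
        using p L by (intro mult_left_mono) (auto simp: weight_poly_def)
      hence e2: "e \<le> 2 * ln (real p) / L" using e1 by (simp add: mult.commute)
      have e0: "e > 0" unfolding e_def using p s by (simp add: powr_less_one)
      have pw: "real p powr (-1 - s) = (1 - e) / real p" using p by (simp add: e_def powr_diff powr_minus field_simps)
      have req: "?r p = 1 + e / (real p - 1)" using p unfolding pw by (simp add: field_simps)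
      show "?r p > 0" unfolding req using e0 p by (intro add_pos_pos divide_pos_pos) auto
      have "?r p \<le> exp (e / (real p - 1))" unfolding req by (rule exp_ge_add_one_self)
      also have "e / (real p - 1) = e / real p + e / (real p * (real p - 1))"
        using p by (simp add: field_simps)
      also have "e / real p \<le> ln (real p) / L * weight_poly (ln (real p) / L) / real p"
        using p e1 by (intro divide_right_mono) auto
      also have "\<dots> = ln (real p) / real p * weight_poly (ln (real p) / L) / L" by simp
      also have "e / (real p * (real p - 1)) \<le> 2 * ln (real p) / L / (real p * (real p - 1))"
        using p e2 by (intro divide_right_mono) auto
      also have "\<dots> = 2 / L * (ln (real p) / (real p * (real p - 1)))" by simp
      finally show "?r p \<le> exp (ln (real p) / real p * weight_poly (ln (real p) / L) / L + 2 / L * (ln (real p) / (real p * (real p - 1))))"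
        by simp
    qed
    have "(\<Prod>p\<in>?P. ?r p) \<le> (\<Prod>p\<in>?P. exp (ln (real p) / real p * weight_poly (ln (real p) / L) / L + 2 / L * (ln (real p) / (real p * (real p - 1)))))"
      using rb by (intro prod_mono) (auto intro: less_imp_le)
    also have "\<dots> = exp ((\<Sum>p\<in>?P. ln (real p) / real p * weight_poly (ln (real p) / L)) / L + 2 / L * (\<Sum>p\<in>?P. ln (real p) / (real p * (real p - 1))))"
      by (subst exp_sum[symmetric]) (auto simp: sum.distrib sum_distrib_left sum_divide_distrib)
    also have "\<dots> \<le> exp ((L * (136 / 100) + ln 4 * 2) / L + 2 / L * Z)"
    proof (subst exp_le_cancel_iff, intro add_mono divide_right_mono mult_left_mono)
      have "(\<Sum>p\<in>?P. ln (real p) / real p * weight_poly (ln (real p) / L)) \<le> L * ((\<Sum>i<20. weight_poly (real i / real 20)) / real 20) + ln 4 * weight_poly 0"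
        unfolding L_def by (rule sum_ln_prime_weighted_le) (use q weight_poly_antimono in \<open>auto simp: weight_poly_def\<close>)
      also have "\<dots> \<le> L * (136 / 100) + ln 4 * 2"
        using weight_poly_average L by (intro add_mono mult_left_mono) (auto simp: weight_poly_def)
      finally show "(\<Sum>p\<in>?P. ln (real p) / real p * weight_poly (ln (real p) / L)) \<le> L * (136 / 100) + ln 4 * 2" .
      show "(\<Sum>p\<in>?P. ln (real p) / (real p * (real p - 1))) \<le> Z" unfolding Z_def
      proof (intro sum_le_suminf summable_ln_div ballI)
        fix n :: nat show "0 \<le> ln (real n) / (real n * (real n - 1))"
          by (cases "n = 0") (auto intro!: divide_nonneg_nonneg mult_nonneg_nonneg)
      qed auto
    qed (use L in auto)
    also have "(L * (136 / 100) + ln 4 * 2) / L + 2 / L * Z = 136 / 100 + C / L"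
      using L by (simp add: C_def field_simps)
    finally have 1: "(\<Prod>p\<in>?P. ?r p) \<le> exp (136 / 100 + C / L)" .
    have Tpos: "Theta (real q) > 0" by (rule Theta_pos)
    have "(\<Prod>p\<in>?P. ?r p) = (\<Prod>p\<in>?P. 1 - real p powr (-1 - s)) / Theta (real q)"
      unfolding Theta_nat by (rule prod_dividef)
    hence eq: "(\<Prod>p\<in>?P. 1 - real p powr (-1 - s)) = (\<Prod>p\<in>?P. ?r p) * Theta (real q)" using Tpos by simp
    have "1 \<le> (\<Prod>p\<in>?P. 1 - real p powr (-1 - s)) * (1 + 1 / s)" by (rule prod_euler_factor_ge[OF s]) auto
    also have "\<dots> = (\<Prod>p\<in>?P. ?r p) * (Theta (real q) * (1 + 1 / s))" unfolding eq by simp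
    also have "\<dots> \<le> exp (136 / 100 + C / L) * (Theta (real q) * (1 + 1 / s))"
      using Tpos s by (intro mult_right_mono 1) auto
    finally show ?thesis using Tpos L by (simp add: s_def field_simps L_def)
  qed
  have "((\<lambda>q::nat. (1 / ln q + 1 / 2) * exp (136 / 100 + C / ln q)) \<longlongrightarrow> (0 + 1 / 2) * exp (136 / 100 + 0)) sequentially"
    by (intro tendsto_intros; real_asymp)
  moreover have "(0 + 1 / 2) * exp (136 / 100 + 0 :: real) < 2" using exp_136 by simp
  ultimately have "eventually (\<lambda>q::nat. (1 / ln q + 1 / 2) * exp (136 / 100 + C / ln q) < 2) sequentially"
    by (rule order_tendstoD)
  moreover have "eventually (\<lambda>q::nat. q \<ge> 2) sequentially" by (rule eventually_ge_at_top)
  ultimately show ?thesis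
  proof eventually_elim
    case (elim q)
    hence "ln (real q) > 0" by simp
    have "(1 + ln q / 2) * exp (136 / 100 + C / ln q) = ln q * ((1 / ln q + 1 / 2) * exp (136 / 100 + C / ln q))"
      using \<open>ln (real q) > 0\<close> by (simp add: field_simps)
    also have "\<dots> \<le> ln q * 2" using elim \<open>ln (real q) > 0\<close> by (intro mult_left_mono) auto
    finally show ?case using bound[of q] elim by simp
  qed
qed

text \<open>Euler's argument: the product over \<open>p \<le> q\<close> dominates the sum of
  \<open>1 / n\<close> over all integers composed of these primes, and these include every
  \<open>n\<close> up to \<open>q\<close>.\<close>

lemma ln_le_inverse_Theta:
  assumes "q \<ge> 1"
  shows "ln (real q) \<le> inverse (Theta (real q))"
proof -
  have *: "(\<Sum>n\<in>{n\<in>{1..N}. \<forall>p. prime p \<longrightarrow> p dvd n \<longrightarrow> p \<in> P}. 1 / real n) \<le> inverse (\<Prod>p\<in>P. 1 - 1 / real p)"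
    if "finite P" "\<And>p. p \<in> P \<Longrightarrow> prime p" for N and P :: "nat set"
    using that
  proof (induction P rule: finite_induct)
    case empty
    have "{n\<in>{1..N}. \<forall>p. prime p \<longrightarrow> p dvd n \<longrightarrow> p \<in> {}} \<subseteq> {1}"
      using prime_factor_nat by auto
    hence "(\<Sum>n\<in>{n\<in>{1..N}. \<forall>p. prime p \<longrightarrow> p dvd n \<longrightarrow> p \<in> {}}. 1 / real n) \<le> (\<Sum>n\<in>{1}. 1 / real n)"
      by (intro sum_mono2) auto
    thus ?case by simp
  next
    case (insert p P)
    let ?A = "\<lambda>P. {n\<in>{1..N}. \<forall>p. prime p \<longrightarrow> p dvd n \<longrightarrow> p \<in> P}"
    have p: "prime p" "p \<ge> 2" using insert.prems prime_ge_2_nat by auto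
    \<comment> \<open>Dividing a multiple of \<open>p\<close> by \<open>p\<close> stays within the
      same set. Hence the sum is at most the sum for \<open>P\<close> plus \<open>1 / p\<close>
      times itself, and \<open>1 - 1 / p\<close> can be divided out.\<close>
    have sub: "?A (insert p P) \<subseteq> ?A P \<union> (\<lambda>n. p * n) ` ?A (insert p P)"
    proof
      fix n assume n: "n \<in> ?A (insert p P)"
      show "n \<in> ?A P \<union> (\<lambda>n. p * n) ` ?A (insert p P)"
      proof (cases "p dvd n")
        case True
        then obtain m where m: "n = p * m" by auto
        have "m \<in> ?A (insert p P)" using n p m le_trans[of m "p * m" N] by auto
        thus ?thesis using m by blast
      qed (use n in auto)
    qed
    have "(\<Sum>n\<in>?A (insert p P). 1 / real n) \<le> (\<Sum>n\<in>?A P \<union> (\<lambda>n. p * n) ` ?A (insert p P). 1 / real n)"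
      by (intro sum_mono2 sub) auto
    also have "\<dots> \<le> (\<Sum>n\<in>?A P. 1 / real n) + (\<Sum>n\<in>(\<lambda>n. p * n) ` ?A (insert p P). 1 / real n)"
      by (subst sum_Un) (auto intro!: sum_nonneg)
    also have "(\<Sum>n\<in>(\<lambda>n. p * n) ` ?A (insert p P). 1 / real n) = (\<Sum>n\<in>?A (insert p P). 1 / real n) / p"
      using p by (subst sum.reindex) (auto simp: inj_on_def sum_divide_distrib mult.commute)
    also have "(\<Sum>n\<in>?A P. 1 / real n) \<le> inverse (\<Prod>p\<in>P. 1 - 1 / real p)" using insert by auto
    finally have "(\<Sum>n\<in>?A (insert p P). 1 / real n) * (1 - 1 / p) \<le> inverse (\<Prod>p\<in>P. 1 - 1 / real p)"
      by (simp add: algebra_simps)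
    moreover have "1 - 1 / real p > 0" using p by simp
    ultimately have "(\<Sum>n\<in>?A (insert p P). 1 / real n) \<le> inverse (\<Prod>p\<in>P. 1 - 1 / real p) / (1 - 1 / p)"
      by (simp add: pos_le_divide_eq)
    thus ?case using insert.hyps by (simp add: divide_inverse mult.commute)
  qed
  have "ln (real q) \<le> harm q"
    using ln_le_harm[of q] assms by (smt (verit) ln_less_cancel_iff of_nat_0_less_iff zero_less_one less_le_trans)
  also have "harm q = (\<Sum>n=1..q. 1 / real n)" by (simp add: harm_def inverse_eq_divide)
  also have "{1..q} = {n\<in>{1..q}. \<forall>p. prime p \<longrightarrow> p dvd n \<longrightarrow> p \<in> {p. prime p \<and> p \<le> q}}"
    by (auto dest: dvd_imp_le)
  also have "(\<Sum>n\<in>\<dots>. 1 / real n) \<le> inverse (\<Prod>p | prime p \<and> p \<le> q. 1 - 1 / real p)"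
    by (rule *) auto
  finally show ?thesis unfolding Theta_nat .
qed

lemma Theta_antimono:
  assumes "q \<le> r" shows "Theta (real r) \<le> Theta (real q)"
proof -
  let ?A = "{p. prime p \<and> p \<le> q}" and ?B = "{p. prime p \<and> p \<le> r}"
  have "Theta (real r) = (\<Prod>p\<in>?B - ?A. 1 - 1 / real p) * Theta (real q)"
    unfolding Theta_nat using assms by (intro prod.subset_diff) auto
  also have "(\<Prod>p\<in>?B - ?A. 1 - 1 / real p) \<le> 1"
    by (intro prod_le_1) (auto dest: prime_gt_0_nat)
  finally show ?thesis using Theta_pos[of q] by (simp add: mult_le_cancel_right1)
qed

section \<open>Existence and size of the sieving level\<close>

context
  fixes t :: real
  assumes t: "t \<ge> exp 2"
begin

text \<open>Bounds the primes among which \<open>GREATEST\<close> chooses; together with the prime 2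
  as a member this gives \<open>sieve_level\<close> its meaning.\<close>

lemma sieve_level_bound:
  assumes "prime q" "inverse (Theta (real q)) \<le> ln t"
  shows "real q \<le> t"
proof -
  have "q \<ge> 1" using assms(1) prime_gt_0_nat[of q] by simp
  have "t > 0" using t exp_gt_zero[of 2] by linarith
  have "ln (real q) \<le> ln t" using ln_le_inverse_Theta[OF \<open>q \<ge> 1\<close>] assms(2) by linarith
  thus ?thesis using \<open>q \<ge> 1\<close> \<open>t > 0\<close> by (subst (asm) ln_le_cancel_iff) auto
qed

lemma sieve_level_props:
  "prime (sieve_level t) \<and> inverse (Theta (real (sieve_level t))) \<le> ln t"
  unfolding sieve_level_def
proof (rule GreatestI_nat)
  have "{p. prime p \<and> p \<le> (2::nat)} = {2}" by (auto dest: prime_ge_2_nat intro: antisym)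
  hence T: "Theta (real 2) = 1 / 2" unfolding Theta_nat by simp
  have "ln t \<ge> 2" using t by (metis exp_gt_zero ln_exp ln_mono less_le_trans)
  thus "prime (2::nat) \<and> inverse (Theta (real 2)) \<le> ln t" unfolding T by simp
next
  fix q :: nat assume "prime q \<and> inverse (Theta (real q)) \<le> ln t"
  thus "q \<le> nat \<lfloor>t\<rfloor>" using sieve_level_bound[of q] by (simp add: le_nat_floor)
qed

lemma le_sieve_level:
  assumes "prime q" "inverse (Theta (real q)) \<le> ln t"
  shows "q \<le> sieve_level t"
  unfolding sieve_level_def
proof (rule Greatest_le_nat)
  fix q :: nat assume "prime q \<and> inverse (Theta (real q)) \<le> ln t"
  thus "q \<le> nat \<lfloor>t\<rfloor>" using sieve_level_bound[of q] by (simp add: le_nat_floor)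
qed (use assms in auto)

lemma sieve_level_le: "real (sieve_level t) \<le> t"
  using sieve_level_bound sieve_level_props by blast

end

lemma sieve_level_mono:
  assumes "exp 2 \<le> t" "t \<le> u"
  shows "sieve_level t \<le> sieve_level u"
proof -
  have "t > 0" using assms exp_gt_zero[of 2] by linarith
  hence "ln t \<le> ln u" using assms by (subst ln_le_cancel_iff) auto
  thus ?thesis using sieve_level_props[OF assms(1)] assms by (intro le_sieve_level) auto
qed

text \<open>\<open>Theta\<close> passes \<open>1 / ln t\<close> between the level and the next prime
  \<open>q\<close>, that is, within the single factor \<open>1 - 1 / q\<close>; so at the level it
  matches \<open>1 / ln t\<close> up to a relative error of order \<open>1 / q\<close>. From
  \<open>ln t < inverse (Theta q)\<close> and \<open>inverse (Theta q) \<le> 2 * ln q\<close> it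
  follows that \<open>q\<close> is at least \<open>sqrt t\<close>.\<close>

lemma eventually_sieve_level_next_prime:
  "eventually (\<lambda>t. \<exists>q. prime q \<and> q > sieve_level t \<and> (\<forall>p. prime p \<longrightarrow> p > sieve_level t \<longrightarrow> p \<ge> q) \<and>
      real q \<ge> sqrt t \<and> 1 / ln t \<le> Theta (sieve_level t) \<and> Theta (sieve_level t) * (1 - 1 / q) \<le> 1 / ln t) at_top"
proof -
  obtain q0 where q0: "\<And>q. q \<ge> q0 \<Longrightarrow> inverse (Theta (real q)) \<le> 2 * ln (real q)"
    using eventually_inverse_Theta_le unfolding eventually_sequentially by blast
  have "eventually (\<lambda>t. ln t \<ge> inverse (Theta (real q0))) at_top" by real_asymp
  moreover have "eventually (\<lambda>t. t \<ge> exp (2::real)) at_top" by (rule eventually_ge_at_top)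
  ultimately show ?thesis
  proof eventually_elim
    case (elim t)
    have t: "t > 1" using elim(2) by (smt (verit) exp_gt_one)
    have lnt: "ln t > 0" using t by simp
    define z where "z = sieve_level t"
    define q where "q = (LEAST q. prime q \<and> q > z)"
    have q: "prime q" "q > z" unfolding q_def using LeastI_ex[OF bigger_prime[of z]] by auto
    have qmin: "p \<ge> q" if "prime p" "p > z" for p unfolding q_def using that by (intro Least_le) auto
    have z: "prime z" "inverse (Theta (real z)) \<le> ln t" using sieve_level_props[OF elim(2)] by (auto simp: z_def)
    have gt: "inverse (Theta (real q)) > ln t"
      using le_sieve_level[OF elim(2), of q] q unfolding z_def by fastforce
    \<comment> \<open>The bound with constant 2 is available only from \<open>q0\<close> on; a
      smaller \<open>q\<close> would have
      \<open>inverse (Theta q) \<le> inverse (Theta q0) \<le> ln t\<close> by monotonicity.\<close>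
    have "q \<ge> q0"
    proof (rule ccontr)
      assume "\<not> q \<ge> q0"
      hence "Theta (real q0) \<le> Theta (real q)" by (intro Theta_antimono) auto
      hence "inverse (Theta (real q)) \<le> inverse (Theta (real q0))" using Theta_pos by (intro le_imp_inverse_le) auto
      thus False using gt elim by linarith
    qed
    hence "ln t \<le> 2 * ln (real q)" using q0[of q] gt by linarith
    also have "2 * ln (real q) = ln (real q ^ 2)" using q prime_gt_0_nat[of q] by (simp add: ln_realpow)
    finally have "t \<le> real q ^ 2" using t prime_gt_0_nat[of q] q by (subst (asm) ln_le_cancel_iff) auto
    hence "sqrt t \<le> real q" by (intro real_le_lsqrt) (use t in auto)
    moreover have "Theta (real q) = Theta (real z) * (1 - 1 / q)"
    proof -
      have "{p. prime p \<and> p \<le> q} = insert q {p. prime p \<and> p \<le> z}"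
        using q qmin by (auto simp: not_less) (metis le_antisym not_le_imp_less)
      thus ?thesis unfolding Theta_nat using q by (simp add: mult.commute)
    qed
    moreover have "Theta (real q) \<le> 1 / ln t" using gt Theta_pos[of q] lnt by (simp add: field_simps)
    moreover have "1 / ln t \<le> Theta (real z)" using z Theta_pos[of z] lnt by (simp add: field_simps)
    ultimately show ?case using q qmin unfolding z_def by (intro exI[of _ q]) auto
  qed
qed

section \<open>Correlations of sieved sets\<close>

text \<open>The expansion of \<open>\<Prod>p\<in>P. 1 + f p\<close> is cut as soon as the next prime would push the product of the
  chosen primes beyond \<open>Q\<close>; the remaining factors are not expanded but absorbed by the weights \<open>w\<close>.\<close>

lemma prod_decomposition_bound:
  fixes f w :: "nat \<Rightarrow> real" and Q :: real
  assumes "finite P" and "\<And>p. p \<in> P \<Longrightarrow> 0 \<le> w p \<and> w p \<le> 1 \<and> 0 \<le> w p * (1 + f p) \<and> w p * (1 + f p) \<le> 1"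
    and "Q \<ge> 1" and "\<And>p. p \<in> P \<Longrightarrow> p \<ge> 1"
  shows "(\<Prod>p\<in>P. w p) * \<bar>(\<Prod>p\<in>P. 1 + f p) - (\<Sum>S | S \<subseteq> P \<and> real (\<Prod>S) \<le> Q. \<Prod>p\<in>S. f p)\<bar> \<le>
           (\<Sum>S | S \<subseteq> P \<and> real (\<Prod>S) \<le> Q. (\<Prod>p\<in>S. \<bar>f p\<bar>) * (\<Sum>p | p \<in> P \<and> Q < real p * real (\<Prod>S). \<bar>f p\<bar>))"
  using assms(1,2,4)
proof (induction P rule: finite_induct)
  case empty
  have "{S. S = {} \<and> real (\<Prod>S) \<le> Q} = {{}}" using assms(3) by auto
  thus ?case by simp
next
  case (insert r P)
  let ?F = "\<lambda>S. \<Prod>p\<in>S. f p" and ?Fa = "\<lambda>S. \<Prod>p\<in>S. \<bar>f p\<bar>"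
  let ?A = "\<lambda>P. {S. S \<subseteq> P \<and> real (\<Prod>S) \<le> Q}"
  let ?T = "\<lambda>P S. \<Sum>p | p \<in> P \<and> Q < real p * real (\<Prod>S). \<bar>f p\<bar>"
  define G where "G = (\<Sum>S\<in>?A P. ?F S)"
  define E where "E = (\<Prod>p\<in>P. 1 + f p) - G"
  \<comment> \<open>\<open>B\<close> holds the sets that fill the cutoff so far that
    \<open>r\<close> no longer fits, \<open>B'\<close> those that may be enlarged by
    \<open>r\<close>.\<close>
  define B where "B = {S. S \<subseteq> P \<and> real (\<Prod>S) \<le> Q \<and> Q < real r * real (\<Prod>S)}"
  define B' where "B' = {S. S \<subseteq> P \<and> real (\<Prod>S) \<le> Q \<and> real r * real (\<Prod>S) \<le> Q}"
  have fin: "finite (?A P)" using insert by auto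
  have finB: "finite B" "finite B'" using insert by (auto simp: B_def B'_def)
  have r: "r \<ge> 1" "r \<notin> P" using insert by auto
  have prodins: "real (\<Prod>(insert r S)) = real r * real (\<Prod>S)" if "S \<subseteq> P" for S
  proof -
    have "finite S" "r \<notin> S" using that insert finite_subset by auto
    thus ?thesis by simp
  qed
  have Fins: "?F (insert r S) = f r * ?F S" if "S \<subseteq> P" for S
  proof -
    have "finite S" "r \<notin> S" using that insert finite_subset by auto
    thus ?thesis by simp
  qed
  have Aeq: "?A (insert r P) = ?A P \<union> insert r ` B'"
  proof (intro equalityI subsetI)
    fix S assume S: "S \<in> ?A (insert r P)"
    show "S \<in> ?A P \<union> insert r ` B'"
    proof (cases "r \<in> S")
      case True
      let ?S = "S - {r}"
      have S': "?S \<subseteq> P" "S = insert r ?S" using S True by auto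
      have "real r * real (\<Prod>?S) \<le> Q" using prodins[OF S'(1)] S S'(2) by auto
      moreover have "1 * real (\<Prod>?S) \<le> real r * real (\<Prod>?S)" using r by (intro mult_right_mono of_nat_0_le_iff) auto
      ultimately have "?S \<in> B'" using S'(1) unfolding B'_def by auto
      thus ?thesis using S'(2) by blast
    qed (use S in auto)
  next
    fix S assume "S \<in> ?A P \<union> insert r ` B'"
    thus "S \<in> ?A (insert r P)" using prodins unfolding B'_def by auto
  qed
  have "(\<Sum>S\<in>?A (insert r P). ?F S) = G + (\<Sum>S\<in>insert r ` B'. ?F S)"
    unfolding Aeq G_def using fin finB r by (intro sum.union_disjoint) auto
  also have "(\<Sum>S\<in>insert r ` B'. ?F S) = (\<Sum>S\<in>B'. f r * ?F S)"
  proof (subst sum.reindex)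
    show "inj_on (insert r) B'" using r by (auto simp: inj_on_def B'_def)
    show "sum (?F \<circ> insert r) B' = (\<Sum>S\<in>B'. f r * ?F S)" using Fins by (intro sum.cong) (auto simp: B'_def)
  qed
  also have "\<dots> = f r * G - f r * (\<Sum>S\<in>B. ?F S)"
  proof -
    have "?A P = B \<union> B'" "B \<inter> B' = {}" by (auto simp: B_def B'_def)
    hence "G = (\<Sum>S\<in>B. ?F S) + (\<Sum>S\<in>B'. ?F S)" unfolding G_def using finB by (simp add: sum.union_disjoint)
    thus ?thesis by (simp add: sum_distrib_left algebra_simps)
  qed
  finally have G': "(\<Sum>S\<in>?A (insert r P). ?F S) = (1 + f r) * G - f r * (\<Sum>S\<in>B. ?F S)" by (simp add: algebra_simps)
  have wP: "0 \<le> (\<Prod>p\<in>P. w p)" "(\<Prod>p\<in>P. w p) \<le> 1" using insert.prems by (auto intro!: prod_nonneg prod_le_1)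
  have wr: "0 \<le> w r" "w r \<le> 1" "0 \<le> w r * (1 + f r)" "w r * (1 + f r) \<le> 1" using insert.prems by auto
  have IH: "(\<Prod>p\<in>P. w p) * \<bar>E\<bar> \<le> (\<Sum>S\<in>?A P. ?Fa S * ?T P S)"
    unfolding E_def G_def using insert by auto
  \<comment> \<open>When \<open>r\<close> is added, the old error is multiplied by
    \<open>1 + f r\<close>, which \<open>w r\<close> compensates, and the sets in \<open>B\<close>
    leave a new error. The latter is exactly what the inner sum on the right gains from
    \<open>r\<close>.\<close>
  have E': "(\<Prod>p\<in>insert r P. 1 + f p) - (\<Sum>S\<in>?A (insert r P). ?F S) = (1 + f r) * E + f r * (\<Sum>S\<in>B. ?F S)"
    unfolding G' E_def using insert.hyps by (simp add: algebra_simps)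
  have "(\<Prod>p\<in>insert r P. w p) * \<bar>(1 + f r) * E + f r * (\<Sum>S\<in>B. ?F S)\<bar> 
      = \<bar>(w r * (1 + f r)) * ((\<Prod>p\<in>P. w p) * E) + (w r * (\<Prod>p\<in>P. w p)) * (f r * (\<Sum>S\<in>B. ?F S))\<bar>"
  proof -
    have "(\<Prod>p\<in>insert r P. w p) * \<bar>(1 + f r) * E + f r * (\<Sum>S\<in>B. ?F S)\<bar> =
      \<bar>(w r * (\<Prod>p\<in>P. w p)) * ((1 + f r) * E + f r * (\<Sum>S\<in>B. ?F S))\<bar>"
      using insert.hyps wr wP by (simp add: abs_mult)
    thus ?thesis by (simp add: distrib_left mult_ac)
  qed
  also have "\<dots> \<le> \<bar>(w r * (1 + f r)) * ((\<Prod>p\<in>P. w p) * E)\<bar> + \<bar>(w r * (\<Prod>p\<in>P. w p)) * (f r * (\<Sum>S\<in>B. ?F S))\<bar>"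
    by (rule abs_triangle_ineq)
  also have "\<bar>(w r * (1 + f r)) * ((\<Prod>p\<in>P. w p) * E)\<bar> \<le> 1 * ((\<Prod>p\<in>P. w p) * \<bar>E\<bar>)"
    unfolding abs_mult[of "w r * (1 + f r)"] using wr wP by (intro mult_mono) (auto simp: abs_mult)
  also have "\<dots> \<le> (\<Sum>S\<in>?A P. ?Fa S * ?T P S)" using IH by simp
  also have "\<bar>(w r * (\<Prod>p\<in>P. w p)) * (f r * (\<Sum>S\<in>B. ?F S))\<bar> \<le> 1 * (\<bar>f r\<bar> * (\<Sum>S\<in>B. ?Fa S))"
    unfolding abs_mult[of "w r * (\<Prod>p\<in>P. w p)"] abs_mult[of "f r"]
  proof (intro mult_mono order.refl)
    show "\<bar>w r * (\<Prod>p\<in>P. w p)\<bar> \<le> 1" using wr wP by (simp add: mult_le_one)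
    show "\<bar>\<Sum>S\<in>B. ?F S\<bar> \<le> (\<Sum>S\<in>B. ?Fa S)" by (intro sum_abs[THEN order_trans]) (simp add: abs_prod)
  qed auto
  also have "(\<Sum>S\<in>?A P. ?Fa S * ?T P S) + 1 * (\<bar>f r\<bar> * (\<Sum>S\<in>B. ?Fa S)) = (\<Sum>S\<in>?A P. ?Fa S * ?T (insert r P) S)"
  proof -
    have "?T (insert r P) S = ?T P S + (if Q < real r * real (\<Prod>S) then \<bar>f r\<bar> else 0)" for S
    proof (cases "Q < real r * real (\<Prod>S)")
      case True
      hence "{p. p \<in> insert r P \<and> Q < real p * real (\<Prod>S)} = insert r {p. p \<in> P \<and> Q < real p * real (\<Prod>S)}" by auto
      thus ?thesis using True insert.hyps by simp
    next
      case False
      hence "{p. p \<in> insert r P \<and> Q < real p * real (\<Prod>S)} = {p. p \<in> P \<and> Q < real p * real (\<Prod>S)}" by auto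
      thus ?thesis using False by simp
    qed
    hence "?Fa S * ?T (insert r P) S = ?Fa S * ?T P S + (if Q < real r * real (\<Prod>S) then ?Fa S * \<bar>f r\<bar> else 0)" for S
      by (simp only: distrib_left if_distrib[of "\<lambda>x. ?Fa S * x"] mult_zero_right)
    hence "(\<Sum>S\<in>?A P. ?Fa S * ?T (insert r P) S) = (\<Sum>S\<in>?A P. ?Fa S * ?T P S) + (\<Sum>S\<in>?A P. if Q < real r * real (\<Prod>S) then ?Fa S * \<bar>f r\<bar> else 0)"
      by (simp only: sum.distrib)
    also have "(\<Sum>S\<in>?A P. if Q < real r * real (\<Prod>S) then ?Fa S * \<bar>f r\<bar> else 0) = (\<Sum>S\<in>B. ?Fa S * \<bar>f r\<bar>)"
      using fin by (subst sum.inter_filter[symmetric]) (auto simp: B_def intro!: sum.cong)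
    finally show ?thesis by (simp add: sum_distrib_left mult.commute)
  qed
  also have "\<dots> \<le> (\<Sum>S\<in>?A (insert r P). ?Fa S * ?T (insert r P) S)"
    using insert.hyps by (intro sum_mono2) (auto intro!: mult_nonneg_nonneg prod_nonneg sum_nonneg)
  finally show ?case unfolding E' by simp
qed

section \<open>Sums of periodic functions\<close>

lemma sum_window_eq:
  fixes r :: "nat \<Rightarrow> 'a :: ab_group_add"
  assumes per: "\<And>n. r (n + d) = r n"
  shows "(\<Sum>n\<in>{i..<i + d}. r n) = (\<Sum>n<d. r n)"
proof (induction i)
  case (Suc i)
  have "(\<Sum>n\<in>{Suc i..<Suc i + d}. r n) + r i = (\<Sum>n\<in>{i..<i + d}. r n) + r (i + d)"
  proof (cases "d = 0")
    case False
    have "{i..<i + d} = insert i {Suc i..<i + d}" using False by auto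
    moreover have "{Suc i..<Suc i + d} = insert (i + d) {Suc i..<i + d}" using False by auto
    ultimately show ?thesis by (simp add: algebra_simps)
  qed auto
  thus ?case using Suc per[of i] by simp
qed (simp add: atLeast0LessThan)

text \<open>Complete periods are cut off at no cost until at most one period remains.\<close>

lemma abs_sum_periodic_le:
  fixes r :: "nat \<Rightarrow> real"
  assumes per: "\<And>n. r (n + d) = r n" and d: "d > 0" and zero: "(\<Sum>n<d. r n) = 0"
  shows "\<bar>\<Sum>n\<in>{i..<j}. r n\<bar> \<le> (\<Sum>n<d. \<bar>r n\<bar>)"
proof (induction "j - i" arbitrary: i rule: less_induct)
  case less
  show ?case
  proof (cases "j \<le> i + d")
    case True
    have "\<bar>\<Sum>n\<in>{i..<j}. r n\<bar> \<le> (\<Sum>n\<in>{i..<j}. \<bar>r n\<bar>)" by (rule sum_abs)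
    also have "\<dots> \<le> (\<Sum>n\<in>{i..<i + d}. \<bar>r n\<bar>)" using True by (intro sum_mono2) auto
    also have "\<dots> = (\<Sum>n<d. \<bar>r n\<bar>)" by (rule sum_window_eq) (simp add: per)
    finally show ?thesis .
  next
    case False
    have "(\<Sum>n\<in>{i..<j}. r n) = (\<Sum>n\<in>{i..<i + d}. r n) + (\<Sum>n\<in>{i + d..<j}. r n)"
      using False by (intro sum.atLeastLessThan_concat[symmetric]) auto
    also have "(\<Sum>n\<in>{i..<i + d}. r n) = 0" using sum_window_eq[of r d i] per zero by simp
    finally show ?thesis using less[of "i + d"] False d by simp
  qed
qed

lemma sum_abs_periodic_le:
  fixes r :: "nat \<Rightarrow> real"
  assumes per: "\<And>n. r (n + d) = r n" and d: "d > 0" and nonneg: "\<And>n. r n \<ge> 0"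
  shows "(\<Sum>n\<in>{i..<j}. r n) \<le> (real (j - i) / real d + 1) * (\<Sum>n<d. r n)"
proof (induction "j - i" arbitrary: i rule: less_induct)
  case less
  have pos: "(\<Sum>n<d. r n) \<ge> 0" by (intro sum_nonneg nonneg)
  show ?case
  proof (cases "j \<le> i + d")
    case True
    have "(\<Sum>n\<in>{i..<j}. r n) \<le> (\<Sum>n\<in>{i..<i + d}. r n)" using True nonneg by (intro sum_mono2) auto
    also have "\<dots> = 1 * (\<Sum>n<d. r n)" using sum_window_eq[of r d i] per by simp
    also have "\<dots> \<le> (real (j - i) / real d + 1) * (\<Sum>n<d. r n)" using pos by (intro mult_right_mono) auto
    finally show ?thesis .
  next
    case False
    have "(\<Sum>n\<in>{i..<j}. r n) = (\<Sum>n\<in>{i..<i + d}. r n) + (\<Sum>n\<in>{i + d..<j}. r n)"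
      using False by (intro sum.atLeastLessThan_concat[symmetric]) auto
    also have "(\<Sum>n\<in>{i..<i + d}. r n) = (\<Sum>n<d. r n)" using sum_window_eq[of r d i] per by simp
    also have "(\<Sum>n\<in>{i + d..<j}. r n) \<le> (real (j - (i + d)) / real d + 1) * (\<Sum>n<d. r n)"
      using less[of "i + d"] False d by simp
    also have "real (j - (i + d)) = real (j - i) - real d" using False by (simp add: of_nat_diff)
    finally show ?thesis using d by (simp add: field_simps)
  qed
qed

text \<open>Chinese remainder theorem: the numbers below \<open>a * b\<close> correspond to the
  pairs of their residues.\<close>

lemma sum_mult_coprime_periodic:
  fixes f g :: "nat \<Rightarrow> real"
  assumes cop: "coprime a b" and a: "a > 0" and b: "b > 0"
    and f: "\<And>n. f (n mod a) = f n" and g: "\<And>n. g (n mod b) = g n"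
  shows "(\<Sum>n<a * b. f n * g n) = (\<Sum>n<a. f n) * (\<Sum>n<b. g n)"
proof -
  have inj: "inj_on (\<lambda>n. (n mod a, n mod b)) {..<a * b}"
  proof (rule inj_onI)
    fix x y assume xy: "x \<in> {..<a * b}" "y \<in> {..<a * b}" "(x mod a, x mod b) = (y mod a, y mod b)"
    hence "[x = y] (mod a * b)" using cop by (intro coprime_cong_mult_nat) (auto simp: cong_def)
    thus "x = y" using xy by (simp add: cong_def)
  qed
  have im: "(\<lambda>n. (n mod a, n mod b)) ` {..<a * b} = {..<a} \<times> {..<b}"
  proof (rule card_subset_eq)
    show "card ((\<lambda>n. (n mod a, n mod b)) ` {..<a * b}) = card ({..<a} \<times> {..<b})"
      by (simp add: card_image[OF inj] card_cartesian_product)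
  qed (use a b in auto)
  have "(\<Sum>n<a. f n) * (\<Sum>n<b. g n) = (\<Sum>(x, y)\<in>{..<a} \<times> {..<b}. f x * g y)"
    by (simp add: sum_product sum.cartesian_product)
  also have "\<dots> = (\<Sum>n<a * b. f (n mod a) * g (n mod b))"
    unfolding im[symmetric] by (subst sum.reindex[OF inj]) (simp add: case_prod_unfold)
  finally show ?thesis by (simp add: f g)
qed

lemma periodic_mod:
  fixes r :: "nat \<Rightarrow> 'a" assumes "\<And>n. r (n + d) = r n" shows "r (n mod d) = r n"
proof -
  have "r (m + k * d) = r m" for m k
  proof (induction k)
    case (Suc k)
    show ?case using assms[of "m + k * d"] Suc by (simp add: algebra_simps)
  qed simp
  from this[of "n mod d" "n div d"] show ?thesis by simp
qed

text \<open>Both claims go through one induction, because the step for the first uses that the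
  product over \<open>S\<close> has period \<open>\<Prod>S\<close>.\<close>

lemma sum_prod_primes_periodic:
  fixes f :: "nat \<Rightarrow> nat \<Rightarrow> real"
  assumes "finite S" "\<And>p. p \<in> S \<Longrightarrow> prime p" "\<And>p n. p \<in> S \<Longrightarrow> f p (n + p) = f p n"
  shows "(\<Sum>n<\<Prod>S. \<Prod>p\<in>S. f p n) = (\<Prod>p\<in>S. \<Sum>n<p. f p n) \<and>
         (\<forall>n. (\<Prod>p\<in>S. f p (n + \<Prod>S)) = (\<Prod>p\<in>S. f p n))"
  using assms
proof (induction S rule: finite_induct)
  case (insert p S)
  let ?F = "\<lambda>n. \<Prod>q\<in>S. f q n"
  have p: "prime p" "p > 0" using insert.prems prime_gt_0_nat by auto
  have IH: "(\<Sum>n<\<Prod>S. ?F n) = (\<Prod>p\<in>S. \<Sum>n<p. f p n)" "\<And>n. ?F (n + \<Prod>S) = ?F n"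
    using insert by auto
  have S0: "\<Prod>S > 0" using insert.prems prime_gt_0_nat by (intro prod_pos) auto
  have cop: "coprime p (\<Prod>S)"
  proof (rule prod_coprime_right)
    fix q assume "q \<in> S"
    thus "coprime p q" using insert by (intro primes_coprime) auto
  qed
  have "(\<Sum>n<p * \<Prod>S. f p n * ?F n) = (\<Sum>n<p. f p n) * (\<Sum>n<\<Prod>S. ?F n)"
    by (rule sum_mult_coprime_periodic[OF cop p(2) S0]; rule periodic_mod) (use insert.prems IH in auto)
  moreover have "f p (n + p * k) = f p n" for n k
  proof (induction k)
    case (Suc k)
    have "f p (n + p * k + p) = f p (n + p * k)" using insert.prems by auto
    thus ?case using Suc by (simp add: algebra_simps)
  qed simp
  moreover have "?F (n + k * \<Prod>S) = ?F n" for n k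
  proof (induction k)
    case (Suc k)
    have "?F (n + k * \<Prod>S + \<Prod>S) = ?F (n + k * \<Prod>S)" by (rule IH)
    thus ?case using Suc by (simp add: algebra_simps)
  qed simp
  ultimately show ?case using insert.hyps IH by simp
qed auto

text \<open>Abel summation: a decreasing weight in [0, 1] does not worsen a bound on the partial
  sums. The weight will be the survival probability at \<open>n\<close>, which falls as the level
  rises.\<close>

lemma abs_sum_antimono_weight_le:
  fixes w r :: "nat \<Rightarrow> real"
  assumes partial: "\<And>k. k \<le> j \<Longrightarrow> \<bar>\<Sum>n\<in>{i..<k}. r n\<bar> \<le> B"
    and w: "\<And>n m. i \<le> n \<Longrightarrow> n \<le> m \<Longrightarrow> m < j \<Longrightarrow> w m \<le> w n"
    and w0: "\<And>n. i \<le> n \<Longrightarrow> n < j \<Longrightarrow> 0 \<le> w n \<and> w n \<le> 1"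
  shows "\<bar>\<Sum>n\<in>{i..<j}. w n * r n\<bar> \<le> B"
proof -
  have B: "B \<ge> 0" using partial[of 0] by simp
  let ?R = "\<lambda>k. \<Sum>n\<in>{i..<k}. r n"
  have *: "\<bar>(\<Sum>n\<in>{i..<Suc k}. w n * r n) - w k * ?R (Suc k)\<bar> \<le> (w i - w k) * B" if "i \<le> k" "k < j" for k
    using that
  proof (induction k rule: dec_induct)
    case (step k)
    have "(\<Sum>n\<in>{i..<Suc (Suc k)}. w n * r n) - w (Suc k) * ?R (Suc (Suc k)) =
       ((\<Sum>n\<in>{i..<Suc k}. w n * r n) - w k * ?R (Suc k)) + (w k - w (Suc k)) * ?R (Suc k)"
      using step.hyps by (simp add: algebra_simps)
    also have "\<bar>\<dots>\<bar> \<le> (w i - w k) * B + (w k - w (Suc k)) * B"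
    proof (rule order_trans[OF abs_triangle_ineq], intro add_mono)
      show "\<bar>(w k - w (Suc k)) * ?R (Suc k)\<bar> \<le> (w k - w (Suc k)) * B"
        unfolding abs_mult using w[of k "Suc k"] step partial[of "Suc k"] by (intro mult_mono) auto
    qed (use step in auto)
    finally show ?case by (simp add: algebra_simps)
  qed simp
  show ?thesis
  proof (cases "i < j")
    case True
    define k where "k = j - 1"
    have k: "i \<le> k" "k < j" "Suc k = j" using True by (auto simp: k_def)
    have "\<bar>w k * ?R j\<bar> \<le> w k * B"
      unfolding abs_mult using w0[OF k(1,2)] partial[of j] by (intro mult_mono) auto
    hence "\<bar>\<Sum>n\<in>{i..<j}. w n * r n\<bar> \<le> (w i - w k) * B + w k * B"
      using *[OF k(1,2)] unfolding k(3) by linarith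
    also have "\<dots> = w i * B" by (simp add: algebra_simps)
    also have "\<dots> \<le> 1 * B" using w0[of i] True B by (intro mult_right_mono) auto
    finally show ?thesis by simp
  qed (use B in auto)
qed

section \<open>The covariance sum in abstract form\<close>

definition primes_upto :: "nat \<Rightarrow> nat set" where
  "primes_upto k = {p. prime p \<and> p \<le> k}"

lemma finite_primes_upto [simp, intro]: "finite (primes_upto k)"
  by (simp add: primes_upto_def)

lemma primes_upto_mono: "k \<le> l \<Longrightarrow> primes_upto k \<subseteq> primes_upto l"
  by (auto simp: primes_upto_def)

lemma in_primes_uptoD: "p \<in> primes_upto k \<Longrightarrow> prime p"
  by (auto simp: primes_upto_def)

lemma upclosed_interval:
  fixes i j :: nat
  assumes "\<And>n m. n \<in> {i..<j} \<Longrightarrow> m \<in> {i..<j} \<Longrightarrow> n \<le> m \<Longrightarrow> Q n \<Longrightarrow> Q m"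
  obtains i' where "i \<le> i'" "{n \<in> {i..<j}. Q n} = {i'..<j}"
proof (cases "\<exists>n\<in>{i..<j}. Q n")
  case True
  define k where "k = (LEAST n. n \<in> {i..<j} \<and> Q n)"
  have k: "k \<in> {i..<j}" "Q k" using LeastI_ex[of "\<lambda>n. n \<in> {i..<j} \<and> Q n"] True unfolding k_def by blast+
  have "k \<le> n" if "n \<in> {i..<j}" "Q n" for n unfolding k_def using that by (intro Least_le) auto
  hence "{n \<in> {i..<j}. Q n} = {k..<j}" using k assms[of k] by auto
  thus ?thesis using k by (intro that) auto
next
  case False
  thus ?thesis by (intro that[of "max i j"]) auto
qed

lemma prod_le_prod_subset:
  fixes f :: "'a \<Rightarrow> real"
  assumes "finite B" "A \<subseteq> B" "\<And>x. x \<in> B \<Longrightarrow> 0 \<le> f x \<and> f x \<le> 1"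
  shows "prod f B \<le> prod f A"
proof -
  have "prod f B = prod f (B - A) * prod f A" by (rule prod.subset_diff[OF assms(2,1)])
  also have "\<dots> \<le> 1 * prod f A"
    using assms by (intro mult_right_mono prod_le_1 prod_nonneg) auto
  finally show ?thesis by simp
qed

text \<open>\<open>\<gamma> p\<close> and \<open>\<rho> p n m\<close> stand for \<open>gam\<close>
  and \<open>corr\<close>, and \<open>y\<close> for the level. \<open>E\<close> marks the pairs for
  which the large primes need not have a small contribution; they are few and are estimated
  trivially. In the last factor of the bound, 1 comes from the truncated expansion,
  \<open>2 * C1\<close> from its remainder and \<open>2 * K2\<close> from the pairs in
  \<open>E\<close>.\<close>

lemma covariance_sum_bound:
  fixes \<rho> :: "nat \<Rightarrow> nat \<Rightarrow> nat \<Rightarrow> real" and \<gamma> b :: "nat \<Rightarrow> real" and y :: "nat \<Rightarrow> nat"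
    and i j N Z :: nat and E :: "nat \<Rightarrow> nat \<Rightarrow> bool" and C1 K2 :: real
  defines "V \<equiv> \<lambda>n. \<Prod>p\<in>primes_upto (y n). \<gamma> p"
    and "T \<equiv> \<Sum>S | S \<subseteq> primes_upto Z \<and> real (\<Prod>S) \<le> real N. \<Prod>p\<in>S. b p"
  assumes \<gamma>: "\<And>p. prime p \<Longrightarrow> 0 < \<gamma> p \<and> \<gamma> p \<le> 1"
    and w: "\<And>p n m. prime p \<Longrightarrow> 0 \<le> (\<gamma> p)\<^sup>2 * (1 + \<rho> p n m) \<and> (\<gamma> p)\<^sup>2 * (1 + \<rho> p n m) \<le> 1"
    and per: "\<And>p n m. prime p \<Longrightarrow> \<rho> p (n + p) m = \<rho> p n m"
    and zero: "\<And>p m. prime p \<Longrightarrow> (\<Sum>n<p. \<rho> p n m) = 0"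
    and abs1: "\<And>p m. prime p \<Longrightarrow> (\<Sum>n<p. \<bar>\<rho> p n m\<bar>) \<le> b p"
    and abs2: "\<And>p n m. prime p \<Longrightarrow> \<bar>\<rho> p n m\<bar> \<le> b p"
    and y: "\<And>n m. i \<le> n \<Longrightarrow> n \<le> m \<Longrightarrow> m < j \<Longrightarrow> y n \<le> y m"
    and Z: "\<And>n. i \<le> n \<Longrightarrow> n < j \<Longrightarrow> y n \<le> Z"
    and len: "j - i \<le> N" and N: "N \<ge> 1" and C1: "C1 \<ge> 0" and K2: "K2 \<ge> 0"
    and tail: "\<And>n m d. n \<in> {i..<j} \<Longrightarrow> m \<in> {i..<j} \<Longrightarrow> \<not> E n m \<Longrightarrow> d \<ge> 1 \<Longrightarrow>
                 (\<Sum>p | p \<in> primes_upto Z \<and> real N < real p * real d. \<bar>\<rho> p n m\<bar>) \<le> C1 * real d / real N"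
    and exc: "\<And>m. m \<in> {i..<j} \<Longrightarrow> real (card {n \<in> {i..<j}. E n m}) \<le> K2"
  shows "(\<Sum>n=i..<j. \<Sum>m=i..<j. V n * V m * ((\<Prod>p\<in>primes_upto (min (y n) (y m)). 1 + \<rho> p n m) - 1))
           \<le> real N * T * (1 + 2 * C1 + 2 * K2)"
proof -
  let ?I = "{i..<j}"
  define \<S> where "\<S> = {S. S \<subseteq> primes_upto Z \<and> real (\<Prod>S) \<le> real N}"
  define P where "P = (\<lambda>n m. primes_upto (min (y n) (y m)))"
  define G where "G = (\<lambda>n m. \<Sum>S | S \<subseteq> P n m \<and> real (\<Prod>S) \<le> real N. \<Prod>p\<in>S. \<rho> p n m)"
  define \<rho>S where "\<rho>S = (\<lambda>S n m. \<Prod>p\<in>S. \<rho> p n m)"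
  define bS where "bS = (\<lambda>S. \<Prod>p\<in>S. b p)"
  define F where "F = (\<lambda>n m. \<Prod>p\<in>P n m. 1 + \<rho> p n m)"
  have b0: "b p \<ge> 0" if "prime p" for p using abs2[OF that, of 0 0] by linarith
  have fin\<S>: "finite \<S>" unfolding \<S>_def by (rule finite_subset[of _ "Pow (primes_upto Z)"]) auto
  have \<S>D: "finite S" "\<And>p. p \<in> S \<Longrightarrow> prime p" "\<Prod>S \<ge> 1" "real (\<Prod>S) \<le> real N" "bS S \<ge> 0" if "S \<in> \<S>" for S
  proof -
    show fin: "finite S" using that finite_subset unfolding \<S>_def by blast
    show pr: "prime p" if "p \<in> S" for p using that \<open>S \<in> \<S>\<close> unfolding \<S>_def by (auto dest: in_primes_uptoD)
    have "\<Prod>S > 0" using pr prime_gt_0_nat by (intro prod_pos) auto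
    thus "\<Prod>S \<ge> 1" by linarith
    show "real (\<Prod>S) \<le> real N" using that unfolding \<S>_def by auto
    show "bS S \<ge> 0" unfolding bS_def using pr b0 by (intro prod_nonneg) auto
  qed
  have T: "T = (\<Sum>S\<in>\<S>. bS S)" by (simp add: T_def \<S>_def bS_def)
  have emp: "{} \<in> \<S>" using N by (auto simp: \<S>_def)
  have T1: "T \<ge> 1"
  proof -
    have "(\<Sum>S\<in>{{}}. bS S) \<le> T" unfolding T using fin\<S> emp \<S>D by (intro sum_mono2) auto
    thus ?thesis by (simp add: bS_def)
  qed
  have PZ: "P n m \<subseteq> primes_upto Z" if "n \<in> ?I" for n m
    unfolding P_def using Z[of n] that by (intro primes_upto_mono) auto
  have absS: "\<bar>\<rho>S S n m\<bar> \<le> bS S" if "S \<in> \<S>" for S n m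
    unfolding \<rho>S_def bS_def abs_prod using that \<S>D abs2 by (intro prod_mono) auto
  have V: "0 < V n" "V n \<le> 1" for n
    unfolding V_def using \<gamma> by (auto intro!: prod_pos prod_le_1 dest: in_primes_uptoD less_imp_le)
  have \<gamma>P: "0 \<le> \<gamma> p" "\<gamma> p \<le> 1" if "p \<in> primes_upto k" for p k
    using \<gamma>[OF in_primes_uptoD[OF that]] by auto
  \<comment> \<open>Primes between the two levels are discarded. Every common prime then carries
    \<open>\<gamma> p\<close> once for \<open>n\<close> and once for \<open>m\<close>, the weight
    that \<open>prod_decomposition_bound\<close> asks for.\<close>
  have VV: "V n * V m \<le> (\<Prod>p\<in>P n m. (\<gamma> p)\<^sup>2)" for n m
  proof -
    have "V n \<le> (\<Prod>p\<in>P n m. \<gamma> p)" "V m \<le> (\<Prod>p\<in>P n m. \<gamma> p)" unfolding V_def P_def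
      by (intro prod_le_prod_subset primes_upto_mono; use \<gamma> in \<open>auto dest: in_primes_uptoD less_imp_le\<close>)+
    hence "V n * V m \<le> (\<Prod>p\<in>P n m. \<gamma> p) * (\<Prod>p\<in>P n m. \<gamma> p)"
      using V[of n] V[of m] by (intro mult_mono) auto
    thus ?thesis by (simp add: power2_eq_square prod.distrib)
  qed
  have subset: "{S. S \<subseteq> P n m \<and> real (\<Prod>S) \<le> real N} \<subseteq> \<S>" if "n \<in> ?I" for n m
    using PZ[OF that] unfolding \<S>_def by auto
  have error: "\<bar>V n * V m * (F n m - G n m)\<bar> \<le> 
      (\<Sum>S\<in>\<S>. \<bar>\<rho>S S n m\<bar> * (C1 * real (\<Prod>S) / real N)) + (if E n m then 2 * T else 0)"
    if nm: "n \<in> ?I" "m \<in> ?I" for n m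
  proof (cases "E n m")
    case False
    have "\<bar>V n * V m * (F n m - G n m)\<bar> = V n * V m * \<bar>F n m - G n m\<bar>"
      using V[of n] V[of m] by (simp add: abs_mult)
    also have "\<dots> \<le> (\<Prod>p\<in>P n m. (\<gamma> p)\<^sup>2) * \<bar>F n m - G n m\<bar>" using VV by (intro mult_right_mono) auto
    also have "\<dots> \<le> (\<Sum>S | S \<subseteq> P n m \<and> real (\<Prod>S) \<le> real N. (\<Prod>p\<in>S. \<bar>\<rho> p n m\<bar>) * 
                       (\<Sum>p | p \<in> P n m \<and> real N < real p * real (\<Prod>S). \<bar>\<rho> p n m\<bar>))"
      unfolding F_def G_def
    proof (rule prod_decomposition_bound)
      fix p assume "p \<in> P n m"
      hence "prime p" by (auto simp: P_def dest: in_primes_uptoD)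
      thus "p \<ge> 1" "0 \<le> (\<gamma> p)\<^sup>2 \<and> (\<gamma> p)\<^sup>2 \<le> 1 \<and> 0 \<le> (\<gamma> p)\<^sup>2 * (1 + \<rho> p n m) \<and> (\<gamma> p)\<^sup>2 * (1 + \<rho> p n m) \<le> 1"
        using w[of p n m] \<gamma>[of p] prime_gt_0_nat[of p] by (auto simp: power_le_one)
    qed (use N in \<open>auto simp: P_def\<close>)
    also have "\<dots> \<le> (\<Sum>S | S \<subseteq> P n m \<and> real (\<Prod>S) \<le> real N. \<bar>\<rho>S S n m\<bar> * (C1 * real (\<Prod>S) / real N))"
    proof (rule sum_mono)
      fix S assume "S \<in> {S. S \<subseteq> P n m \<and> real (\<Prod>S) \<le> real N}"
      hence S: "S \<in> \<S>" using subset nm by blast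
      have "(\<Sum>p | p \<in> P n m \<and> real N < real p * real (\<Prod>S). \<bar>\<rho> p n m\<bar>) \<le> (\<Sum>p | p \<in> primes_upto Z \<and> real N < real p * real (\<Prod>S). \<bar>\<rho> p n m\<bar>)"
        using PZ nm by (intro sum_mono2) auto
      also have "\<dots> \<le> C1 * real (\<Prod>S) / real N" using False nm \<S>D(3)[OF S] by (intro tail) auto
      finally show "(\<Prod>p\<in>S. \<bar>\<rho> p n m\<bar>) * (\<Sum>p | p \<in> P n m \<and> real N < real p * real (\<Prod>S). \<bar>\<rho> p n m\<bar>) \<le> \<bar>\<rho>S S n m\<bar> * (C1 * real (\<Prod>S) / real N)"
        unfolding \<rho>S_def abs_prod by (intro mult_left_mono prod_nonneg) auto
    qed
    also have "\<dots> \<le> (\<Sum>S\<in>\<S>. \<bar>\<rho>S S n m\<bar> * (C1 * real (\<Prod>S) / real N))"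
      using C1 nm by (intro sum_mono2 fin\<S> subset) (auto intro!: mult_nonneg_nonneg divide_nonneg_nonneg prod_nonneg)
    finally show ?thesis using False by simp
  next
    case True
    \<comment> \<open>On exceptional pairs no cancellation is used: the weighted full product has
      factors at most 1, and the truncated sum is at most \<open>T\<close>.\<close>
    have G: "\<bar>G n m\<bar> \<le> T"
    proof -
      have "\<bar>G n m\<bar> \<le> (\<Sum>S | S \<subseteq> P n m \<and> real (\<Prod>S) \<le> real N. \<bar>\<rho>S S n m\<bar>)" unfolding G_def \<rho>S_def by (rule sum_abs)
      also have "\<dots> \<le> (\<Sum>S\<in>\<S>. \<bar>\<rho>S S n m\<bar>)" using nm by (intro sum_mono2 fin\<S> subset) auto
      also have "\<dots> \<le> T" unfolding T using absS by (intro sum_mono) auto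
      finally show ?thesis .
    qed
    have F0: "0 \<le> F n m" unfolding F_def
    proof (rule prod_nonneg)
      fix p assume "p \<in> P n m"
      hence "prime p" by (auto simp: P_def dest: in_primes_uptoD)
      thus "0 \<le> 1 + \<rho> p n m" using w[of p n m] \<gamma>[of p] by (simp add: zero_le_mult_iff)
    qed
    have "V n * V m * F n m \<le> (\<Prod>p\<in>P n m. (\<gamma> p)\<^sup>2) * F n m" using VV F0 by (intro mult_right_mono) auto
    also have "\<dots> = (\<Prod>p\<in>P n m. (\<gamma> p)\<^sup>2 * (1 + \<rho> p n m))" unfolding F_def by (simp add: prod.distrib)
    also have "\<dots> \<le> 1" using w by (intro prod_le_1) (auto simp: P_def dest: in_primes_uptoD)
    finally have 1: "V n * V m * F n m \<le> 1" .
    have VV1: "0 \<le> V n * V m" "V n * V m \<le> 1" using V[of n] V[of m] by (auto simp: mult_le_one)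
    have "\<bar>V n * V m * (F n m - G n m)\<bar> \<le> \<bar>V n * V m * F n m\<bar> + \<bar>V n * V m * G n m\<bar>"
      unfolding right_diff_distrib by (rule abs_triangle_ineq4)
    also have "\<bar>V n * V m * F n m\<bar> \<le> 1" using 1 F0 VV1 V[of n] V[of m] by (simp add: abs_mult)
    also have "\<bar>V n * V m * G n m\<bar> \<le> 1 * T" unfolding abs_mult[of "V n * V m"] using VV1 G by (intro mult_mono) auto
    finally have "\<bar>V n * V m * (F n m - G n m)\<bar> \<le> 2 * T" using T1 by simp
    moreover have "(\<Sum>S\<in>\<S>. \<bar>\<rho>S S n m\<bar> * (C1 * real (\<Prod>S) / real N)) \<ge> 0"
      using C1 by (auto intro!: sum_nonneg mult_nonneg_nonneg divide_nonneg_nonneg prod_nonneg)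
    ultimately show ?thesis using True by simp
  qed
  have pS: "\<rho>S S (n + \<Prod>S) m = \<rho>S S n m" "(\<Sum>n<\<Prod>S. \<bar>\<rho>S S n m\<bar>) \<le> bS S" if S: "S \<in> \<S>" for S n m
  proof -
    show "\<rho>S S (n + \<Prod>S) m = \<rho>S S n m" unfolding \<rho>S_def
      using sum_prod_primes_periodic[of S "\<lambda>p n. \<rho> p n m"] \<S>D[OF S] per by auto
    have "(\<Sum>n<\<Prod>S. \<bar>\<rho>S S n m\<bar>) = (\<Prod>p\<in>S. \<Sum>n<p. \<bar>\<rho> p n m\<bar>)" unfolding \<rho>S_def abs_prod
      using sum_prod_primes_periodic[of S "\<lambda>p n. \<bar>\<rho> p n m\<bar>"] \<S>D[OF S] per by auto
    also have "\<dots> \<le> bS S" unfolding bS_def using abs1 \<S>D[OF S] by (intro prod_mono) (auto intro: sum_nonneg)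
    finally show "(\<Sum>n<\<Prod>S. \<bar>\<rho>S S n m\<bar>) \<le> bS S" .
  qed
  have zS: "(\<Sum>n<\<Prod>S. \<rho>S S n m) = 0" if S: "S \<in> \<S>" "S \<noteq> {}" for S m
  proof -
    have "(\<Sum>n<\<Prod>S. \<rho>S S n m) = (\<Prod>p\<in>S. \<Sum>n<p. \<rho> p n m)" unfolding \<rho>S_def
      using sum_prod_primes_periodic[of S "\<lambda>p n. \<rho> p n m"] \<S>D[OF S(1)] per by auto
    thus ?thesis using S zero \<S>D[OF S(1)] by (auto intro!: prod_zero)
  qed
  \<comment> \<open>Summing over \<open>n\<close> costs at most \<open>N / d + 1\<close> periods of
    \<open>d = \<Prod>S\<close>, which is at most \<open>2 * N / d\<close> because the cutoff
    ensures \<open>d \<le> N\<close>; the factor \<open>d / N\<close> from \<open>tail\<close> then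
    cancels.\<close>
  have err_sum: "(\<Sum>n\<in>?I. \<Sum>S\<in>\<S>. \<bar>\<rho>S S n m\<bar> * (C1 * real (\<Prod>S) / real N)) \<le> 2 * C1 * T" for m
  proof -
    have "(\<Sum>n\<in>?I. \<Sum>S\<in>\<S>. \<bar>\<rho>S S n m\<bar> * (C1 * real (\<Prod>S) / real N)) = (\<Sum>S\<in>\<S>. (\<Sum>n\<in>?I. \<bar>\<rho>S S n m\<bar>) * (C1 * real (\<Prod>S) / real N))"
      unfolding sum_distrib_right by (rule sum.swap)
    also have "\<dots> \<le> (\<Sum>S\<in>\<S>. ((real N / real (\<Prod>S) + 1) * bS S) * (C1 * real (\<Prod>S) / real N))"
    proof (intro sum_mono mult_right_mono)
      fix S assume S: "S \<in> \<S>"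
      have "(\<Sum>n\<in>?I. \<bar>\<rho>S S n m\<bar>) \<le> (real (j - i) / real (\<Prod>S) + 1) * (\<Sum>n<\<Prod>S. \<bar>\<rho>S S n m\<bar>)"
        by (rule sum_abs_periodic_le) (use pS(1)[OF S] \<S>D(3)[OF S] in auto)
      also have "\<dots> \<le> (real N / real (\<Prod>S) + 1) * bS S"
        using len pS(2)[OF S] \<S>D(3)[OF S] by (intro mult_mono add_mono divide_right_mono) (auto intro!: sum_nonneg prod_nonneg add_nonneg_nonneg divide_nonneg_nonneg)
      finally show "(\<Sum>n\<in>?I. \<bar>\<rho>S S n m\<bar>) \<le> (real N / real (\<Prod>S) + 1) * bS S" .
      show "0 \<le> C1 * real (\<Prod>S) / real N" using C1 by (intro divide_nonneg_nonneg mult_nonneg_nonneg of_nat_0_le_iff) auto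
    qed
    also have "\<dots> \<le> (\<Sum>S\<in>\<S>. 2 * C1 * bS S)"
    proof (rule sum_mono)
      fix S assume S: "S \<in> \<S>"
      define d where "d = real (\<Prod>S)"
      have d: "d \<ge> 1" "d \<le> real N" using \<S>D(3,4)[OF S] unfolding d_def by linarith+
      have "((real N / d + 1) * bS S) * (C1 * d / real N) = (1 + d / real N) * (C1 * bS S)"
        using d by (simp add: field_simps)
      also have "\<dots> \<le> 2 * (C1 * bS S)" using d C1 \<S>D(5)[OF S] by (intro mult_right_mono) auto
      finally show "((real N / real (\<Prod>S) + 1) * bS S) * (C1 * real (\<Prod>S) / real N) \<le> 2 * C1 * bS S" 
        unfolding d_def by simp
    qed
    also have "\<dots> = 2 * C1 * T" unfolding T sum_distrib_left ..
    finally show ?thesis .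
  qed
  have err_total: "(\<Sum>n\<in>?I. \<Sum>m\<in>?I. V n * V m * (F n m - G n m)) \<le> real N * (2 * C1 * T + 2 * T * K2)"
  proof -
    have "(\<Sum>n\<in>?I. \<Sum>m\<in>?I. V n * V m * (F n m - G n m)) \<le> (\<Sum>n\<in>?I. \<Sum>m\<in>?I. 
       (\<Sum>S\<in>\<S>. \<bar>\<rho>S S n m\<bar> * (C1 * real (\<Prod>S) / real N)) + (if E n m then 2 * T else 0))"
      using error by (intro sum_mono) (meson abs_le_D1)
    also have "\<dots> = (\<Sum>m\<in>?I. (\<Sum>n\<in>?I. \<Sum>S\<in>\<S>. \<bar>\<rho>S S n m\<bar> * (C1 * real (\<Prod>S) / real N)) + (\<Sum>n\<in>?I. if E n m then 2 * T else 0))"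
      by (subst sum.swap) (simp add: sum.distrib)
    also have "\<dots> \<le> (\<Sum>m\<in>?I. 2 * C1 * T + 2 * T * K2)"
    proof (intro sum_mono add_mono err_sum)
      fix m assume m: "m \<in> ?I"
      have "(\<Sum>n\<in>?I. if E n m then 2 * T else 0) = real (card {n\<in>?I. E n m}) * (2 * T)"
        by (subst sum.inter_filter[symmetric]) auto
      also have "\<dots> \<le> K2 * (2 * T)" using exc[OF m] T1 by (intro mult_right_mono) auto
      finally show "(\<Sum>n\<in>?I. if E n m then 2 * T else 0) \<le> 2 * T * K2" by (simp add: mult.commute)
    qed
    also have "\<dots> = real (j - i) * (2 * C1 * T + 2 * T * K2)" by simp
    also have "\<dots> \<le> real N * (2 * C1 * T + 2 * T * K2)"
      using len T1 C1 K2 by (intro mult_right_mono add_nonneg_nonneg mult_nonneg_nonneg) auto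
    finally show ?thesis .
  qed
  have main: "(\<Sum>n\<in>?I. \<Sum>m\<in>?I. V n * V m * (G n m - 1)) \<le> real N * T"
  proof -
    let ?ok = "\<lambda>S n. S \<subseteq> primes_upto (y n)"
    \<comment> \<open>The primes up to \<open>min (y n) (y m)\<close> form an intersection, so the
      condition on \<open>S\<close> splits into one on \<open>n\<close> and one on \<open>m\<close>.
      The empty set supplies the subtracted 1.\<close>
    have Gsum: "G n m - 1 = (\<Sum>S\<in>\<S> - {{}}. if ?ok S n \<and> ?ok S m then \<rho>S S n m else 0)" if "n \<in> ?I" for n m
    proof -
      have "P n m = primes_upto (y n) \<inter> primes_upto (y m)" by (auto simp: P_def primes_upto_def)
      hence "{S. S \<subseteq> P n m \<and> real (\<Prod>S) \<le> real N} = {S\<in>\<S>. ?ok S n \<and> ?ok S m}"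
        using PZ[OF that] unfolding \<S>_def by blast
      hence "G n m = (\<Sum>S\<in>\<S>. if ?ok S n \<and> ?ok S m then \<rho>S S n m else 0)"
        unfolding G_def \<rho>S_def by (simp only: sum.inter_filter[OF fin\<S>])
      also have "\<dots> = (\<Sum>S\<in>\<S> - {{}}. if ?ok S n \<and> ?ok S m then \<rho>S S n m else 0) + 1"
        using emp fin\<S> by (subst sum.remove[of _ "{}"]) (auto simp: \<rho>S_def)
      finally show ?thesis by simp
    qed
    have "(\<Sum>n\<in>?I. \<Sum>m\<in>?I. V n * V m * (G n m - 1)) = 
       (\<Sum>n\<in>?I. \<Sum>m\<in>?I. \<Sum>S\<in>\<S> - {{}}. V n * V m * (if ?ok S n \<and> ?ok S m then \<rho>S S n m else 0))"
      using Gsum by (intro sum.cong) (auto simp: sum_distrib_left)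
    also have "\<dots> = (\<Sum>m\<in>?I. \<Sum>S\<in>\<S> - {{}}. \<Sum>n\<in>?I. V n * V m * (if ?ok S n \<and> ?ok S m then \<rho>S S n m else 0))"
      by (subst sum.swap) (intro sum.cong refl sum.swap)
    also have "\<dots> \<le> (\<Sum>m\<in>?I. \<Sum>S\<in>\<S> - {{}}. bS S)"
    proof (intro sum_mono)
      fix m S assume m: "m \<in> ?I" and S: "S \<in> \<S> - {{}}"
      obtain i' where i': "i \<le> i'" "{n \<in> ?I. ?ok S n} = {i'..<j}"
      proof (rule upclosed_interval[of i j "?ok S"])
        fix n m assume "n \<in> ?I" "m \<in> ?I" "n \<le> m" "?ok S n"
        thus "?ok S m" using y[of n m] primes_upto_mono[of "y n" "y m"] by auto
      qed blast
      \<comment> \<open>For fixed \<open>m\<close> and nonempty \<open>S\<close> the summand has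
        mean zero over a period, a decreasing weight and an interval as its range; so one period of
        absolute values bounds the sum, however long the interval is.\<close>
      have "\<bar>\<Sum>n\<in>{i'..<j}. V n * \<rho>S S n m\<bar> \<le> bS S"
      proof (rule abs_sum_antimono_weight_le)
        fix k assume "k \<le> j"
        have "\<bar>\<Sum>n\<in>{i'..<k}. \<rho>S S n m\<bar> \<le> (\<Sum>n<\<Prod>S. \<bar>\<rho>S S n m\<bar>)"
          by (rule abs_sum_periodic_le) (use S pS zS \<S>D(3)[of S] in auto)
        also have "\<dots> \<le> bS S" using S pS by auto
        finally show "\<bar>\<Sum>n\<in>{i'..<k}. \<rho>S S n m\<bar> \<le> bS S" .
      next
        fix n n' assume "i' \<le> n" "n \<le> n'" "n' < j"
        thus "V n' \<le> V n" unfolding V_def using i' y[of n n'] \<gamma>P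
          by (intro prod_le_prod_subset primes_upto_mono) auto
      qed (use V in \<open>auto intro: less_imp_le\<close>)
      also have "(\<Sum>n\<in>{i'..<j}. V n * \<rho>S S n m) = (\<Sum>n\<in>?I. if ?ok S n then V n * \<rho>S S n m else 0)"
        unfolding i'(2)[symmetric] by (rule sum.inter_filter) auto
      finally have A: "\<bar>\<Sum>n\<in>?I. if ?ok S n then V n * \<rho>S S n m else 0\<bar> \<le> bS S" .
      show "(\<Sum>n\<in>?I. V n * V m * (if ?ok S n \<and> ?ok S m then \<rho>S S n m else 0)) \<le> bS S"
      proof (cases "?ok S m")
        case True
        have "(\<Sum>n\<in>?I. V n * V m * (if ?ok S n \<and> ?ok S m then \<rho>S S n m else 0)) = V m * (\<Sum>n\<in>?I. if ?ok S n then V n * \<rho>S S n m else 0)"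
          using True by (simp add: sum_distrib_left) (intro sum.cong, auto)
        also have "\<dots> \<le> V m * bS S" using A V[of m] by (intro mult_left_mono) auto
        also have "\<dots> \<le> 1 * bS S" using V[of m] \<S>D(5) S by (intro mult_right_mono) auto
        finally show ?thesis by simp
      next
        case False
        have "0 \<le> bS S" using S \<S>D(5) by auto
        thus ?thesis using False by simp
      qed
    qed
    also have "(\<Sum>S\<in>\<S> - {{}}. bS S) \<le> T" unfolding T using fin\<S> \<S>D by (intro sum_mono2) auto
    hence "(\<Sum>m\<in>?I. \<Sum>S\<in>\<S> - {{}}. bS S) \<le> real (j - i) * T" by (simp add: mult_left_mono)
    also have "\<dots> \<le> real N * T" using len T1 by (intro mult_right_mono) auto
    finally show ?thesis .
  qed
  have "(\<Sum>n\<in>?I. \<Sum>m\<in>?I. V n * V m * (F n m - 1)) =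
     (\<Sum>n\<in>?I. \<Sum>m\<in>?I. V n * V m * (F n m - G n m)) + (\<Sum>n\<in>?I. \<Sum>m\<in>?I. V n * V m * (G n m - 1))"
    by (simp add: sum.distrib[symmetric] algebra_simps)
  also have "\<dots> \<le> real N * (2 * C1 * T + 2 * T * K2) + real N * T" by (intro add_mono main err_total)
  finally show ?thesis unfolding F_def P_def by (simp add: algebra_simps)
qed

section \<open>Local correlations of a tuple at two places\<close>

definition resid :: "int set \<Rightarrow> nat \<Rightarrow> nat \<Rightarrow> int set" where
  "resid H p n = (\<lambda>h. (int n + h) mod int p) ` H"

abbreviation overlap :: "int set \<Rightarrow> nat \<Rightarrow> nat \<Rightarrow> nat \<Rightarrow> nat" where
  "overlap H p n m \<equiv> card (resid H p n \<inter> resid H p m)"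

definition gam :: "int set \<Rightarrow> nat \<Rightarrow> real" where
  "gam H p = 1 - real (num_residues H p) / real p"

text \<open>\<open>gam H p\<close> is the probability that \<open>n + H\<close> avoids a random residue class modulo \<open>p\<close>, and
  \<open>corr H p n m\<close> is the covariance of these events for \<open>n\<close> and \<open>m\<close>, divided by \<open>(gam H p)\<^sup>2\<close>.\<close>

definition corr :: "int set \<Rightarrow> nat \<Rightarrow> nat \<Rightarrow> nat \<Rightarrow> real" where
  "corr H p n m = (real (overlap H p n m) / real p - (real (num_residues H p) / real p)\<^sup>2) / (gam H p)\<^sup>2"

text \<open>Bounds the sum of the absolute values of \<open>corr\<close> over one period. For
  \<open>p \<le> 2 * K\<close> admissibility gives only \<open>gam H p \<ge> 1 / p\<close>, so that
  single terms are bounded by \<open>p ^ 2\<close>; for larger \<open>p\<close> one has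
  \<open>gam H p \<ge> 1 / 2\<close>, and the average overlap yields the order
  \<open>K ^ 2 / p\<close>.\<close>

definition corr_bound :: "nat \<Rightarrow> nat \<Rightarrow> real" where
  "corr_bound K p = (if p \<le> 2 * K then real p ^ 3 else 8 * real K ^ 2 / real p)"

abbreviation corr_bound_sum :: "nat \<Rightarrow> nat \<Rightarrow> real \<Rightarrow> real" where
  "corr_bound_sum K Z N \<equiv> \<Sum>S | S \<subseteq> primes_upto Z \<and> real (\<Prod>S) \<le> N. \<Prod>p\<in>S. corr_bound K p"

lemma resid_subset: "p > 0 \<Longrightarrow> resid H p n \<subseteq> {0..<int p}"
  by (auto simp: resid_def)

lemma finite_resid [simp]: "finite H \<Longrightarrow> finite (resid H p n)"
  by (simp add: resid_def)

lemma resid_add_period: "resid H p (n + p) = resid H p n"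
proof -
  have "(int (n + p) + h) mod int p = (int n + h) mod int p" for h
    using mod_add_self2[of "int n + h" "int p"] by (simp add: algebra_simps del: mod_add_self2)
  thus ?thesis unfolding resid_def by simp
qed

lemma mod_add_left_cancel_iff:
  fixes x y k q :: int
  shows "(k + x) mod q = (k + y) mod q \<longleftrightarrow> x mod q = y mod q"
  by (simp add: mod_eq_dvd_iff)

lemma card_resid: "card (resid H p n) = num_residues H p"
proof -
  have "resid H p n = (\<lambda>r. (int n + r) mod int p) ` ((\<lambda>h. h mod int p) ` H)"
    unfolding resid_def image_image by (intro image_cong refl) (simp add: mod_simps)
  moreover have "inj_on (\<lambda>r. (int n + r) mod int p) ((\<lambda>h. h mod int p) ` H)"
    by (auto simp: inj_on_def mod_add_left_cancel_iff)
  ultimately show ?thesis by (simp add: card_image num_residues_def)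
qed

lemma num_residues_le_card: "finite H \<Longrightarrow> num_residues H p \<le> card H"
  unfolding num_residues_def by (rule card_image_le)

text \<open>Double counting: each residue \<open>b\<close> lies in \<open>resid H p n\<close> for as
  many \<open>n\<close> below \<open>p\<close> as \<open>H\<close> has residues. This is the reason
  why \<open>corr\<close> has mean zero in \<open>n\<close>.\<close>

lemma sum_card_resid_Int:
  assumes p: "p > 0" and H: "finite H"
  shows "(\<Sum>n<p. overlap H p n m) = (num_residues H p)\<^sup>2"
proof -
  have cnt: "card {n. n < p \<and> b \<in> resid H p n} = num_residues H p" if b: "b \<in> {0..<int p}" for b
  proof -
    have "{n. n < p \<and> b \<in> resid H p n} = (\<lambda>r. nat ((b - r) mod int p)) ` ((\<lambda>h. h mod int p) ` H)"
    proof (intro equalityI subsetI)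
      fix n assume "n \<in> {n. n < p \<and> b \<in> resid H p n}"
      then obtain h where h: "n < p" "h \<in> H" "b = (int n + h) mod int p" by (auto simp: resid_def)
      have "(b - h mod int p) mod int p = int n mod int p" unfolding h(3) by (simp add: mod_simps)
      also have "\<dots> = int n" using h by simp
      finally have "n = nat ((b - h mod int p) mod int p)" by simp
      thus "n \<in> (\<lambda>r. nat ((b - r) mod int p)) ` ((\<lambda>h. h mod int p) ` H)" using h by blast
    next
      fix n assume "n \<in> (\<lambda>r. nat ((b - r) mod int p)) ` ((\<lambda>h. h mod int p) ` H)"
      then obtain h where h: "h \<in> H" "n = nat ((b - h) mod int p)" by (auto simp: mod_simps)
      have "int n = (b - h) mod int p" using h p by simp
      moreover have "(b - h) mod int p < int p" using p by simp
      ultimately have "n < p" "(int n + h) mod int p = b" using b by (linarith, simp add: mod_simps)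
      thus "n \<in> {n. n < p \<and> b \<in> resid H p n}" using h unfolding resid_def by blast
    qed
    moreover have "inj_on (\<lambda>r. nat ((b - r) mod int p)) ((\<lambda>h. h mod int p) ` H)"
    proof (rule inj_onI)
      fix x y assume xy: "x \<in> (\<lambda>h. h mod int p) ` H" "y \<in> (\<lambda>h. h mod int p) ` H" "nat ((b - x) mod int p) = nat ((b - y) mod int p)"
      hence "(b - x) mod int p = (b - y) mod int p" using p by (simp add: eq_nat_nat_iff)
      hence "int p dvd (y - x)" by (simp add: mod_eq_dvd_iff)
      hence "y mod int p = x mod int p" by (simp add: mod_eq_dvd_iff)
      thus "x = y" using xy by auto
    qed
    ultimately show ?thesis by (simp add: card_image num_residues_def)
  qed
  have "(\<Sum>n<p. overlap H p n m) = (\<Sum>n<p. \<Sum>b\<in>resid H p m. if b \<in> resid H p n then 1 else 0)"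
  proof (rule sum.cong)
    fix n
    have "(\<Sum>b\<in>resid H p m. if b \<in> resid H p n then 1 else (0::nat)) = card {b \<in> resid H p m. b \<in> resid H p n}"
      using H by (subst sum.inter_filter[symmetric]) auto
    also have "{b \<in> resid H p m. b \<in> resid H p n} = resid H p n \<inter> resid H p m" by auto
    finally show "overlap H p n m = (\<Sum>b\<in>resid H p m. if b \<in> resid H p n then 1 else 0)" ..
  qed simp
  also have "\<dots> = (\<Sum>b\<in>resid H p m. \<Sum>n<p. if b \<in> resid H p n then 1 else 0)" by (rule sum.swap)
  also have "\<dots> = (\<Sum>b\<in>resid H p m. num_residues H p)"
  proof (rule sum.cong)
    fix b assume "b \<in> resid H p m"
    hence "b \<in> {0..<int p}" using resid_subset[OF p] by blast
    hence "card {n. n < p \<and> b \<in> resid H p n} = num_residues H p" by (rule cnt)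
    moreover have "{n \<in> {..<p}. b \<in> resid H p n} = {n. n < p \<and> b \<in> resid H p n}" by auto
    ultimately show "(\<Sum>n<p. if b \<in> resid H p n then 1 else 0) = num_residues H p"
      by (subst sum.inter_filter[symmetric]) auto
  qed simp
  finally show ?thesis by (simp add: card_resid power2_eq_square)
qed

context
  fixes H :: "int set"
  assumes H: "finite H" "admissible H"
begin

lemma gam_bounds:
  assumes "prime p" shows "1 / real p \<le> gam H p" "gam H p \<le> 1"
proof -
  have p: "p > 0" using assms prime_gt_0_nat by auto
  have "num_residues H p + 1 \<le> p" using H assms by (auto simp: admissible_def)
  hence "real (num_residues H p) + 1 \<le> real p" by linarith
  thus "1 / real p \<le> gam H p" "gam H p \<le> 1" using p by (auto simp: gam_def field_simps)
qed

lemma gam_pos: assumes "prime p" shows "0 < gam H p"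
proof -
  have "0 < 1 / real p" using assms prime_gt_0_nat by simp
  thus ?thesis using gam_bounds(1)[OF assms] by linarith
qed

lemma gam_ge_half:
  assumes "p > 2 * card H" shows "gam H p \<ge> 1 / 2"
proof -
  have "2 * num_residues H p \<le> p" using num_residues_le_card[OF H(1), of p] assms by linarith
  hence "2 * real (num_residues H p) \<le> real p" by linarith
  thus ?thesis using assms by (simp add: gam_def field_simps)
qed

text \<open>Inclusion-exclusion: the right-hand side is the probability that a random residue class
  avoids both \<open>n + H\<close> and \<open>m + H\<close>.\<close>

lemma gam_sq_mult_corr:
  assumes "prime p"
  shows "(gam H p)\<^sup>2 * (1 + corr H p n m) = 1 - real (card (resid H p n \<union> resid H p m)) / real p"
proof -
  have g: "gam H p \<noteq> 0" using gam_pos[OF assms] by simp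
  have p: "real p > 0" using assms prime_gt_0_nat by simp
  have "card (resid H p n \<union> resid H p m) + overlap H p n m = num_residues H p + num_residues H p"
    using card_Un_Int[of "resid H p n" "resid H p m"] H(1) by (simp add: card_resid)
  hence u: "real (card (resid H p n \<union> resid H p m)) = 2 * real (num_residues H p) - real (overlap H p n m)"
    by linarith
  have "(gam H p)\<^sup>2 * (1 + corr H p n m) = (gam H p)\<^sup>2 + (real (overlap H p n m) / real p - (real (num_residues H p) / real p)\<^sup>2)"
    using g by (simp add: corr_def field_simps)
  thus ?thesis unfolding u gam_def using p by (simp add: power2_eq_square field_simps)
qed

lemma gam_sq_mult_corr_bounds:
  assumes "prime p"
  shows "0 \<le> (gam H p)\<^sup>2 * (1 + corr H p n m) \<and> (gam H p)\<^sup>2 * (1 + corr H p n m) \<le> 1"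
proof -
  have p: "p > 0" using assms prime_gt_0_nat by auto
  have "card (resid H p n \<union> resid H p m) \<le> card {0..<int p}"
    using resid_subset[OF p] by (intro card_mono) auto
  thus ?thesis unfolding gam_sq_mult_corr[OF assms] using p by simp
qed

lemma corr_add_period: "corr H p (n + p) m = corr H p n m"
  by (simp add: corr_def resid_add_period)

lemma sum_corr_eq_0:
  assumes "prime p" shows "(\<Sum>n<p. corr H p n m) = 0"
proof -
  have p: "p > 0" using assms prime_gt_0_nat by auto
  have "(\<Sum>n<p. corr H p n m) = (real (\<Sum>n<p. overlap H p n m) / real p - real p * (real (num_residues H p) / real p)\<^sup>2) / (gam H p)\<^sup>2"
    by (simp add: corr_def sum_subtractf flip: sum_divide_distrib)
  also have "\<dots> = 0" unfolding sum_card_resid_Int[OF p H(1)] using p by (simp add: power2_eq_square)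
  finally show ?thesis .
qed

lemma abs_corr_le_small:
  assumes "prime p" shows "\<bar>corr H p n m\<bar> \<le> real p ^ 2"
proof -
  have p: "p > 0" using assms prime_gt_0_nat by auto
  have "num_residues H p \<le> p" using H assms by (auto simp: admissible_def less_imp_le)
  hence 1: "0 \<le> (real (num_residues H p) / real p)\<^sup>2" "(real (num_residues H p) / real p)\<^sup>2 \<le> 1"
    using p by (auto simp: power_le_one)
  have "overlap H p n m \<le> card (resid H p n)" using H by (intro card_mono) auto
  hence "overlap H p n m \<le> p" using \<open>num_residues H p \<le> p\<close> by (simp add: card_resid)
  hence 2: "0 \<le> real (overlap H p n m) / real p" "real (overlap H p n m) / real p \<le> 1"
    using p by auto
  have "(1 / real p)\<^sup>2 \<le> (gam H p)\<^sup>2" using gam_bounds[OF assms] p by (intro power_mono) auto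
  have "\<bar>corr H p n m\<bar> = \<bar>real (overlap H p n m) / real p - (real (num_residues H p) / real p)\<^sup>2\<bar> / (gam H p)\<^sup>2"
    by (simp add: corr_def)
  also have "\<dots> \<le> 1 / (1 / real p)\<^sup>2"
  proof (rule frac_le)
    show "\<bar>real (overlap H p n m) / real p - (real (num_residues H p) / real p)\<^sup>2\<bar> \<le> 1"
      using 1 2 by linarith
  qed (use p \<open>(1 / real p)\<^sup>2 \<le> (gam H p)\<^sup>2\<close> in auto)
  finally show ?thesis by (simp add: power_divide)
qed

lemma abs_corr_le_large:
  assumes "prime p" "p > 2 * card H"
  shows "\<bar>corr H p n m\<bar> \<le> 4 * (real (overlap H p n m) / real p + (real (num_residues H p))\<^sup>2 / real p ^ 2)"
proof -
  have "(1 / 2)\<^sup>2 \<le> (gam H p)\<^sup>2" using gam_ge_half[OF assms(2)] by (intro power_mono) auto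
  have "\<bar>corr H p n m\<bar> = \<bar>real (overlap H p n m) / real p - (real (num_residues H p) / real p)\<^sup>2\<bar> / (gam H p)\<^sup>2"
    by (simp add: corr_def)
  also have "\<dots> \<le> (real (overlap H p n m) / real p + (real (num_residues H p))\<^sup>2 / real p ^ 2) / (1 / 2)\<^sup>2"
  proof (rule frac_le)
    have "real (overlap H p n m) / real p \<ge> 0" "(real (num_residues H p) / real p)\<^sup>2 \<ge> 0" by auto
    thus "\<bar>real (overlap H p n m) / real p - (real (num_residues H p) / real p)\<^sup>2\<bar> \<le> real (overlap H p n m) / real p + (real (num_residues H p))\<^sup>2 / real p ^ 2"
      unfolding power_divide[symmetric] by linarith
  qed (use \<open>(1 / 2)\<^sup>2 \<le> (gam H p)\<^sup>2\<close> in auto)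
  finally show ?thesis by (simp add: power_divide mult.commute)
qed

text \<open>For large \<open>p\<close> both parts of \<open>abs_corr_le_large\<close> have the same
  sum over a period, by \<open>sum_card_resid_Int\<close>; this turns the factor 4 into 8.\<close>

lemma sum_abs_corr_le:
  assumes "prime p" shows "(\<Sum>n<p. \<bar>corr H p n m\<bar>) \<le> corr_bound (card H) p"
proof (cases "p \<le> 2 * card H")
  case True
  have "(\<Sum>n<p. \<bar>corr H p n m\<bar>) \<le> (\<Sum>n<p. real p ^ 2)" using abs_corr_le_small[OF assms] by (intro sum_mono)
  thus ?thesis using True by (simp add: corr_bound_def power3_eq_cube power2_eq_square)
next
  case False
  have p: "p > 0" using assms prime_gt_0_nat by auto
  let ?\<nu> = "real (num_residues H p)"
  have "(\<Sum>n<p. \<bar>corr H p n m\<bar>) \<le> (\<Sum>n<p. 4 * (real (overlap H p n m) / real p + ?\<nu>\<^sup>2 / real p ^ 2))"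
    using False abs_corr_le_large[OF assms] by (intro sum_mono) auto
  also have "\<dots> = 4 * (real (\<Sum>n<p. overlap H p n m) / real p + real p * (?\<nu>\<^sup>2 / real p ^ 2))"
    by (simp add: sum.distrib flip: sum_distrib_left sum_divide_distrib)
  also have "\<dots> = 8 * ?\<nu>\<^sup>2 / real p" unfolding sum_card_resid_Int[OF p H(1)] using p
    by (simp add: power2_eq_square field_simps)
  also have "\<dots> \<le> 8 * real (card H) ^ 2 / real p"
    using num_residues_le_card[OF H(1), of p] by (intro divide_right_mono mult_left_mono power_mono) auto
  finally show ?thesis using False by (simp add: corr_bound_def)
qed

lemma abs_corr_le:
  assumes "prime p" shows "\<bar>corr H p n m\<bar> \<le> corr_bound (card H) p"
proof -
  have p: "p > 0" using assms prime_gt_0_nat by auto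
  have "\<bar>corr H p (n mod p) m\<bar> \<le> (\<Sum>n<p. \<bar>corr H p n m\<bar>)"
    using p by (intro member_le_sum) auto
  moreover have "corr H p (n mod p) m = corr H p n m"
    by (rule periodic_mod[where r = "\<lambda>n. corr H p n m"]) (rule corr_add_period)
  ultimately show ?thesis using sum_abs_corr_le[OF assms, of m] by simp
qed

end

text \<open>A product of \<open>k\<close> distinct primes is at least \<open>2 ^ k\<close>.\<close>

lemma card_prime_divisors_le:
  fixes q :: int
  assumes "q \<noteq> 0" "\<bar>q\<bar> < 2 ^ M" "finite P" "\<And>p. p \<in> P \<Longrightarrow> prime p \<and> int p dvd q"
  shows "card P \<le> M"
proof -
  have "(\<Prod>p\<in>P. p ^ 1) dvd nat \<bar>q\<bar>"
  proof (rule prod_distinct_primes_dvd)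
    fix p assume "p \<in> P"
    thus "p ^ 1 dvd nat \<bar>q\<bar>" using assms(4)[of p] by (metis int_dvd_int_iff int_nat_eq abs_ge_zero dvd_abs_iff power_one_right)
  qed (use assms in auto)
  hence "\<Prod>P \<le> nat \<bar>q\<bar>" using assms by (intro dvd_imp_le) auto
  moreover have "2 ^ card P \<le> \<Prod>P"
  proof -
    have "(\<Prod>p\<in>P. 2) \<le> \<Prod>P" using assms prime_ge_2_nat by (intro prod_mono) auto
    thus ?thesis by simp
  qed
  ultimately have "int (2 ^ card P) \<le> \<bar>q\<bar>" by linarith
  with assms(2) have "(2::int) ^ card P < 2 ^ M" unfolding of_nat_power of_nat_numeral by linarith
  thus ?thesis by simp
qed

lemma sum_inverse_primes_le:
  assumes "Z \<ge> 1" shows "(\<Sum>p\<in>primes_upto Z. 1 / real p) \<le> 1 + ln Z"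
proof -
  have "(\<Sum>p\<in>primes_upto Z. 1 / real p) \<le> (\<Sum>p=1..Z. 1 / real p)"
    by (intro sum_mono2) (auto simp: primes_upto_def dest: prime_gt_0_nat)
  also have "\<dots> = harm Z" by (simp add: harm_def inverse_eq_divide)
  also have "\<dots> \<le> 1 + ln Z"
    using assms
  proof (induction Z rule: dec_induct)
    case (step n)
    have "1 / real (Suc n) \<le> ln (real (Suc n)) - ln (real n)"
    proof -
      have "ln (real n / real (Suc n)) \<le> real n / real (Suc n) - 1" using step by (intro ln_le_minus_one) auto
      also have "\<dots> = - (1 / real (Suc n))" by (simp add: field_simps)
      also have "ln (real n / real (Suc n)) = ln (real n) - ln (real (Suc n))" using step by (intro ln_divide_pos) auto
      finally show ?thesis by linarith
    qed
    thus ?case using step by (simp add: harm_Suc inverse_eq_divide)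
  qed (simp add: harm_def)
  finally show ?thesis .
qed

text \<open>In the tail \<open>1 / p < d / N\<close>, which extracts the factor
  \<open>d / N\<close>. The overlaps then count primes dividing some
  \<open>n + h - (m + h')\<close>; these differences are nonzero and below \<open>2 ^ M\<close>, so
  each has at most \<open>M\<close> prime divisors. The fourth power of \<open>card H\<close>
  accounts for the primes up to \<open>2 * card H\<close>.\<close>

lemma corr_tail:
  fixes H :: "int set" and Z N d n m M :: nat
  assumes H: "finite H" "admissible H"
    and ne: "\<And>h h'. h \<in> H \<Longrightarrow> h' \<in> H \<Longrightarrow> int n + h \<noteq> int m + h'"
    and M: "\<And>h h'. h \<in> H \<Longrightarrow> h' \<in> H \<Longrightarrow> \<bar>int n + h - (int m + h')\<bar> < 2 ^ M"
    and Z: "Z \<ge> 1" and N: "N \<ge> 1" and d: "d \<ge> 1"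
  shows "(\<Sum>p | p \<in> primes_upto Z \<and> real N < real p * real d. \<bar>corr H p n m\<bar>) \<le> 
           ((2 * real (card H)) ^ 4 + 4 * real (card H) ^ 2 * (real M + 1 + ln Z)) * real d / real N"
proof -
  let ?K = "real (card H)" and ?P = "{p. p \<in> primes_upto Z \<and> real N < real p * real d}"
  have bound: "\<bar>corr H p n m\<bar> \<le> (real d / real N) * ((if p \<le> 2 * card H then (2 * ?K) ^ 3 else 0) + (4 * real (overlap H p n m) + 4 * ?K ^ 2 * (1 / real p)))"
    if p: "p \<in> ?P" for p
  proof -
    have pr: "prime p" "p > 0" using p in_primes_uptoD prime_gt_0_nat by auto
    have inv: "1 / real p \<le> real d / real N" using p pr N by (simp add: field_simps)
    show ?thesis
    proof (cases "p \<le> 2 * card H")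
      case True
      have "\<bar>corr H p n m\<bar> \<le> real p ^ 2" by (rule abs_corr_le_small[OF H pr(1)])
      also have "\<dots> = (1 / real p) * real p ^ 3" using pr by (simp add: power3_eq_cube power2_eq_square)
      also have "\<dots> \<le> (real d / real N) * (2 * ?K) ^ 3"
        using True by (intro mult_mono inv power_mono) auto
      also have "\<dots> \<le> (real d / real N) * ((2 * ?K) ^ 3 + (4 * real (overlap H p n m) + 4 * ?K ^ 2 * (1 / real p)))"
        by (intro mult_left_mono) auto
      finally show ?thesis using True by simp
    next
      case False
      have "\<bar>corr H p n m\<bar> \<le> 4 * (real (overlap H p n m) / real p + (real (num_residues H p))\<^sup>2 / real p ^ 2)"
        using False by (intro abs_corr_le_large[OF H pr(1)]) auto
      also have "\<dots> = (1 / real p) * (4 * real (overlap H p n m) + 4 * (real (num_residues H p))\<^sup>2 * (1 / real p))"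
        using pr by (simp add: power2_eq_square field_simps)
      also have "\<dots> \<le> (real d / real N) * (4 * real (overlap H p n m) + 4 * ?K ^ 2 * (1 / real p))"
        using num_residues_le_card[OF H(1), of p]
        by (intro mult_mono inv add_mono order.refl power_mono mult_left_mono mult_right_mono) auto
      finally show ?thesis using False by simp
    qed
  qed
  have "(\<Sum>p\<in>?P. \<bar>corr H p n m\<bar>) \<le> (\<Sum>p\<in>?P. (real d / real N) * ((if p \<le> 2 * card H then (2 * ?K) ^ 3 else 0) + (4 * real (overlap H p n m) + 4 * ?K ^ 2 * (1 / real p))))"
    by (intro sum_mono bound)
  also have "\<dots> \<le> (\<Sum>p\<in>primes_upto Z. (real d / real N) * ((if p \<le> 2 * card H then (2 * ?K) ^ 3 else 0) + (4 * real (overlap H p n m) + 4 * ?K ^ 2 * (1 / real p))))"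
    by (intro sum_mono2) (auto intro!: mult_nonneg_nonneg add_nonneg_nonneg)
  also have "\<dots> = (real d / real N) * ((\<Sum>p\<in>primes_upto Z. if p \<le> 2 * card H then (2 * ?K) ^ 3 else 0) + (4 * real (\<Sum>p\<in>primes_upto Z. overlap H p n m) + 4 * ?K ^ 2 * (\<Sum>p\<in>primes_upto Z. 1 / real p)))"
    by (simp only: sum_distrib_left[symmetric] sum.distrib of_nat_sum)
  also have "\<dots> \<le> (real d / real N) * ((2 * ?K) ^ 4 + (4 * (?K ^ 2 * real M) + 4 * ?K ^ 2 * (1 + ln Z)))"
  proof (intro mult_left_mono add_mono)
    have "(\<Sum>p\<in>primes_upto Z. if p \<le> 2 * card H then (2 * ?K) ^ 3 else 0) = (\<Sum>p | p \<in> primes_upto Z \<and> p \<le> 2 * card H. (2 * ?K) ^ 3)"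
      by (subst sum.inter_filter[symmetric]) auto
    also have "\<dots> \<le> (\<Sum>p\<in>{1..2 * card H}. (2 * ?K) ^ 3)"
      by (intro sum_mono2) (auto simp: primes_upto_def dest: prime_gt_0_nat)
    also have "\<dots> = (2 * ?K) ^ 4" by (simp add: eval_nat_numeral)
    finally show "(\<Sum>p\<in>primes_upto Z. if p \<le> 2 * card H then (2 * ?K) ^ 3 else 0) \<le> (2 * ?K) ^ 4" .
    show "(\<Sum>p\<in>primes_upto Z. 1 / real p) \<le> 1 + ln Z" by (rule sum_inverse_primes_le[OF Z])
    have "(\<Sum>p\<in>primes_upto Z. overlap H p n m) \<le> (\<Sum>p\<in>primes_upto Z. card {(h, h') \<in> H \<times> H. int p dvd (int n + h - (int m + h'))})"
    proof (rule sum_mono)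
      fix p assume "p \<in> primes_upto Z"
      have "resid H p n \<inter> resid H p m \<subseteq> (\<lambda>(h, h'). (int n + h) mod int p) ` {(h, h') \<in> H \<times> H. int p dvd (int n + h - (int m + h'))}"
      proof
        fix x assume "x \<in> resid H p n \<inter> resid H p m"
        then obtain h h' where h: "h \<in> H" "h' \<in> H" "x = (int n + h) mod int p" "x = (int m + h') mod int p"
          by (auto simp: resid_def)
        hence "(int n + h) mod int p = (int m + h') mod int p" by simp
        hence "int p dvd (int n + h - (int m + h'))" by (simp only: mod_eq_dvd_iff)
        thus "x \<in> (\<lambda>(h, h'). (int n + h) mod int p) ` {(h, h') \<in> H \<times> H. int p dvd (int n + h - (int m + h'))}"
          using h by force
      qed
      moreover have fin: "finite {(h, h') \<in> H \<times> H. int p dvd (int n + h - (int m + h'))}"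
        by (rule finite_subset[of _ "H \<times> H"]) (use H in auto)
      ultimately have "overlap H p n m \<le> card ((\<lambda>(h, h'). (int n + h) mod int p) ` {(h, h') \<in> H \<times> H. int p dvd (int n + h - (int m + h'))})"
        by (intro card_mono) auto
      also have "\<dots> \<le> card {(h, h') \<in> H \<times> H. int p dvd (int n + h - (int m + h'))}" by (rule card_image_le[OF fin])
      finally show "overlap H p n m \<le> card {(h, h') \<in> H \<times> H. int p dvd (int n + h - (int m + h'))}" .
    qed
    also have "\<dots> = (\<Sum>p\<in>primes_upto Z. \<Sum>x\<in>H \<times> H. if int p dvd (int n + fst x - (int m + snd x)) then 1 else 0)"
      using H by (intro sum.cong refl, subst sum.inter_filter[symmetric]) (auto simp: case_prod_unfold intro!: arg_cong[where f = card])
    also have "\<dots> = (\<Sum>x\<in>H \<times> H. \<Sum>p\<in>primes_upto Z. if int p dvd (int n + fst x - (int m + snd x)) then 1 else 0)"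
      by (rule sum.swap)
    also have "\<dots> \<le> (\<Sum>x\<in>H \<times> H. M)"
    proof (rule sum_mono)
      fix x assume x: "x \<in> H \<times> H"
      have "card {p \<in> primes_upto Z. int p dvd (int n + fst x - (int m + snd x))} \<le> M"
        by (rule card_prime_divisors_le[of "int n + fst x - (int m + snd x)"])
           (use x ne[of "fst x" "snd x"] M[of "fst x" "snd x"] in \<open>auto dest: in_primes_uptoD\<close>)
      thus "(\<Sum>p\<in>primes_upto Z. if int p dvd (int n + fst x - (int m + snd x)) then 1 else 0) \<le> M"
        by (subst sum.inter_filter[symmetric]) auto
    qed
    also have "\<dots> = card H ^ 2 * M" using H by (simp add: card_cartesian_product power2_eq_square)
    finally have "real (\<Sum>p\<in>primes_upto Z. overlap H p n m) \<le> real (card H ^ 2 * M)" by (rule of_nat_mono)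
    thus "real (\<Sum>p\<in>primes_upto Z. overlap H p n m) \<le> ?K ^ 2 * real M" by simp
  qed auto
  also have "\<dots> = ((2 * ?K) ^ 4 + 4 * ?K ^ 2 * (real M + 1 + ln Z)) * real d / real N"
    using N by (simp add: field_simps)
  finally show ?thesis .
qed

text \<open>The exceptional pairs are those where \<open>n + H\<close> and \<open>m + H\<close>
  meet; for given \<open>m\<close> such an \<open>n\<close> has the form \<open>m + h' - h\<close>,
  which leaves at most \<open>card H ^ 2\<close> values.\<close>

lemma corr_covariance_sum_bound:
  fixes H :: "int set" and y :: "nat \<Rightarrow> nat" and i j N Z M :: nat
  defines "V \<equiv> \<lambda>n. \<Prod>p\<in>primes_upto (y n). gam H p"
    and "T \<equiv> corr_bound_sum (card H) Z (real N)"
    and "C1 \<equiv> (2 * real (card H)) ^ 4 + 4 * real (card H) ^ 2 * (real M + 1 + ln Z)"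
  assumes H: "finite H" "admissible H" "H \<subseteq> {0..int D}"
    and y: "\<And>n m. i \<le> n \<Longrightarrow> n \<le> m \<Longrightarrow> m < j \<Longrightarrow> y n \<le> y m"
    and Z: "\<And>n. i \<le> n \<Longrightarrow> n < j \<Longrightarrow> y n \<le> Z" "Z \<ge> 1"
    and len: "j - i \<le> N" and N: "N \<ge> 1" and M: "j + D < 2 ^ M"
  shows "(\<Sum>n=i..<j. \<Sum>m=i..<j. V n * V m * ((\<Prod>p\<in>primes_upto (min (y n) (y m)). 1 + corr H p n m) - 1))
           \<le> real N * T * (1 + 2 * C1 + 2 * real (card H) ^ 2)"
  unfolding V_def T_def
proof (rule covariance_sum_bound[where E = "\<lambda>n m. \<exists>h\<in>H. \<exists>h'\<in>H. int n + h = int m + h'"])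
  show "C1 \<ge> 0" unfolding C1_def using Z by auto
  fix n m d :: nat
  assume *: "n \<in> {i..<j}" "m \<in> {i..<j}" "\<not> (\<exists>h\<in>H. \<exists>h'\<in>H. int n + h = int m + h')" "1 \<le> d"
  show "(\<Sum>p | p \<in> primes_upto Z \<and> real N < real p * real d. \<bar>corr H p n m\<bar>) \<le> C1 * real d / real N"
    unfolding C1_def
  proof (rule corr_tail[OF H(1,2) _ _ Z(2) N *(4)])
    fix h h' assume h: "h \<in> H" "h' \<in> H"
    thus "int n + h \<noteq> int m + h'" using * by blast
    have "0 \<le> h" "h \<le> int D" "0 \<le> h'" "h' \<le> int D" using h H by auto
    hence "\<bar>int n + h - (int m + h')\<bar> < int j + int D" using * by auto
    also have "\<dots> = int (j + D)" by simp
    also have "\<dots> < int (2 ^ M)" using M by (rule of_nat_less_iff[THEN iffD2])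
    finally show "\<bar>int n + h - (int m + h')\<bar> < 2 ^ M" by simp
  qed
next
  fix m assume "m \<in> {i..<j}"
  have "{n \<in> {i..<j}. \<exists>h\<in>H. \<exists>h'\<in>H. int n + h = int m + h'} \<subseteq> (\<lambda>(h, h'). nat (int m + h' - h)) ` (H \<times> H)"
  proof
    fix n assume "n \<in> {n \<in> {i..<j}. \<exists>h\<in>H. \<exists>h'\<in>H. int n + h = int m + h'}"
    then obtain h h' where h: "h \<in> H" "h' \<in> H" "int n = int m + h' - h" by (auto simp: algebra_simps)
    hence "n = nat (int m + h' - h)" by linarith
    thus "n \<in> (\<lambda>(h, h'). nat (int m + h' - h)) ` (H \<times> H)" using h
      by (intro image_eqI[of _ _ "(h, h')"]) auto
  qed
  hence "card {n \<in> {i..<j}. \<exists>h\<in>H. \<exists>h'\<in>H. int n + h = int m + h'} \<le> card (H \<times> H)"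
    using H(1) by (intro surj_card_le) auto
  thus "real (card {n \<in> {i..<j}. \<exists>h\<in>H. \<exists>h'\<in>H. int n + h = int m + h'}) \<le> real (card H) ^ 2"
    by (simp add: card_cartesian_product power2_eq_square flip: of_nat_mult)
qed (use y Z len N gam_pos[OF H(1,2)] gam_bounds[OF H(1,2)] gam_sq_mult_corr_bounds[OF H(1,2)] corr_add_period[OF H(1,2)]
  sum_corr_eq_0[OF H(1,2)] sum_abs_corr_le[OF H(1,2)] abs_corr_le[OF H(1,2)] in auto)

section \<open>Second moment of the random sieve\<close>

definition survives :: "int set \<Rightarrow> (nat \<Rightarrow> int) \<Rightarrow> nat \<Rightarrow> nat \<Rightarrow> bool" where
  "survives H a k n \<longleftrightarrow> (\<forall>p\<in>primes_upto k. a p mod int p \<notin> resid H p n)"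

definition sieve_density :: "int set \<Rightarrow> nat \<Rightarrow> real" where
  "sieve_density H k = (\<Prod>p\<in>primes_upto k. gam H p)"

lemma survives_iff: "survives H a k n \<longleftrightarrow> (\<forall>h\<in>H. int n + h \<in> sieved a (real k))"
  unfolding survives_def sieved_def resid_def primes_upto_def cong_def by (auto simp: image_iff) metis+

context prob_space
begin

context
  fixes a :: "nat \<Rightarrow> 'a \<Rightarrow> int"
  assumes indep: "indep_vars (\<lambda>_. count_space UNIV) a {p. prime p}"
    and unif: "\<And>p. prime p \<Longrightarrow> distr M (count_space UNIV) (a p) = measure_pmf (pmf_of_set {0..<int p})"
begin

lemma measurable_a: "prime p \<Longrightarrow> a p \<in> measurable M (count_space UNIV)"
  using indep unfolding indep_vars_def by auto

text \<open>Independence factors the expectation; each factor is the chance that a uniform residue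
  misses \<open>B p\<close>.\<close>

lemma
  assumes P: "finite P" "\<And>p. p \<in> P \<Longrightarrow> prime p" "\<And>p. p \<in> P \<Longrightarrow> B p \<subseteq> {0..<int p}"
  shows expectation_prod_avoid: "expectation (\<lambda>\<omega>. \<Prod>p\<in>P. 1 - indicator (B p) (a p \<omega> mod int p)) = (\<Prod>p\<in>P. 1 - real (card (B p)) / real p)" (is ?eq)
    and integrable_prod_avoid: "integrable M (\<lambda>\<omega>. \<Prod>p\<in>P. 1 - indicator (B p) (a p \<omega> mod int p) :: real)" (is ?int)
proof -
  let ?X = "\<lambda>p \<omega>. 1 - indicator (B p) (a p \<omega> mod int p) :: real"
  have ind: "indep_vars (\<lambda>_. borel) ?X P"
  proof (rule indep_vars_compose2[where Y = "\<lambda>p k. 1 - indicator (B p) (k mod int p)"])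
    show "indep_vars (\<lambda>_. count_space UNIV) a P"
      by (rule indep_vars_subset[OF indep]) (use P in auto)
  qed auto
  have E: "expectation (?X p) = 1 - real (card (B p)) / real p" and I: "integrable M (?X p)" if p: "p \<in> P" for p
  proof -
    have pr: "prime p" "p > 0" using P(2)[OF p] prime_gt_0_nat by auto
    have fin: "finite {0..<int p}" "{0..<int p} \<noteq> {}" using pr by auto
    have "integrable (measure_pmf (pmf_of_set {0..<int p})) (\<lambda>k. 1 - indicator (B p) (k mod int p) :: real)"
      by (intro integrable_measure_pmf_finite) (use fin in auto)
    thus "integrable M (?X p)"
      unfolding unif[OF pr(1), symmetric] using measurable_a[OF pr(1)] by (subst (asm) integrable_distr_eq) auto
    have "expectation (?X p) = measure_pmf.expectation (pmf_of_set {0..<int p}) (\<lambda>k. 1 - indicator (B p) (k mod int p))"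
      unfolding unif[OF pr(1), symmetric] using measurable_a[OF pr(1)] by (subst integral_distr) auto
    also have "\<dots> = (\<Sum>k\<in>{0..<int p}. 1 - indicator (B p) (k mod int p)) / real (card {0..<int p})"
      using fin by (intro integral_pmf_of_set)
    also have "(\<Sum>k\<in>{0..<int p}. 1 - indicator (B p) (k mod int p)) = real p - (\<Sum>k\<in>{0..<int p}. indicator (B p) k)"
      by (simp add: sum_subtractf)
    also have "(\<Sum>k\<in>{0..<int p}. indicator (B p) k) = real (card (B p))"
      using P(3)[OF p] by (simp add: indicator_def sum.If_cases Int_absorb1)
    finally show "expectation (?X p) = 1 - real (card (B p)) / real p" using pr by (simp add: field_simps)
  qed
  show ?eq using indep_vars_lebesgue_integral[OF P(1) ind I] E by (simp cong: prod.cong)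
  show ?int by (rule indep_vars_integrable[OF P(1) ind I])
qed

context
  fixes H :: "int set" and y :: "nat \<Rightarrow> nat"
  assumes H: "finite H" "admissible H"
begin

text \<open>Primes between \<open>k\<close> and \<open>Z\<close> receive an empty forbidden set. In
  this form events with different levels are products over the same primes and can be multiplied
  factor by factor.\<close>

lemma of_bool_survives:
  assumes "k \<le> Z"
  shows "of_bool (survives H a' k n) = (\<Prod>p\<in>primes_upto Z. 1 - indicator (if p \<le> k then resid H p n else {}) (a' p mod int p) :: real)"
proof (cases "survives H a' k n")
  case True
  hence "(\<Prod>p\<in>primes_upto Z. 1 - indicator (if p \<le> k then resid H p n else {}) (a' p mod int p) :: real) = (\<Prod>p\<in>primes_upto Z. 1)"
    by (intro prod.cong) (auto simp: survives_def primes_upto_def)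
  thus ?thesis using True by simp
next
  case False
  then obtain p where p: "p \<in> primes_upto k" "a' p mod int p \<in> resid H p n" by (auto simp: survives_def)
  have "(\<Prod>p\<in>primes_upto Z. 1 - indicator (if p \<le> k then resid H p n else {}) (a' p mod int p) :: real) = 0"
    using p assms by (intro prod_zero bexI[of _ p]) (auto simp: primes_upto_def)
  thus ?thesis using False by simp
qed

lemma
  assumes "k \<le> Z"
  shows expectation_survives: "expectation (\<lambda>\<omega>. of_bool (survives H (\<lambda>p. a p \<omega>) k n)) = sieve_density H k"
    and integrable_survives: "integrable M (\<lambda>\<omega>. of_bool (survives H (\<lambda>p. a p \<omega>) k n) :: real)"
proof -
  have B: "(if p \<le> k then resid H p n else {}) \<subseteq> {0..<int p}" if "p \<in> primes_upto k" for p
    using resid_subset[of p H n] prime_gt_0_nat[OF in_primes_uptoD[OF that]] by auto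
  note fin = finite_primes_upto[of k]
  show "integrable M (\<lambda>\<omega>. of_bool (survives H (\<lambda>p. a p \<omega>) k n) :: real)"
    unfolding of_bool_survives[OF order.refl] by (rule integrable_prod_avoid[OF fin in_primes_uptoD B])
  show "expectation (\<lambda>\<omega>. of_bool (survives H (\<lambda>p. a p \<omega>) k n)) = sieve_density H k"
    unfolding of_bool_survives[OF order.refl] sieve_density_def gam_def
    by (subst expectation_prod_avoid[OF fin in_primes_uptoD B]; (assumption)?) (intro prod.cong, auto simp: card_resid primes_upto_def)
qed

text \<open>Primes up to \<open>k\<close> constrain both places and are evaluated by
  \<open>gam_sq_mult_corr\<close>; those between \<open>k\<close> and \<open>l\<close> constrain
  only \<open>m\<close> and contribute \<open>gam\<close>.\<close>

lemma
  assumes kl: "k \<le> l"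
  shows expectation_survives_mult: "expectation (\<lambda>\<omega>. of_bool (survives H (\<lambda>p. a p \<omega>) k n) * of_bool (survives H (\<lambda>p. a p \<omega>) l m)) =
      sieve_density H k * sieve_density H l * (\<Prod>p\<in>primes_upto k. 1 + corr H p n m)" (is ?eq)
    and integrable_survives_mult: "integrable M (\<lambda>\<omega>. of_bool (survives H (\<lambda>p. a p \<omega>) k n) * of_bool (survives H (\<lambda>p. a p \<omega>) l m) :: real)" (is ?int)
proof -
  let ?B = "\<lambda>p. (if p \<le> k then resid H p n else {}) \<union> resid H p m"
  have B: "?B p \<subseteq> {0..<int p}" if "p \<in> primes_upto l" for p
    using resid_subset[of p H] prime_gt_0_nat[OF in_primes_uptoD[OF that]] by auto
  note fin = finite_primes_upto[of l]
  have eq: "of_bool (survives H (\<lambda>p. a p \<omega>) k n) * of_bool (survives H (\<lambda>p. a p \<omega>) l m) = (\<Prod>p\<in>primes_upto l. 1 - indicator (?B p) (a p \<omega> mod int p) :: real)" for \<omega>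
    unfolding of_bool_survives[OF kl] of_bool_survives[OF order.refl[of l]] prod.distrib[symmetric]
    by (intro prod.cong refl) (auto simp: indicator_def primes_upto_def)
  show ?int unfolding eq by (rule integrable_prod_avoid[OF fin in_primes_uptoD B])
  have split: "prod f (primes_upto l) = prod f (primes_upto l - primes_upto k) * prod f (primes_upto k)" for f :: "nat \<Rightarrow> real"
    using primes_upto_mono[OF kl] by (intro prod.subset_diff) auto
  have "(\<Prod>p\<in>primes_upto l. 1 - real (card (?B p)) / real p) = 
     (\<Prod>p\<in>primes_upto l - primes_upto k. gam H p) * (\<Prod>p\<in>primes_upto k. (gam H p)\<^sup>2 * (1 + corr H p n m))"
    unfolding split
  proof (intro arg_cong2[where f = "(*)"] prod.cong refl)
    fix p assume "p \<in> primes_upto l - primes_upto k"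
    thus "1 - real (card (?B p)) / real p = gam H p" by (auto simp: gam_def card_resid primes_upto_def)
  next
    fix p assume "p \<in> primes_upto k"
    thus "1 - real (card (?B p)) / real p = (gam H p)\<^sup>2 * (1 + corr H p n m)"
      by (subst gam_sq_mult_corr[OF H]) (auto simp: primes_upto_def)
  qed
  also have "\<dots> = sieve_density H k * sieve_density H l * (\<Prod>p\<in>primes_upto k. 1 + corr H p n m)"
    unfolding sieve_density_def split by (simp add: prod.distrib power2_eq_square)
  finally show ?eq unfolding eq by (subst expectation_prod_avoid[OF fin in_primes_uptoD B]; (assumption)?)
qed

lemma
  shows expectation_survives_mult': "expectation (\<lambda>\<omega>. of_bool (survives H (\<lambda>p. a p \<omega>) k n) * of_bool (survives H (\<lambda>p. a p \<omega>) l m)) =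
      sieve_density H k * sieve_density H l * (\<Prod>p\<in>primes_upto (min k l). 1 + corr H p n m)" (is ?eq)
    and integrable_survives_mult': "integrable M (\<lambda>\<omega>. of_bool (survives H (\<lambda>p. a p \<omega>) k n) * of_bool (survives H (\<lambda>p. a p \<omega>) l m) :: real)" (is ?int)
proof -
  have sym: "corr H p n m = corr H p m n" for p by (simp add: corr_def Int_commute)
  have "?eq \<and> ?int"
  proof (cases "k \<le> l")
    case True
    thus ?thesis using expectation_survives_mult[OF True] integrable_survives_mult[OF True] by (simp add: min_def)
  next
    case False
    hence "l \<le> k" by simp
    from expectation_survives_mult[OF this, of m n] integrable_survives_mult[OF this, of m n] show ?thesis
      using False by (simp add: min_def sym mult.commute)
  qed
  thus ?eq ?int by auto
qed

text \<open>Chebyshev's inequality; expanding the square turns the second moment into the sum of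
  covariances bounded in \<open>corr_covariance_sum_bound\<close>.\<close>

lemma prob_block_deviation_le:
  fixes i j N Z K D :: nat and t :: real
  defines "T \<equiv> corr_bound_sum (card H) Z (real N)"
    and "C1 \<equiv> (2 * real (card H)) ^ 4 + 4 * real (card H) ^ 2 * (real K + 1 + ln Z)"
  assumes HD: "H \<subseteq> {0..int D}"
    and y: "\<And>n m. i \<le> n \<Longrightarrow> n \<le> m \<Longrightarrow> m < j \<Longrightarrow> y n \<le> y m"
    and Z: "\<And>n. i \<le> n \<Longrightarrow> n < j \<Longrightarrow> y n \<le> Z" "Z \<ge> 1"
    and len: "j - i \<le> N" and N: "N \<ge> 1" and K: "j + D < 2 ^ K" and t: "t > 0"
  shows "prob {\<omega> \<in> space M. t \<le> \<bar>\<Sum>n=i..<j. of_bool (survives H (\<lambda>p. a p \<omega>) (y n) n) - sieve_density H (y n)\<bar>} 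
           \<le> real N * T * (1 + 2 * C1 + 2 * real (card H) ^ 2) / t\<^sup>2"
proof -
  let ?g = "\<lambda>n \<omega>. of_bool (survives H (\<lambda>p. a p \<omega>) (y n) n) :: real"
  let ?V = "\<lambda>n. sieve_density H (y n)"
  let ?F = "\<lambda>\<omega>. \<Sum>n=i..<j. ?g n \<omega> - ?V n"
  have sq: "(?F \<omega>)\<^sup>2 = (\<Sum>n=i..<j. \<Sum>m=i..<j. ?g n \<omega> * ?g m \<omega> - ?g n \<omega> * ?V m - ?g m \<omega> * ?V n + ?V n * ?V m)" for \<omega>
    unfolding power2_eq_square sum_product by (intro sum.cong refl) (simp add: algebra_simps)
  note [simp] = integrable_survives[OF order.refl] integrable_survives_mult' expectation_survives[OF order.refl]
  have int1: "integrable M ?F" by (intro Bochner_Integration.integrable_sum Bochner_Integration.integrable_diff) auto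
  have int2: "integrable M (\<lambda>\<omega>. (?F \<omega>)\<^sup>2)" unfolding sq
    by (intro Bochner_Integration.integrable_sum Bochner_Integration.integrable_diff Bochner_Integration.integrable_add integrable_mult_left) auto
  have "expectation (\<lambda>\<omega>. (?F \<omega>)\<^sup>2) = (\<Sum>n=i..<j. \<Sum>m=i..<j. expectation (\<lambda>\<omega>. ?g n \<omega> * ?g m \<omega> - ?g n \<omega> * ?V m - ?g m \<omega> * ?V n + ?V n * ?V m))"
    unfolding sq by (subst Bochner_Integration.integral_sum; (intro sum.cong refl Bochner_Integration.integral_sum)?;
      (intro Bochner_Integration.integrable_sum Bochner_Integration.integrable_diff Bochner_Integration.integrable_add integrable_mult_left)?; simp)
  also have "\<dots> = (\<Sum>n=i..<j. \<Sum>m=i..<j. ?V n * ?V m * ((\<Prod>p\<in>primes_upto (min (y n) (y m)). 1 + corr H p n m) - 1))"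
  proof (intro sum.cong refl)
    fix n m
    have "expectation (\<lambda>\<omega>. ?g n \<omega> * ?g m \<omega> - ?g n \<omega> * ?V m - ?g m \<omega> * ?V n + ?V n * ?V m) = 
      expectation (\<lambda>\<omega>. ?g n \<omega> * ?g m \<omega>) - expectation (?g n) * ?V m - expectation (?g m) * ?V n + ?V n * ?V m"
      by (simp add: prob_space)
    also have "\<dots> = ?V n * ?V m * (\<Prod>p\<in>primes_upto (min (y n) (y m)). 1 + corr H p n m) - ?V n * ?V m"
      unfolding expectation_survives_mult' by simp
    finally show "expectation (\<lambda>\<omega>. ?g n \<omega> * ?g m \<omega> - ?g n \<omega> * ?V m - ?g m \<omega> * ?V n + ?V n * ?V m) = 
       ?V n * ?V m * ((\<Prod>p\<in>primes_upto (min (y n) (y m)). 1 + corr H p n m) - 1)"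
      by (simp add: algebra_simps)
  qed
  also have "\<dots> \<le> real N * T * (1 + 2 * C1 + 2 * real (card H) ^ 2)"
    unfolding T_def C1_def sieve_density_def
    by (rule corr_covariance_sum_bound[OF H HD y Z len N K]) auto
  finally have E: "expectation (\<lambda>\<omega>. (?F \<omega>)\<^sup>2) \<le> real N * T * (1 + 2 * C1 + 2 * real (card H) ^ 2)" .
  have "prob {\<omega> \<in> space M. t \<le> \<bar>?F \<omega>\<bar>} \<le> expectation (\<lambda>\<omega>. (?F \<omega>)\<^sup>2) / t\<^sup>2"
    by (rule second_moment_method[OF borel_measurable_integrable[OF int1] int2 t])
  also have "\<dots> \<le> real N * T * (1 + 2 * C1 + 2 * real (card H) ^ 2) / t\<^sup>2"
    by (intro divide_right_mono E) auto
  finally show ?thesis .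
qed

end
end
end

section \<open>Moments of the correlation weights\<close>

text \<open>Following the binary digits of \<open>u\<close>, an initial segment splits into dyadic
  blocks of distinct lengths. All endpoints are thus controlled by the blocks alone, at the cost of
  a factor \<open>J + 1\<close>.\<close>

lemma dyadic_prefix_sum_le:
  fixes f :: "nat \<Rightarrow> real"
  assumes blocks: "\<And>i m. i \<le> J \<Longrightarrow> (m + 1) * 2 ^ i \<le> 2 ^ J \<Longrightarrow> \<bar>\<Sum>n\<in>{m * 2 ^ i..<(m + 1) * 2 ^ i}. f n\<bar> \<le> B"
    and u: "u \<le> 2 ^ J"
  shows "\<bar>\<Sum>n<u. f n\<bar> \<le> (real J + 1) * B"
proof -
  have B: "B \<ge> 0" using blocks[of 0 0] by simp
  \<comment> \<open>Stated for segments at the start of an arbitrary dyadic block, so that the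
    induction applies to the second half of a block.\<close>
  have "\<bar>\<Sum>n\<in>{m * 2 ^ i..<m * 2 ^ i + v}. f n\<bar> \<le> (real i + 1) * B"
    if "i \<le> J" "(m + 1) * 2 ^ i \<le> 2 ^ J" "v \<le> 2 ^ i" for i m v
    using that
  proof (induction i arbitrary: m v)
    case 0
    have "v = 0 \<or> v = 1" using 0 by auto
    thus ?case using blocks[of 0 m] 0 B by auto
  next
    case (Suc i)
    have s: "m * 2 ^ Suc i = (2 * m) * 2 ^ i" "(2 * m + 1) * 2 ^ i = (2 * m) * 2 ^ i + 2 ^ i"
      "(2 * m + 1 + 1) * 2 ^ i = (m + 1) * 2 ^ Suc i"
      by (auto simp: algebra_simps)
    have le: "(2 * m + 1) * 2 ^ i \<le> 2 ^ J" "(2 * m + 1 + 1) * 2 ^ i \<le> 2 ^ J"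
      using Suc.prems by (auto simp: algebra_simps)
    show ?case
    proof (cases "v \<le> 2 ^ i")
      case True
      have "\<bar>\<Sum>n\<in>{m * 2 ^ Suc i..<m * 2 ^ Suc i + v}. f n\<bar> \<le> (real i + 1) * B"
        unfolding s(1) using Suc.prems le True by (intro Suc.IH) auto
      also have "\<dots> \<le> (real (Suc i) + 1) * B" using B by (intro mult_right_mono) auto
      finally show ?thesis .
    next
      case False
      have "(\<Sum>n\<in>{m * 2 ^ Suc i..<m * 2 ^ Suc i + v}. f n) =
              (\<Sum>n\<in>{2 * m * 2 ^ i..<(2 * m + 1) * 2 ^ i}. f n) + (\<Sum>n\<in>{(2 * m + 1) * 2 ^ i..<(2 * m + 1) * 2 ^ i + (v - 2 ^ i)}. f n)"
        using False unfolding s(1) by (subst sum.atLeastLessThan_concat) (auto simp: algebra_simps)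
      also have "\<bar>\<dots>\<bar> \<le> B + (real i + 1) * B"
      proof (rule order_trans[OF abs_triangle_ineq], intro add_mono)
        show "\<bar>\<Sum>n\<in>{2 * m * 2 ^ i..<(2 * m + 1) * 2 ^ i}. f n\<bar> \<le> B"
          using blocks[of i "2 * m"] Suc.prems le by simp
        show "\<bar>\<Sum>n\<in>{(2 * m + 1) * 2 ^ i..<(2 * m + 1) * 2 ^ i + (v - 2 ^ i)}. f n\<bar> \<le> (real i + 1) * B"
          using Suc.prems le by (intro Suc.IH) auto
      qed
      finally show ?thesis by (simp add: algebra_simps)
    qed
  qed
  from this[of J 0 u] u show ?thesis by (simp add: atLeast0LessThan)
qed

text \<open>Rankin's trick: on sets with \<open>\<Prod>S \<le> N\<close> the factor
  \<open>(N / \<Prod>S) powr \<sigma>\<close> is at least 1. Once it is inserted, the size condition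
  is dropped and the sum over all subsets is a product over primes.\<close>

lemma rankin_bound:
  fixes b :: "nat \<Rightarrow> real"
  assumes P: "finite P" "\<And>p. p \<in> P \<Longrightarrow> p \<ge> 1 \<and> b p \<ge> 0" and \<sigma>: "\<sigma> \<ge> 0" and N: "N \<ge> 1"
  shows "(\<Sum>S | S \<subseteq> P \<and> real (\<Prod>S) \<le> N. \<Prod>p\<in>S. b p) \<le> N powr \<sigma> * (\<Prod>p\<in>P. 1 + b p * real p powr (-\<sigma>))"
proof -
  have "(\<Sum>S | S \<subseteq> P \<and> real (\<Prod>S) \<le> N. \<Prod>p\<in>S. b p) \<le> (\<Sum>S | S \<subseteq> P \<and> real (\<Prod>S) \<le> N. N powr \<sigma> * (\<Prod>p\<in>S. b p * real p powr (-\<sigma>)))"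
  proof (rule sum_mono)
    fix S assume "S \<in> {S. S \<subseteq> P \<and> real (\<Prod>S) \<le> N}"
    hence S: "S \<subseteq> P" "real (\<Prod>S) \<le> N" by auto
    have pos: "\<Prod>S > 0" using S P(2) by (intro prod_pos) force
    have b0: "(\<Prod>p\<in>S. b p) \<ge> 0" using S P(2) by (intro prod_nonneg) auto
    have "(\<Prod>p\<in>S. real p powr (-\<sigma>)) = real (\<Prod>S) powr (-\<sigma>)" unfolding of_nat_prod by (rule prod_powr_distrib[symmetric])
    also have "\<dots> \<ge> N powr (-\<sigma>)" using S \<sigma> pos by (intro powr_mono2') linarith+
    finally have "N powr \<sigma> * N powr (-\<sigma>) \<le> N powr \<sigma> * (\<Prod>p\<in>S. real p powr (-\<sigma>))" by (intro mult_left_mono) auto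
    hence "1 \<le> N powr \<sigma> * (\<Prod>p\<in>S. real p powr (-\<sigma>))" using N by (simp add: powr_add[symmetric])
    from mult_left_mono[OF this b0] show "(\<Prod>p\<in>S. b p) \<le> N powr \<sigma> * (\<Prod>p\<in>S. b p * real p powr (-\<sigma>))"
      by (simp add: prod.distrib mult_ac)
  qed
  also have "\<dots> \<le> (\<Sum>S\<in>Pow P. N powr \<sigma> * (\<Prod>p\<in>S. b p * real p powr (-\<sigma>)))"
    using P by (intro sum_mono2) (auto intro!: mult_nonneg_nonneg prod_nonneg)
  also have "\<dots> = N powr \<sigma> * (\<Prod>p\<in>P. 1 + b p * real p powr (-\<sigma>))"
    using prod_add[OF P(1), of "\<lambda>p. b p * real p powr (-\<sigma>)" "\<lambda>_. 1"]
    by (simp add: sum_distrib_left add.commute)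
  finally show ?thesis .
qed

lemma corr_bound_nonneg: "corr_bound K p \<ge> 0"
  by (simp add: corr_bound_def)

text \<open>There are at most \<open>Y\<close> primes up to \<open>Y\<close>, and each factor there
  is bounded crudely. Beyond \<open>Y\<close>, \<open>p powr (\<tau> - \<sigma>)\<close> is at most
  \<open>Y powr (\<tau> - \<sigma>)\<close>, and the remaining \<open>p powr (-1 - \<tau>)\<close>
  has a convergent sum. The condition \<open>2 * \<kappa> \<le> Y\<close> confines the cubic branch
  of \<open>corr_bound\<close> to the first range.\<close>

lemma prod_corr_bound_le:
  fixes Y \<kappa> \<sigma> \<tau> :: real
  assumes K: "real K \<le> \<kappa>" and Y: "2 * \<kappa> \<le> Y" "Y \<ge> 1" and \<tau>: "0 < \<tau>" "\<tau> \<le> \<sigma>"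
  shows "(\<Prod>p\<in>primes_upto Z. 1 + corr_bound K p * real p powr (-\<sigma>)) \<le>
           exp (Y * ln (1 + Y ^ 3 + 8 * \<kappa>\<^sup>2) + 8 * \<kappa>\<^sup>2 * Y powr (\<tau> - \<sigma>) * (1 + 1 / \<tau>))"
proof -
  let ?A = "{p\<in>primes_upto Z. real p \<le> Y}" and ?B = "{p\<in>primes_upto Z. \<not> real p \<le> Y}"
  let ?f = "\<lambda>p. 1 + corr_bound K p * real p powr (-\<sigma>)"
  have f1: "?f p \<ge> 1" for p using corr_bound_nonneg by simp
  have \<kappa>: "\<kappa> \<ge> 0" using K by linarith
  have p1: "p \<ge> 1" if "p \<in> primes_upto Z" for p using in_primes_uptoD[OF that] prime_gt_0_nat[of p] by simp
  have split: "(\<Prod>p\<in>primes_upto Z. ?f p) = (\<Prod>p\<in>?A. ?f p) * (\<Prod>p\<in>?B. ?f p)"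
    by (subst prod.union_disjoint[symmetric]) (auto intro!: prod.cong)
  have A: "(\<Prod>p\<in>?A. ?f p) \<le> exp (Y * ln (1 + Y ^ 3 + 8 * \<kappa>\<^sup>2))"
  proof -
    have "(\<Prod>p\<in>?A. ?f p) \<le> (\<Prod>p\<in>?A. 1 + Y ^ 3 + 8 * \<kappa>\<^sup>2)"
    proof (intro prod_mono conjI)
      fix p assume p: "p \<in> ?A"
      show "0 \<le> ?f p" using f1[of p] by linarith
      have "corr_bound K p \<le> Y ^ 3 + 8 * \<kappa>\<^sup>2"
      proof (cases "p \<le> 2 * K")
        case True
        have "real p ^ 3 \<le> Y ^ 3" using p by (intro power_mono) auto
        thus ?thesis using True by (simp add: corr_bound_def add_increasing2)
      next
        case False
        have "8 * real K ^ 2 / real p \<le> 8 * real K ^ 2 / 1" using p p1[of p] by (intro divide_left_mono) auto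
        also have "\<dots> \<le> 8 * \<kappa>\<^sup>2" using K by (simp add: power_mono)
        also have "\<dots> \<le> Y ^ 3 + 8 * \<kappa>\<^sup>2" using Y by simp
        finally show ?thesis using False by (simp add: corr_bound_def)
      qed
      moreover have "real p powr (-\<sigma>) \<le> 1"
        using p p1[of p] \<tau> powr_mono[of "-\<sigma>" 0 "real p"] by auto
      ultimately have "corr_bound K p * real p powr (-\<sigma>) \<le> (Y ^ 3 + 8 * \<kappa>\<^sup>2) * 1"
        using corr_bound_nonneg[of K p] Y by (intro mult_mono) auto
      thus "?f p \<le> 1 + Y ^ 3 + 8 * \<kappa>\<^sup>2" by simp
    qed
    also have "\<dots> = (1 + Y ^ 3 + 8 * \<kappa>\<^sup>2) ^ card ?A" by simp
    also have "\<dots> = (1 + Y ^ 3 + 8 * \<kappa>\<^sup>2) powr real (card ?A)"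
      using Y by (intro powr_realpow[symmetric]) (auto intro!: add_pos_nonneg)
    also have "\<dots> \<le> (1 + Y ^ 3 + 8 * \<kappa>\<^sup>2) powr Y"
    proof (intro powr_mono)
      have "card ?A \<le> card {1..nat \<lfloor>Y\<rfloor>}" using p1 by (intro card_mono) (auto simp: le_nat_floor)
      also have "\<dots> = nat \<lfloor>Y\<rfloor>" by simp
      finally show "real (card ?A) \<le> Y" using Y by linarith
    qed (use Y in auto)
    also have "\<dots> = exp (Y * ln (1 + Y ^ 3 + 8 * \<kappa>\<^sup>2))"
    proof -
      have "0 < 1 + Y ^ 3 + 8 * \<kappa>\<^sup>2" using Y by (intro add_pos_nonneg) auto
      thus ?thesis by (simp add: powr_def)
    qed
    finally show ?thesis .
  qed
  have B: "(\<Prod>p\<in>?B. ?f p) \<le> exp (8 * \<kappa>\<^sup>2 * Y powr (\<tau> - \<sigma>) * (1 + 1 / \<tau>))"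
  proof -
    have "(\<Prod>p\<in>?B. ?f p) \<le> (\<Prod>p\<in>?B. exp (8 * \<kappa>\<^sup>2 * Y powr (\<tau> - \<sigma>) * real p powr (-1 - \<tau>)))"
    proof (intro prod_mono conjI)
      fix p assume p: "p \<in> ?B"
      show "0 \<le> ?f p" using f1[of p] by linarith
      have pY: "real p > Y" "\<not> p \<le> 2 * K" using p Y K by auto
      have "corr_bound K p * real p powr (-\<sigma>) = 8 * real K ^ 2 * (real p powr (\<tau> - \<sigma>) * real p powr (-1 - \<tau>))"
        using pY Y by (simp add: corr_bound_def powr_add[symmetric]) (simp add: powr_diff powr_minus field_simps)
      also have "\<dots> \<le> 8 * \<kappa>\<^sup>2 * (Y powr (\<tau> - \<sigma>) * real p powr (-1 - \<tau>))"
        using K pY Y \<tau> by (intro mult_mono power_mono powr_mono2') auto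
      finally have "?f p \<le> 1 + 8 * \<kappa>\<^sup>2 * Y powr (\<tau> - \<sigma>) * real p powr (-1 - \<tau>)" by (simp add: mult_ac)
      also have "\<dots> \<le> exp (8 * \<kappa>\<^sup>2 * Y powr (\<tau> - \<sigma>) * real p powr (-1 - \<tau>))" by (rule exp_ge_add_one_self)
      finally show "?f p \<le> \<dots>" .
    qed
    also have "\<dots> = exp (8 * \<kappa>\<^sup>2 * Y powr (\<tau> - \<sigma>) * (\<Sum>p\<in>?B. real p powr (-1 - \<tau>)))"
      by (subst exp_sum[symmetric]) (auto simp: sum_distrib_left)
    also have "\<dots> \<le> exp (8 * \<kappa>\<^sup>2 * Y powr (\<tau> - \<sigma>) * (1 + 1 / \<tau>))"
    proof (subst exp_le_cancel_iff, intro mult_left_mono)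
      have "(\<Sum>p\<in>?B. real p powr (-1 - \<tau>)) \<le> (\<Sum>p. real p powr (-1 - \<tau>))"
        by (intro sum_le_suminf summable_nat_powr \<tau>) auto
      also have "\<dots> \<le> 1 + 1 / \<tau>" by (rule suminf_nat_powr_le[OF \<tau>(1)])
      finally show "(\<Sum>p\<in>?B. real p powr (-1 - \<tau>)) \<le> 1 + 1 / \<tau>" .
    qed auto
    finally show ?thesis .
  qed
  have "0 \<le> ?f p" for p using f1[of p] by linarith
  thus ?thesis unfolding split exp_add by (intro mult_mono A B prod_nonneg) auto
qed

lemma sum_corr_bound_le:
  fixes Y \<kappa> \<sigma> \<tau> :: real
  assumes "real K \<le> \<kappa>" "2 * \<kappa> \<le> Y" "Y \<ge> 1" "0 < \<tau>" "\<tau> \<le> \<sigma>" "N \<ge> 1"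
  shows "(corr_bound_sum K Z N) \<le> N powr \<sigma> *
           exp (Y * ln (1 + Y ^ 3 + 8 * \<kappa>\<^sup>2) + 8 * \<kappa>\<^sup>2 * Y powr (\<tau> - \<sigma>) * (1 + 1 / \<tau>))"
proof -
  have "(corr_bound_sum K Z N) \<le> N powr \<sigma> * (\<Prod>p\<in>primes_upto Z. 1 + corr_bound K p * real p powr (-\<sigma>))"
  proof (rule rankin_bound)
    fix p assume "p \<in> primes_upto Z"
    hence "p \<ge> 1" using in_primes_uptoD[of p Z] prime_gt_0_nat[of p] by simp
    thus "1 \<le> p \<and> 0 \<le> corr_bound K p" using corr_bound_nonneg by simp
  qed (use assms in auto)
  also have "\<dots> \<le> N powr \<sigma> * exp (Y * ln (1 + Y ^ 3 + 8 * \<kappa>\<^sup>2) + 8 * \<kappa>\<^sup>2 * Y powr (\<tau> - \<sigma>) * (1 + 1 / \<tau>))"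
    using assms by (intro mult_left_mono prod_corr_bound_le) auto
  finally show ?thesis .
qed

text \<open>A nonempty set with at most \<open>k\<close> elements is the set of a list of length
  exactly \<open>k\<close>, padded by repeating an element. The empty set offers nothing to repeat
  and accounts for the 1.\<close>

lemma card_bounded_subsets_le:
  assumes "finite A"
  shows "card {H. H \<subseteq> A \<and> card H \<le> k} \<le> 1 + card A ^ k"
proof -
  have sub: "{H. H \<subseteq> A \<and> card H \<le> k} \<subseteq> insert {} (set ` {xs. set xs \<subseteq> A \<and> length xs = k})"
  proof
    fix H assume H: "H \<in> {H. H \<subseteq> A \<and> card H \<le> k}"
    show "H \<in> insert {} (set ` {xs. set xs \<subseteq> A \<and> length xs = k})"
    proof (cases "H = {}")
      case False
      then obtain x where x: "x \<in> H" by blast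
      have "finite H" using H assms finite_subset by auto
      then obtain xs where xs: "set xs = H" "distinct xs" using finite_distinct_list by blast
      have "length xs = card H" using xs distinct_card by metis
      hence "set (xs @ replicate (k - length xs) x) = H" "length (xs @ replicate (k - length xs) x) = k"
        using xs x H by auto
      thus ?thesis using H by (intro insertI2 image_eqI[of _ _ "xs @ replicate (k - length xs) x"]) auto
    qed simp
  qed
  have fin: "finite {xs. set xs \<subseteq> A \<and> length xs = k}" using assms by (rule finite_lists_length_eq)
  have "card {H. H \<subseteq> A \<and> card H \<le> k} \<le> card (insert {} (set ` {xs. set xs \<subseteq> A \<and> length xs = k}))"
    using fin by (intro card_mono sub) auto
  also have "\<dots> \<le> 1 + card (set ` {xs. set xs \<subseteq> A \<and> length xs = k})" using fin by (simp add: card_insert_if)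
  also have "\<dots> \<le> 1 + card {xs. set xs \<subseteq> A \<and> length xs = k}" using fin by (intro add_left_mono card_image_le)
  also have "\<dots> = 1 + card A ^ k" using assms by (simp add: card_lists_length_eq)
  finally show ?thesis .
qed

section \<open>The singular series and the expected count\<close>

definition sing_factor :: "int set \<Rightarrow> nat \<Rightarrow> real" where
  "sing_factor H p = (1 - real (num_residues H p) / real p) * inverse ((1 - 1 / real p) ^ card H)"

lemma sing_factor_pos:
  assumes "finite H" "admissible H" "prime p" shows "sing_factor H p > 0"
proof -
  have "p \<ge> 2" using assms(3) prime_ge_2_nat by auto
  hence "(1 - 1 / real p) ^ card H > 0" by (intro zero_less_power) auto
  moreover have "1 - real (num_residues H p) / real p > 0" using gam_pos[OF assms] by (simp add: gam_def)
  ultimately show ?thesis by (simp add: sing_factor_def)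
qed

text \<open>Bernoulli's inequality for \<open>1 - 1 / p\<close> gives the upper bound. The lower one
  follows from Bernoulli for \<open>1 + 1 / p\<close>, as the product of the two powers is at most
  1. The first-order terms cancel, so the deviation is quadratic in \<open>1 / p\<close>.\<close>

lemma sing_factor_generic:
  assumes p: "prime p" and \<nu>: "num_residues H p = card H" and le: "card H \<le> p"
  shows "sing_factor H p \<le> 1" "sing_factor H p \<ge> 1 - (real (card H) / real p)\<^sup>2"
proof -
  let ?k = "card H" and ?x = "1 / real p"
  have p2: "real p \<ge> 2" using p prime_ge_2_nat of_nat_le_iff[of 2 p, where 'a = real] by simp
  have x: "0 < ?x" "?x < 1" using p2 by auto
  have pw: "(1 - ?x) ^ ?k > 0" using x by (intro zero_less_power) auto
  have "1 - real ?k * ?x \<le> (1 - ?x) ^ ?k"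
    using Bernoulli_inequality[of "-?x" ?k] x by simp
  thus "sing_factor H p \<le> 1" using pw by (simp add: sing_factor_def \<nu> field_simps)
  have nn: "0 \<le> 1 - real ?k / real p" using le p2 by (simp add: field_simps)
  have "(1 + real ?k * ?x) * (1 - ?x) ^ ?k \<le> (1 + ?x) ^ ?k * (1 - ?x) ^ ?k"
    using Bernoulli_inequality[of ?x ?k] x pw by (intro mult_right_mono) auto
  also have "\<dots> = (1 - ?x ^ 2) ^ ?k" by (simp add: power_mult_distrib[symmetric] power2_eq_square algebra_simps)
  also have "\<dots> \<le> 1" using x by (intro power_le_one) (auto simp: power_le_one)
  finally have "1 + real ?k * ?x \<le> inverse ((1 - ?x) ^ ?k)" using pw by (simp add: field_simps)
  from mult_left_mono[OF this nn] show "sing_factor H p \<ge> 1 - (real ?k / real p)\<^sup>2"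
    unfolding sing_factor_def \<nu> by (simp add: power2_eq_square algebra_simps)
qed

lemma sum_inverse_squares_le:
  fixes A :: "nat set"
  assumes "finite A" "\<And>p. p \<in> A \<Longrightarrow> p \<ge> q" "q \<ge> 2"
  shows "(\<Sum>p\<in>A. 1 / real p ^ 2) \<le> 2 / real q"
proof -
  have step: "1 / real n ^ 2 \<le> 1 / (real n - 1) - 1 / real n" if "n \<ge> 2" for n :: nat
    using that by (simp add: field_simps power2_eq_square)
  obtain m where "\<forall>n\<in>A. n < m" using assms(1) finite_nat_set_iff_bounded[of A] by blast
  hence m: "A \<subseteq> {q..<m}" using assms(2) by auto
  have tele: "q \<le> m \<Longrightarrow> (\<Sum>n\<in>{q..<m}. 1 / (real n - 1) - 1 / real n) = 1 / (real q - 1) - 1 / (real m - 1)" for m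
  proof (induction m rule: dec_induct)
    case (step m)
    thus ?case by simp
  qed simp
  have "(\<Sum>p\<in>A. 1 / real p ^ 2) \<le> (\<Sum>n\<in>{q..<max q m}. 1 / real n ^ 2)"
    using m by (intro sum_mono2) auto
  also have "\<dots> \<le> (\<Sum>n\<in>{q..<max q m}. 1 / (real n - 1) - 1 / real n)" using assms(3) step by (intro sum_mono) auto
  also have "\<dots> = 1 / (real q - 1) - 1 / (real (max q m) - 1)" by (rule tele) auto
  also have "\<dots> \<le> 1 / (real q - 1)" using assms(3) by auto
  also have "\<dots> \<le> 2 / real q" using assms(3) by (simp add: field_simps)
  finally show ?thesis .
qed

text \<open>\<open>q\<close> plays the part of the first prime after \<open>z\<close>. Beyond
  \<open>z\<close> all factors are generic, so truncating the product there costs at most the sum of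
  \<open>(card H / p) ^ 2\<close> over \<open>p \<ge> q\<close>, relatively.\<close>

lemma singular_series_bounds:
  assumes H: "finite H" "admissible H" and q: "q \<ge> 2" "card H \<le> q"
    and big: "\<And>p. prime p \<Longrightarrow> p > z \<Longrightarrow> p \<ge> q \<and> num_residues H p = card H"
  defines "P \<equiv> \<Prod>p\<in>primes_upto z. sing_factor H p"
  shows "singular_series H \<le> P" "singular_series H \<ge> P * (1 - 2 * real (card H) ^ 2 / real q)" "P > 0" "singular_series H \<ge> 0"
proof -
  let ?k = "real (card H)" and ?f = "\<lambda>p. if prime p then sing_factor H p else 1"
  have fpos: "?f p > 0" for p using sing_factor_pos[OF H] by auto
  show P: "P > 0" unfolding P_def by (intro prod_pos) (auto dest!: in_primes_uptoD intro: sing_factor_pos[OF H])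
  have gen: "sing_factor H p \<le> 1" "1 - (?k / real p)\<^sup>2 \<le> sing_factor H p" if "prime p" "p > z" for p
    using sing_factor_generic[of p H] big[OF that] that q by auto
  \<comment> \<open>Convergence comes first: it is what identifies the value of the infinite product
    with the limit of the partial products.\<close>
  have conv: "convergent_prod ?f"
  proof (rule abs_convergent_prod_imp_convergent_prod, rule summable_imp_abs_convergent_prod)
    show "summable (\<lambda>p. norm (?f p - 1))"
    proof (rule summable_comparison_test_ev)
      show "eventually (\<lambda>p. norm (norm (?f p - 1)) \<le> ?k\<^sup>2 * (1 / real p ^ 2)) sequentially"
        using eventually_gt_at_top[of z]
      proof eventually_elim
        case (elim p)
        show ?case using gen[of p] elim by (auto simp: power_divide)
      qed
      show "summable (\<lambda>p. ?k\<^sup>2 * (1 / real p ^ 2))"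
        using inverse_power_summable[of 2, where 'a = real] by (intro summable_mult) (simp add: inverse_eq_divide)
    qed
  qed
  have "singular_series H = prodinf ?f" unfolding singular_series_def sing_factor_def by (rule arg_cong[of _ _ prodinf]) auto
  with convergent_prod_LIMSEQ[OF conv] have lim: "(\<lambda>n. \<Prod>i\<le>n. ?f i) \<longlonglongrightarrow> singular_series H" by simp
  have part: "(\<Prod>i\<le>n. ?f i) = (\<Prod>p\<in>primes_upto n - primes_upto z. sing_factor H p) * P" if "n \<ge> z" for n
  proof -
    have "(\<Prod>i\<le>n. ?f i) = (\<Prod>p\<in>primes_upto n. sing_factor H p)"
      by (subst prod.inter_filter[symmetric]) (auto simp: primes_upto_def intro!: prod.cong)
    also have "\<dots> = (\<Prod>p\<in>primes_upto n - primes_upto z. sing_factor H p) * P"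
      unfolding P_def by (rule prod.subset_diff[OF primes_upto_mono[OF that]]) auto
    finally show ?thesis .
  qed
  have tail: "(\<Prod>p\<in>primes_upto n - primes_upto z. sing_factor H p) \<le> 1"
    "1 - 2 * ?k ^ 2 / real q \<le> (\<Prod>p\<in>primes_upto n - primes_upto z. sing_factor H p)" for n
  proof -
    let ?A = "primes_upto n - primes_upto z"
    have A: "prime p" "p > z" if "p \<in> ?A" for p using that by (auto simp: primes_upto_def)
    show "(\<Prod>p\<in>?A. sing_factor H p) \<le> 1"
    proof (rule prod_le_1)
      fix p assume "p \<in> ?A"
      thus "0 \<le> sing_factor H p \<and> sing_factor H p \<le> 1"
        using gen[OF A] sing_factor_pos[OF H A(1)] less_imp_le by blast
    qed
    have "1 - 2 * ?k ^ 2 / real q \<le> 1 - ?k\<^sup>2 * (\<Sum>p\<in>?A. 1 / real p ^ 2)"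
      using mult_left_mono[OF sum_inverse_squares_le[of ?A q], of "?k\<^sup>2"] big A q by (simp add: mult.commute)
    also have "\<dots> = 1 - (\<Sum>p\<in>?A. (?k / real p)\<^sup>2)" by (simp add: sum_distrib_left power_divide)
    also have "\<dots> \<le> (\<Prod>p\<in>?A. 1 - (?k / real p)\<^sup>2)"
    proof (rule Weierstrass_prod_ineq)
      fix p assume "p \<in> ?A"
      hence "card H \<le> p" "p > 0" using big[OF A] q A(2)[of p] by (auto intro: order_trans)
      thus "(?k / real p)\<^sup>2 \<in> {0..1}" by (auto simp: power_le_one)
    qed
    also have "\<dots> \<le> (\<Prod>p\<in>?A. sing_factor H p)"
    proof (rule prod_mono)
      fix p assume p: "p \<in> ?A"
      hence "card H \<le> p" "p > 0" using big[OF A] q A(2)[of p] by (auto intro: order_trans)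
      hence "(?k / real p)\<^sup>2 \<le> 1" by (auto simp: power_le_one)
      thus "0 \<le> 1 - (?k / real p)\<^sup>2 \<and> 1 - (?k / real p)\<^sup>2 \<le> sing_factor H p" using gen[OF A] p by auto
    qed
    finally show "1 - 2 * ?k ^ 2 / real q \<le> (\<Prod>p\<in>?A. sing_factor H p)" .
  qed
  show "singular_series H \<le> P"
  proof (rule LIMSEQ_le_const2[OF lim], intro exI[of _ z] allI impI)
    fix n assume n: "n \<ge> z"
    show "(\<Prod>i\<le>n. ?f i) \<le> P"
      unfolding part[OF n] using mult_right_mono[OF tail(1)[of n], of P] P by simp
  qed
  show "singular_series H \<ge> 0"
    by (rule LIMSEQ_le_const[OF lim], intro exI[of _ 0] allI impI prod_nonneg less_imp_le fpos)
  show "singular_series H \<ge> P * (1 - 2 * ?k ^ 2 / real q)"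
  proof (rule LIMSEQ_le_const[OF lim], intro exI[of _ z] allI impI)
    fix n assume n: "n \<ge> z"
    show "P * (1 - 2 * ?k ^ 2 / real q) \<le> (\<Prod>i\<le>n. ?f i)"
      unfolding part[OF n] using mult_right_mono[OF tail(2)[of n], of P] P by (simp add: mult.commute)
  qed
qed

lemma num_residues_eq_card:
  assumes "H \<subseteq> {0..int D}" "D < p"
  shows "num_residues H p = card H"
proof -
  have "inj_on (\<lambda>h. h mod int p) H"
  proof (rule inj_onI)
    fix x y assume xy: "x \<in> H" "y \<in> H" "x mod int p = y mod int p"
    have "x \<in> {0..int D}" "y \<in> {0..int D}" using assms(1) xy by blast+
    thus "x = y" using xy(3) assms(2) by simp
  qed
  thus ?thesis unfolding num_residues_def by (rule card_image)
qed

lemma sieve_density_bounds: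
  assumes "finite H" "admissible H" shows "0 < sieve_density H z" "sieve_density H z \<le> 1"
proof -
  show "0 < sieve_density H z" unfolding sieve_density_def
    by (intro prod_pos gam_pos[OF assms]) (auto dest: in_primes_uptoD)
  show "sieve_density H z \<le> 1" unfolding sieve_density_def
  proof (intro prod_le_1)
    fix p assume "p \<in> primes_upto z"
    thus "0 \<le> gam H p \<and> gam H p \<le> 1"
      using gam_pos[OF assms in_primes_uptoD] gam_bounds(2)[OF assms in_primes_uptoD] less_imp_le by blast
  qed
qed

lemma sieve_density_eq:
  "sieve_density H z = (\<Prod>p\<in>primes_upto z. sing_factor H p) * Theta (real z) ^ card H"
proof -
  have "Theta (real z) ^ card H = (\<Prod>p\<in>primes_upto z. (1 - 1 / real p) ^ card H)"
    unfolding Theta_nat primes_upto_def[symmetric] by (rule prod_power_distrib)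
  moreover have "gam H p = sing_factor H p * (1 - 1 / real p) ^ card H" if "p \<in> primes_upto z" for p
  proof -
    have "p \<ge> 2" using that prime_ge_2_nat by (auto dest: in_primes_uptoD)
    thus ?thesis by (simp add: gam_def sing_factor_def)
  qed
  ultimately show ?thesis unfolding sieve_density_def by (simp add: prod.distrib)
qed

text \<open>Two replacements with \<open>k = card H\<close>: the truncated singular product by the
  full one, at relative cost \<open>2 * k ^ 2 / q\<close>, and \<open>Theta\<close> by
  \<open>1 / ln t\<close>, where the \<open>k\<close>-th power of \<open>1 - 1 / q\<close> costs at
  most \<open>k / q\<close>. As \<open>k \<le> k ^ 2\<close>, the total is
  \<open>3 * k ^ 2 / q\<close>.\<close>

lemma sieve_density_approx:
  fixes t :: real
  assumes H: "finite H" "admissible H" "H \<subseteq> {0..int D}" and t: "ln t > 0"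
    and q: "prime q" "\<And>p. prime p \<Longrightarrow> p > z \<Longrightarrow> p \<ge> q" "D < q"
    and Th: "1 / ln t \<le> Theta (real z)" "Theta (real z) * (1 - 1 / real q) \<le> 1 / ln t"
  shows "singular_series H / ln t ^ card H \<le> sieve_density H z"
    "sieve_density H z \<le> singular_series H / ln t ^ card H + 3 * real (card H) ^ 2 / real q"
    "singular_series H \<ge> 0"
proof -
  let ?k = "real (card H)" and ?S = "singular_series H" and ?V = "sieve_density H z"
  define P where "P = (\<Prod>p\<in>primes_upto z. sing_factor H p)"
  have q2: "q \<ge> 2" using q prime_ge_2_nat by auto
  have "card H \<le> card {0..int D}" using H by (intro card_mono) auto
  hence kq: "card H \<le> q" using q by simp
  have big: "p \<ge> q \<and> num_residues H p = card H" if "prime p" "p > z" for p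
    using q(2)[OF that] num_residues_eq_card[OF H(3), of p] q(3) by auto
  have S: "?S \<le> P" "?S \<ge> P * (1 - 2 * ?k ^ 2 / real q)" "P > 0" "?S \<ge> 0"
    using singular_series_bounds[OF H(1,2) q2 kq, of z] big unfolding P_def by blast+
  have V: "?V = P * Theta (real z) ^ card H" unfolding P_def by (rule sieve_density_eq)
  have V01: "0 < ?V" "?V \<le> 1" using sieve_density_bounds[OF H(1,2)] by auto
  show S0: "?S \<ge> 0" by (rule S)
  have lnk: "ln t ^ card H > 0" using t by simp
  have "?S / ln t ^ card H = ?S * (1 / ln t) ^ card H" by (simp add: power_divide)
  also have "\<dots> \<le> P * Theta (real z) ^ card H"
    using Th(1) t S S0 by (intro mult_mono power_mono) auto
  finally show "?S / ln t ^ card H \<le> ?V" using V by simp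
  show "?V \<le> ?S / ln t ^ card H + 3 * ?k ^ 2 / real q"
  proof (cases "1 - 2 * ?k ^ 2 / real q \<ge> 0")
    case True
    let ?a = "1 - 1 / real q" and ?b = "1 - 2 * ?k ^ 2 / real q"
    have "?V * ?a ^ card H * ?b = P * ?b * (Theta (real z) * ?a) ^ card H"
      unfolding V by (simp add: power_mult_distrib)
    also have "\<dots> \<le> ?S * (1 / ln t) ^ card H"
      using Th(2) S True S0 Theta_pos[of z] q2 by (intro mult_mono power_mono) auto
    also have "\<dots> = ?S / ln t ^ card H" by (simp add: power_divide)
    finally have 1: "?V * ?a ^ card H * ?b \<le> ?S / ln t ^ card H" .
    have "1 - ?k / real q \<le> ?a ^ card H"
      using Bernoulli_inequality[of "-(1 / real q)" "card H"] q2 by simp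
    hence "(1 - ?k / real q) * ?b \<le> ?a ^ card H * ?b" using True by (intro mult_right_mono)
    moreover have "1 - ?k / real q - 2 * ?k ^ 2 / real q \<le> (1 - ?k / real q) * ?b"
    proof -
      have "0 \<le> (?k / real q) * (2 * ?k ^ 2 / real q)" by simp
      thus ?thesis unfolding left_diff_distrib right_diff_distrib by linarith
    qed
    ultimately have "?V * (1 - ?k / real q - 2 * ?k ^ 2 / real q) \<le> ?V * (?a ^ card H * ?b)"
      using V01 by (intro mult_left_mono) auto
    hence "?V - ?V * (?k / real q + 2 * ?k ^ 2 / real q) \<le> ?S / ln t ^ card H"
      using 1 by (simp add: algebra_simps)
    moreover have "?V * (?k / real q + 2 * ?k ^ 2 / real q) \<le> 1 * (?k / real q + 2 * ?k ^ 2 / real q)"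
      using V01 by (intro mult_right_mono) auto
    moreover have "?k \<le> ?k ^ 2"
      using of_nat_mono[OF le_square[of "card H"], where 'a = real] by (simp add: power2_eq_square)
    hence "?k / real q \<le> ?k ^ 2 / real q" by (intro divide_right_mono) auto
    moreover have "3 * ?k ^ 2 / real q = ?k ^ 2 / real q + 2 * ?k ^ 2 / real q"
      by (simp add: add_divide_distrib[symmetric])
    ultimately show ?thesis by (simp only: mult_1_left)
  next
    \<comment> \<open>Here the claimed error exceeds 1, hence the density itself.\<close>
    case False
    hence "1 < 3 * ?k ^ 2 / real q" using q2 by (simp add: field_simps)
    moreover have "?S / ln t ^ card H \<ge> 0" using S0 lnk by simp
    ultimately show ?thesis using V01 by linarith
  qed
qed

section \<open>Comparison of sums with integrals\<close>

lemma integral_antimono_step: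
  fixes f :: "real \<Rightarrow> real"
  assumes anti: "\<And>s t. real n0 \<le> s \<Longrightarrow> s \<le> t \<Longrightarrow> f t \<le> f s"
    and cont: "continuous_on {real n0..} f" and ab: "real n0 \<le> a" "a \<le> b"
  shows "f integrable_on {a..b}" "(b - a) * f b \<le> integral {a..b} f" "integral {a..b} f \<le> (b - a) * f a"
proof -
  show int: "f integrable_on {a..b}"
    using cont ab by (intro integrable_continuous_real continuous_on_subset[OF cont]) auto
  have "integral {a..b} (\<lambda>_. f b) \<le> integral {a..b} f"
    using ab anti by (intro integral_le int) auto
  thus "(b - a) * f b \<le> integral {a..b} f" using ab by simp
  have "integral {a..b} f \<le> integral {a..b} (\<lambda>_. f a)"
    using ab anti by (intro integral_le int) auto
  thus "integral {a..b} f \<le> (b - a) * f a" using ab by simp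
qed

lemma sum_integral_antimono:
  fixes f :: "real \<Rightarrow> real"
  assumes anti: "\<And>s t. real n0 \<le> s \<Longrightarrow> s \<le> t \<Longrightarrow> f t \<le> f s"
    and cont: "continuous_on {real n0..} f" and u: "n0 \<le> u"
  shows "(\<Sum>n=n0..<u. f (real n + 1)) \<le> integral {real n0..real u} f \<and> integral {real n0..real u} f \<le> (\<Sum>n=n0..<u. f (real n))"
  using u
proof (induction u rule: dec_induct)
  case (step u)
  have "integral {real n0..real u} f + integral {real u..real (Suc u)} f = integral {real n0..real (Suc u)} f"
    using step.hyps by (intro Henstock_Kurzweil_Integration.integral_combine integral_antimono_step(1)[OF anti cont]) auto
  thus ?case using step integral_antimono_step[OF anti cont, of "real u" "real (Suc u)"] by (simp add: add.commute)
qed auto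

text \<open>A shift by 1 lowers the sum by the difference of two values of \<open>f\<close> in
  [0, 1], so \<open>e\<close> shifts cost at most \<open>e\<close>. The 2 covers the comparison with
  the integral, the incomplete last cell and the last summand.\<close>

lemma shifted_sum_integral_diff_le:
  fixes f :: "real \<Rightarrow> real"
  assumes anti: "\<And>s t. real n0 \<le> s \<Longrightarrow> s \<le> t \<Longrightarrow> f t \<le> f s"
    and cont: "continuous_on {real n0..} f" and f01: "\<And>t. t \<ge> real n0 \<Longrightarrow> 0 \<le> f t \<and> f t \<le> 1"
    and x: "real n0 \<le> x"
  shows "\<bar>(\<Sum>n=n0..<nat \<lfloor>x\<rfloor> + 1. f (real (n + e))) - integral {real n0..x} f\<bar> \<le> real e + 2"
proof -
  define u where "u = nat \<lfloor>x\<rfloor>"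
  have u: "n0 \<le> u" "real u \<le> x" "x \<le> real u + 1" using x unfolding u_def by linarith+
  let ?A = "\<Sum>n=n0..<u. f (real n)"
  have S1: "(\<Sum>n=n0..<u. f (real n + 1)) = ?A - f (real n0) + f (real u)"
    using u(1) by (induction u rule: dec_induct) (auto simp: add.commute)
  have shift: "0 \<le> ?A - (\<Sum>n=n0..<u. f (real (n + e))) \<and> ?A - (\<Sum>n=n0..<u. f (real (n + e))) \<le> real e"
  proof (induction e)
    case (Suc e)
    have "(\<Sum>n=n0..<u. f (real (n + Suc e))) = (\<Sum>n=n0..<u. f (real (n + e))) - f (real (n0 + e)) + f (real (u + e))"
      using u(1) by (induction u rule: dec_induct) auto
    moreover have "f (real (u + e)) \<le> f (real (n0 + e))" using u by (intro anti) auto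
    ultimately show ?case using Suc f01[of "real (n0 + e)"] f01[of "real (u + e)"] u by auto
  qed auto
  have I: "integral {real n0..real u} f + integral {real u..x} f = integral {real n0..x} f"
    using u by (intro Henstock_Kurzweil_Integration.integral_combine integral_antimono_step(1)[OF anti cont]) auto
  have "(x - real u) * f x \<le> integral {real u..x} f" "integral {real u..x} f \<le> (x - real u) * f (real u)"
    using integral_antimono_step[OF anti cont, of "real u" x] u by auto
  moreover have "0 \<le> (x - real u) * f x" using f01[of x] u x by simp
  moreover have "(x - real u) * f (real u) \<le> 1 * 1" using f01[of "real u"] u by (intro mult_mono) auto
  ultimately have I1: "0 \<le> integral {real u..x} f" "integral {real u..x} f \<le> 1" by linarith+
  have I2: "?A - 1 \<le> integral {real n0..real u} f" "integral {real n0..real u} f \<le> ?A"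
    using sum_integral_antimono[OF anti cont u(1)] S1 f01[of "real n0"] f01[of "real u"] u by auto
  have "(\<Sum>n=n0..<u + 1. f (real (n + e))) = (\<Sum>n=n0..<u. f (real (n + e))) + f (real (u + e))" using u by simp
  moreover have "0 \<le> f (real (u + e)) \<and> f (real (u + e)) \<le> 1" using u by (intro f01) auto
  ultimately show ?thesis using shift I I1 I2 unfolding u_def[symmetric] by linarith
qed

lemma sum_inverse_sqrt_le: "(\<Sum>n=1..u. 1 / sqrt (real n)) \<le> 2 * sqrt (real u)"
proof (induction u)
  case (Suc u)
  let ?a = "sqrt (real u)" and ?b = "sqrt (real (Suc u))"
  have b: "?b > 0" by simp
  have sq: "?b\<^sup>2 - ?a\<^sup>2 = 1" by simp
  have "0 \<le> (?b - ?a)\<^sup>2" by simp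
  hence "1 \<le> 2 * (?b - ?a) * ?b" using sq by (simp add: power2_eq_square algebra_simps del: real_sqrt_mult_self)
  hence "1 / ?b \<le> 2 * (?b - ?a)" using b by (simp only: pos_divide_le_eq)
  hence "(\<Sum>n=1..u. 1 / sqrt (real n)) + 1 / ?b \<le> 2 * ?a + 2 * (?b - ?a)" by (intro add_mono Suc)
  thus ?case by simp
qed simp

text \<open>For \<open>k > 0\<close> the integrand exceeds 1 near 2, where \<open>ln t < 1\<close>.
  The bound \<open>2 ^ k\<close> from \<open>ln t \<ge> 1 / 2\<close> is crude, but affordable as
  \<open>n0\<close> will only be the square root of the scale.\<close>

lemma integral_inverse_ln_power_le:
  assumes "(n0::nat) \<ge> 2"
  shows "(\<lambda>t. 1 / ln t ^ k) integrable_on {2..real n0}" "0 \<le> integral {2..real n0} (\<lambda>t. 1 / ln t ^ k)"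
    "integral {2..real n0} (\<lambda>t. 1 / ln t ^ k) \<le> real n0 * 2 ^ k"
proof -
  show int: "(\<lambda>t. 1 / ln t ^ k) integrable_on {2..real n0}"
    by (intro integrable_continuous_real continuous_intros) auto
  show "0 \<le> integral {2..real n0} (\<lambda>t. 1 / ln t ^ k)"
    by (intro integral_nonneg int) auto
  have "integral {2..real n0} (\<lambda>t. 1 / ln t ^ k) \<le> integral {2..real n0} (\<lambda>_. 2 ^ k)"
  proof (intro integral_le int)
    fix t assume t: "t \<in> {2..real n0}"
    have "1 / 2 \<le> ln (2::real)" using ln2_ge_two_thirds by simp
    also have "ln 2 \<le> ln t" using t by (subst ln_le_cancel_iff) auto
    finally have "(1 / 2) ^ k \<le> ln t ^ k" by (intro power_mono) auto
    moreover have "ln t ^ k > 0" using t by (intro zero_less_power) auto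
    ultimately show "1 / ln t ^ k \<le> 2 ^ k" by (simp add: field_simps power_divide)
  qed auto
  also have "\<dots> = (real n0 - 2) * 2 ^ k" using assms by simp
  also have "\<dots> \<le> real n0 * 2 ^ k" by (intro mult_right_mono) auto
  finally show "integral {2..real n0} (\<lambda>t. 1 / ln t ^ k) \<le> real n0 * 2 ^ k" .
qed

section \<open>Concentration\<close>

lemma asym_primes:
  assumes "0 < \<delta>" "0 < \<eta>"
  shows "eventually (\<lambda>L::real. L powr (1 - \<eta>) * ln (1 + L ^ 3 + 8 * L\<^sup>2) \<le> \<delta> * L) at_top"
  using assms by real_asymp

lemma asym_linear:
  assumes "0 < \<delta>" "\<theta> < 1" 
  shows "eventually (\<lambda>L::real. A * L powr \<theta> \<le> \<delta> * L) at_top"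
  using assms by real_asymp

text \<open>The left side bounds the logarithm of the number of tuples at scale \<open>L\<close>.
  The product of the two powers of \<open>L\<close> is \<open>L\<close> itself, so the saving comes
  from the iterated logarithm in the condition on the diameter of \<open>H\<close>.\<close>

lemma asym_tuples:
  assumes "0 < \<delta>" "1/2 \<le> c" "c < 1"
  shows "eventually (\<lambda>L::real. L powr c * (ln 2 + L powr (1 - c) / ln (L - ln 4)) \<le> \<delta> * L) at_top"
  using assms by real_asymp

lemma asym_constants:
  assumes "0 < \<delta>" "1/2 \<le> c" "c < 1"
  shows "eventually (\<lambda>L::real. 1 + 2 * ((2 * L powr c) ^ 4 + 4 * (L powr c)\<^sup>2 * (2 * L + 3 + ln (2 * exp L))) + 6 * (L powr c)\<^sup>2 \<le> exp (\<delta> * L)) at_top"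
  using assms by real_asymp

lemma asym_diameter:
  assumes "1/2 \<le> c" "c < 1"
  shows "eventually (\<lambda>L::real. exp (L powr (1 - c) / ln (L - ln 4)) + 2 \<le> exp (L / 4)) at_top"
  using assms by real_asymp

lemma asym_compare:
  assumes "c < 1 - \<eta>"
  shows "eventually (\<lambda>L::real. 2 * L powr c \<le> L powr (1 - \<eta>)) at_top"
  using assms by real_asymp

lemma asym_log_power:
  assumes "0 < \<delta>" "c < 1"
  shows "eventually (\<lambda>L::real. L powr c * ln (2 * L) \<le> \<delta> * L) at_top"
  using assms by real_asymp

lemma asym_linear_exp:
  assumes "0 < \<delta>"
  shows "eventually (\<lambda>L::real. 4 * (2 * L + 1) \<le> exp (\<delta> * L)) at_top"
  using assms by real_asymp

text \<open>With \<open>L = j * ln 4\<close> this serves all \<open>x\<close> with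
  \<open>L - ln 4 \<le> ln x < L\<close> at once: the numerator is taken at the upper end and the
  denominator at the lower end of that range.\<close>

definition diam :: "real \<Rightarrow> real \<Rightarrow> nat" where
  "diam c L = nat \<lfloor>exp (L powr (1 - c) / ln (L - ln 4))\<rfloor>"

lemma ln_ge_one_4: "1 \<le> ln (4 :: real)"
  using exp_le by (subst ln_ge_iff) auto

text \<open>All quantities are expressed through \<open>L = ln X\<close>, so that
  \<open>exp (\<delta> * L)\<close> is X^\<delta>. The sum of correlation weights is split at
  \<open>Y = L powr (1 - \<eta>)\<close>: smaller primes contribute about Y log Y = o(L) to the
  exponent, larger ones the order \<open>L powr \<theta>\<close>. The requirement
  \<open>\<theta> < 1\<close> is what forces the Rankin exponent \<open>\<sigma>\<close> above
  \<open>2 * c - 1\<close>.\<close>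

lemma eventually_parameters:
  fixes c \<delta> :: real
  assumes c: "1 / 2 \<le> c" "c < 1" and \<delta>: "0 < \<delta>" "\<delta> \<le> 1"
  shows "eventually (\<lambda>L. L > ln 4 + 1 \<and>
     (\<forall>k Z N. real k \<le> L powr c \<longrightarrow> 1 \<le> N \<longrightarrow> N \<le> exp L \<longrightarrow>
        (corr_bound_sum k Z N) \<le> exp ((2 * c - 1 + 3 * \<delta>) * L)) \<and>
     (\<forall>k::nat. real k \<le> L powr c \<longrightarrow> 
        1 + 2 * ((2 * real k) ^ 4 + 4 * (real k)\<^sup>2 * (2 * L + 3 + ln (2 * exp L))) + 6 * (real k)\<^sup>2 \<le> exp (\<delta> * L)) \<and>
     real (diam c L) + 2 \<le> exp (L / 4) \<and>
     (\<forall>k::nat. real k \<le> L powr c \<longrightarrow> (real (diam c L) + 1) ^ k \<le> exp (\<delta> * L)) \<and>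
     (\<forall>k::nat. real k \<le> L powr c \<longrightarrow> (2 * L) ^ k \<le> exp (\<delta> * L)) \<and>
     4 * (2 * L + 1) \<le> exp (\<delta> * L)) at_top"
proof -
  \<comment> \<open>The bound \<open>\<delta> / 8\<close> keeps \<open>\<theta>\<close> below 1; the
    bound \<open>(1 - c) / 2\<close> makes \<open>L powr c\<close> negligible against
    \<open>Y\<close>.\<close>
  define \<eta> where "\<eta> = min (\<delta> / 8) ((1 - c) / 2)"
  define \<sigma> where "\<sigma> = 2 * c - 1 + \<delta>"
  define \<tau> where "\<tau> = \<delta> / 2"
  define \<theta> where "\<theta> = 2 * c + (1 - \<eta>) * (\<tau> - \<sigma>)"
  have \<eta>: "0 < \<eta>" "\<eta> \<le> \<delta> / 8" "c < 1 - \<eta>" "\<eta> < 1" using c \<delta> by (auto simp: \<eta>_def min_def field_simps)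
  have \<tau>: "0 < \<tau>" "\<tau> \<le> \<sigma>" using c \<delta> by (auto simp: \<sigma>_def \<tau>_def)
  have "\<theta> < 1"
  proof -
    have "\<theta> = 1 - \<delta> / 2 + \<eta> * (2 * c - 1 + \<delta> / 2)" by (simp add: \<theta>_def \<sigma>_def \<tau>_def field_simps)
    also have "\<eta> * (2 * c - 1 + \<delta> / 2) \<le> \<delta> / 8 * 2" using \<eta> c \<delta> by (intro mult_mono) auto
    finally show ?thesis using \<delta> by simp
  qed
  show ?thesis
    using eventually_gt_at_top[of "ln 4 + 1"] asym_primes[OF \<delta>(1) \<eta>(1)] asym_linear[OF \<delta>(1) \<open>\<theta> < 1\<close>, of "8 * (1 + 1 / \<tau>)"]
      asym_tuples[OF \<delta>(1) c] asym_constants[OF \<delta>(1) c] asym_diameter[OF c] asym_compare[OF \<eta>(3)]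
      asym_log_power[OF \<delta>(1) c(2)] asym_linear_exp[OF \<delta>(1)]
  proof eventually_elim
    case (elim L)
    have ln4: "ln 4 \<ge> (1::real)" by (rule ln_ge_one_4)
    have L: "L > 2" using elim(1) ln4 by linarith
    have lnL: "ln (L - ln 4) > 0" using elim(1) by simp
    let ?e = "exp (L powr (1 - c) / ln (L - ln 4))"
    have e1: "?e \<ge> 1" using lnL by simp
    have D: "real (diam c L) \<le> ?e" unfolding diam_def using e1 by linarith
    have 1: "(corr_bound_sum k Z N) \<le> exp ((2 * c - 1 + 3 * \<delta>) * L)"
      if k: "real k \<le> L powr c" and N: "1 \<le> N" "N \<le> exp L" for k Z N
    proof -
      let ?Y = "L powr (1 - \<eta>)"
      have Y1: "?Y \<ge> 1" using L \<eta> by (simp add: ge_one_powr_ge_zero)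
      have "(corr_bound_sum k Z N) \<le> 
        N powr \<sigma> * exp (?Y * ln (1 + ?Y ^ 3 + 8 * (L powr c)\<^sup>2) + 8 * (L powr c)\<^sup>2 * ?Y powr (\<tau> - \<sigma>) * (1 + 1 / \<tau>))"
        by (rule sum_corr_bound_le[OF k elim(7) Y1 \<tau> N(1)])
      also have "\<dots> \<le> exp (\<sigma> * L) * exp (\<delta> * L + \<delta> * L)"
      proof (intro mult_mono)
        have "N powr \<sigma> \<le> exp L powr \<sigma>" using N \<tau> by (intro powr_mono2) auto
        thus "N powr \<sigma> \<le> exp (\<sigma> * L)" by (simp add: exp_powr_real mult.commute)
        show "exp (?Y * ln (1 + ?Y ^ 3 + 8 * (L powr c)\<^sup>2) + 8 * (L powr c)\<^sup>2 * ?Y powr (\<tau> - \<sigma>) * (1 + 1 / \<tau>)) \<le> exp (\<delta> * L + \<delta> * L)"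
        proof (subst exp_le_cancel_iff, intro add_mono)
          have "?Y \<le> L powr 1" using L \<eta> by (intro powr_mono) auto
          moreover have "L powr c \<le> L powr 1" using L c by (intro powr_mono) auto
          ultimately have "1 + ?Y ^ 3 + 8 * (L powr c)\<^sup>2 \<le> 1 + L ^ 3 + 8 * L\<^sup>2"
            using L by (intro add_mono mult_left_mono power_mono) auto
          moreover have "1 + ?Y ^ 3 + 8 * (L powr c)\<^sup>2 > 0" by (intro add_pos_nonneg) auto
          ultimately have "ln (1 + ?Y ^ 3 + 8 * (L powr c)\<^sup>2) \<le> ln (1 + L ^ 3 + 8 * L\<^sup>2)" by (intro ln_mono) auto
          hence "?Y * ln (1 + ?Y ^ 3 + 8 * (L powr c)\<^sup>2) \<le> ?Y * ln (1 + L ^ 3 + 8 * L\<^sup>2)" by (intro mult_left_mono) auto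
          thus "?Y * ln (1 + ?Y ^ 3 + 8 * (L powr c)\<^sup>2) \<le> \<delta> * L" using elim(2) by linarith
          have "(L powr c)\<^sup>2 * ?Y powr (\<tau> - \<sigma>) = L powr \<theta>"
            unfolding \<theta>_def using L by (simp add: power2_eq_square powr_add[symmetric] powr_powr)
          thus "8 * (L powr c)\<^sup>2 * ?Y powr (\<tau> - \<sigma>) * (1 + 1 / \<tau>) \<le> \<delta> * L"
            using elim(3) by (simp add: mult_ac)
        qed
      qed auto
      also have "\<dots> = exp ((2 * c - 1 + 3 * \<delta>) * L)" by (simp add: exp_add[symmetric] \<sigma>_def algebra_simps)
      finally show ?thesis .
    qed
    have 2: "1 + 2 * ((2 * real k) ^ 4 + 4 * (real k)\<^sup>2 * (2 * L + 3 + ln (2 * exp L))) + 6 * (real k)\<^sup>2 \<le> exp (\<delta> * L)"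
      if k: "real k \<le> L powr c" for k :: nat
    proof -
      have "1 \<le> exp L" using L by simp
      hence "ln (2 * exp L) \<ge> 0" by (intro ln_ge_zero) linarith
      hence "1 + 2 * ((2 * real k) ^ 4 + 4 * (real k)\<^sup>2 * (2 * L + 3 + ln (2 * exp L))) + 6 * (real k)\<^sup>2 \<le>
        1 + 2 * ((2 * L powr c) ^ 4 + 4 * (L powr c)\<^sup>2 * (2 * L + 3 + ln (2 * exp L))) + 6 * (L powr c)\<^sup>2"
        using k L by (intro add_mono mult_left_mono mult_right_mono power_mono order.refl) auto
      thus ?thesis using elim(5) by linarith
    qed
    have 3: "real (diam c L) + 2 \<le> exp (L / 4)" using elim(6) D by linarith
    have pw: "b ^ k \<le> exp (\<delta> * L)" if k: "real k \<le> L powr c" and b: "b \<ge> 1" "L powr c * ln b \<le> \<delta> * L" for b :: real and k :: nat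
    proof -
      have "b ^ k = exp (real k * ln b)" using b by (simp add: powr_def powr_realpow[symmetric])
      also have "\<dots> \<le> exp (L powr c * ln b)" using k b by (simp add: mult_right_mono)
      also have "\<dots> \<le> exp (\<delta> * L)" using b by simp
      finally show ?thesis .
    qed
    have 4: "(real (diam c L) + 1) ^ k \<le> exp (\<delta> * L)" if k: "real k \<le> L powr c" for k :: nat
    proof (rule pw[OF k])
      have "real (diam c L) + 1 \<le> 2 * ?e" using D e1 by linarith
      hence "ln (real (diam c L) + 1) \<le> ln (2 * ?e)" by (intro ln_mono) auto
      also have "\<dots> = ln 2 + L powr (1 - c) / ln (L - ln 4)" by (simp add: ln_mult)
      finally have "L powr c * ln (real (diam c L) + 1) \<le> L powr c * (ln 2 + L powr (1 - c) / ln (L - ln 4))"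
        by (intro mult_left_mono) auto
      thus "L powr c * ln (real (diam c L) + 1) \<le> \<delta> * L" using elim(4) by linarith
    qed auto
    have 5: "(2 * L) ^ k \<le> exp (\<delta> * L)" if k: "real k \<le> L powr c" for k :: nat
      by (rule pw[OF k]) (use L elim(8) in auto)
    show ?case using elim(1) elim(9) 1 2 3 4 5 by blast
  qed
qed

section \<open>Union bound over tuples and dyadic blocks\<close>

lemma (in finite_measure) measure_UN_le_card:
  assumes "finite A" "\<And>i. i \<in> A \<Longrightarrow> F i \<in> sets M" "\<And>i. i \<in> A \<Longrightarrow> measure M (F i) \<le> b"
  shows "measure M (\<Union>i\<in>A. F i) \<le> real (card A) * b"
proof -
  have "measure M (\<Union>i\<in>A. F i) \<le> (\<Sum>i\<in>A. measure M (F i))"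
    using assms by (intro finite_measure_subadditive_finite) auto
  also have "\<dots> \<le> real (card A) * b" using assms(3) by (rule sum_bounded_above)
  finally show ?thesis .
qed

lemma sets_block_deviation:
  fixes a :: "nat \<Rightarrow> 'w \<Rightarrow> int" and y :: "nat \<Rightarrow> nat"
  assumes "prob_space M" "prob_space.indep_vars M (\<lambda>_. count_space UNIV) a {p. prime p}"
    "\<And>p. prime p \<Longrightarrow> distr M (count_space UNIV) (a p) = measure_pmf (pmf_of_set {0..<int p})"
    "finite H" "admissible H"
  shows "{\<omega> \<in> space M. t \<le> \<bar>\<Sum>n=i..<j. of_bool (survives H (\<lambda>p. a p \<omega>) (y n) n) - sieve_density H (y n)\<bar>} \<in> sets M"
proof -
  interpret prob_space M by fact
  have [measurable]: "(\<lambda>\<omega>. of_bool (survives H (\<lambda>p. a p \<omega>) (y n) n) :: real) \<in> borel_measurable M" for n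
    by (rule borel_measurable_integrable) (use integrable_survives[OF assms(2,3,4,5) order.refl] in auto)
  show ?thesis by measurable
qed

definition tuples :: "nat \<Rightarrow> real \<Rightarrow> int set set" where
  "tuples D \<kappa> = {H. finite H \<and> admissible H \<and> H \<subseteq> {0..int D} \<and> real (card H) \<le> \<kappa>}"

lemma finite_tuples: "finite (tuples D \<kappa>)"
  by (rule finite_subset[of _ "Pow {0..int D}"]) (auto simp: tuples_def)

lemma card_tuples_le:
  assumes "\<kappa> \<ge> 0" shows "card (tuples D \<kappa>) \<le> 1 + (D + 1) ^ nat \<lfloor>\<kappa>\<rfloor>"
proof -
  have "tuples D \<kappa> \<subseteq> {H. H \<subseteq> {0..int D} \<and> card H \<le> nat \<lfloor>\<kappa>\<rfloor>}"
    using assms by (auto simp: tuples_def le_nat_floor)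
  moreover have "finite {H. H \<subseteq> {0..int D} \<and> card H \<le> nat \<lfloor>\<kappa>\<rfloor>}"
    by (rule finite_subset[of _ "Pow {0..int D}"]) auto
  ultimately have "card (tuples D \<kappa>) \<le> card {H. H \<subseteq> {0..int D} \<and> card H \<le> nat \<lfloor>\<kappa>\<rfloor>}"
    by (rule card_mono[rotated])
  also have "\<dots> \<le> 1 + card {0..int D} ^ nat \<lfloor>\<kappa>\<rfloor>" by (rule card_bounded_subsets_le) auto
  also have "card {0..int D} = D + 1" by simp
  finally show ?thesis .
qed

text \<open>Used with \<open>e = 0\<close> and with \<open>e\<close> the diameter of the tuples:
  these are the lowest and the highest level met on the span of \<open>n + H\<close>.\<close>

definition level :: "nat \<Rightarrow> nat \<Rightarrow> nat" where
  "level e n = sieve_level (real (n + e))"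

definition deviation :: "int set \<Rightarrow> (nat \<Rightarrow> int) \<Rightarrow> nat \<Rightarrow> nat \<Rightarrow> nat \<Rightarrow> real" where
  "deviation H a e i j = (\<Sum>n=i..<j. of_bool (survives H a (level e n) n) - sieve_density H (level e n))"

text \<open>Lets \<open>2 ^ J\<close> with \<open>J \<ge> 3\<close> serve as a starting point beyond
  \<open>exp 2\<close>, where \<open>sieve_level\<close> is meaningful.\<close>

lemma exp_2_less_8: "exp 2 < (8 :: real)"
proof -
  have "exp 2 = exp (1 / 16 :: real) ^ 32" by (simp flip: exp_of_nat_mult)
  also have "exp (1 / 16 :: real) \<le> 1 + 1 / 16 + (1 / 16) ^ 2" by (rule exp_bound) auto
  hence "exp (1 / 16 :: real) ^ 32 \<le> (1 + 1 / 16 + (1 / 16) ^ 2) ^ 32" by (intro power_mono) auto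
  also have "\<dots> < 8" by (simp add: power_divide)
  finally show ?thesis .
qed

lemma prob_deviation_le:
  fixes a :: "nat \<Rightarrow> 'w \<Rightarrow> int" and i j D e J :: nat and t :: real
  assumes "prob_space M" "prob_space.indep_vars M (\<lambda>_. count_space UNIV) a {p. prime p}"
    "\<And>p. prime p \<Longrightarrow> distr M (count_space UNIV) (a p) = measure_pmf (pmf_of_set {0..<int p})"
    "finite H" "admissible H" and HD: "H \<subseteq> {0..int D}"
    and i: "exp 2 \<le> real i" and j: "j \<le> 4 ^ J" and e: "e \<le> 4 ^ J" and D: "D \<le> 4 ^ J"
    and len: "j - i \<le> N" and N: "N \<ge> 1" and t: "t > 0"
    and T: "(corr_bound_sum (card H) (2 * 4 ^ J) (real N)) \<le> T"
    and C: "1 + 2 * ((2 * real (card H)) ^ 4 + 4 * real (card H) ^ 2 * (2 * real J + 3 + ln (2 * 4 ^ J))) + 2 * real (card H) ^ 2 \<le> C"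
  shows "measure M {\<omega> \<in> space M. t \<le> \<bar>deviation H (\<lambda>p. a p \<omega>) e i j\<bar>} \<le> real N * T * C / t\<^sup>2"
proof -
  interpret prob_space M by fact
  \<comment> \<open>A level is at most \<open>n + e\<close>, hence at most twice
    \<open>4 ^ J\<close>. Likewise \<open>j + D < 4 * 4 ^ J = 2 ^ (2 * J + 2)\<close>, which fixes
    the bound on the number of prime divisors.\<close>
  let ?Z = "2 * 4 ^ J :: nat"
  have lev: "level e n \<le> ?Z" if "i \<le> n" "n < j" for n
  proof -
    have "real (level e n) \<le> real (n + e)" unfolding level_def using that i by (intro sieve_level_le) auto
    thus ?thesis using that j e by simp
  qed
  have "measure M {\<omega> \<in> space M. t \<le> \<bar>\<Sum>n=i..<j. of_bool (survives H (\<lambda>p. a p \<omega>) (level e n) n) - sieve_density H (level e n)\<bar>}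
      \<le> real N * (corr_bound_sum (card H) ?Z (real N)) * 
        (1 + 2 * ((2 * real (card H)) ^ 4 + 4 * real (card H) ^ 2 * (real (2 * J + 2) + 1 + ln (real ?Z))) + 2 * real (card H) ^ 2) / t\<^sup>2"
  proof (rule prob_block_deviation_le[OF assms(2,3,4,5) HD])
    show "level e n \<le> level e m" if "i \<le> n" "n \<le> m" "m < j" for n m
      unfolding level_def using that i by (intro sieve_level_mono) auto
    have "j + D \<le> 4 ^ J + 4 ^ J" using j D by linarith
    also have "\<dots> < 4 * 4 ^ J" by simp
    also have "\<dots> = (2::nat) ^ (2 * J + 2)" by (simp add: power_mult)
    finally show "j + D < 2 ^ (2 * J + 2)" .
  qed (use lev len N t in auto)
  also have "\<dots> \<le> real N * T * C / t\<^sup>2"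
  proof (intro divide_right_mono mult_mono T)
    show "1 + 2 * ((2 * real (card H)) ^ 4 + 4 * real (card H) ^ 2 * (real (2 * J + 2) + 1 + ln (real ?Z))) + 2 * real (card H) ^ 2 \<le> C"
      using C by (simp add: algebra_simps)
    have "(corr_bound_sum (card H) ?Z (real N)) \<ge> 0"
      by (intro sum_nonneg prod_nonneg corr_bound_nonneg)
    thus "0 \<le> real N * T" using T by simp
    have "(1::nat) \<le> ?Z" using one_le_power[of "4::nat" J] by linarith
    hence "ln (real ?Z) \<ge> 0" by (intro ln_ge_zero) linarith
    thus "0 \<le> 1 + 2 * ((2 * real (card H)) ^ 4 + 4 * real (card H) ^ 2 * (real (2 * J + 2) + 1 + ln (real ?Z))) + 2 * real (card H) ^ 2"
      by (intro add_nonneg_nonneg mult_nonneg_nonneg) auto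
  qed (auto intro!: sum_nonneg prod_nonneg corr_bound_nonneg)
  finally show ?thesis unfolding deviation_def .
qed

text \<open>In powers of \<open>X = 4 ^ J\<close>: the tuples cost X^\<delta>, the blocks of one
  length together X, the variance per unit length is X^(2 * c - 1 + 4 * \<delta>), and the squared
  threshold is X^(2 * c + 10 * \<delta>). The resulting X^(- 5 * \<delta>) also pays for the
  \<open>2 * J + 1\<close> block lengths and still leaves a geometric series in
  \<open>J\<close>.\<close>

lemma AE_deviation_le:
  fixes a :: "nat \<Rightarrow> 'w \<Rightarrow> int" and c \<delta> :: real
  assumes M: "prob_space M" "prob_space.indep_vars M (\<lambda>_. count_space UNIV) a {p. prime p}"
    "\<And>p. prime p \<Longrightarrow> distr M (count_space UNIV) (a p) = measure_pmf (pmf_of_set {0..<int p})"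
    and c: "1 / 2 \<le> c" "c < 1" and \<delta>: "0 < \<delta>" "\<delta> \<le> 1"
  defines "X \<equiv> \<lambda>J::nat. (4::real) ^ J" and "L \<equiv> \<lambda>J::nat. real J * ln 4"
  defines "D \<equiv> \<lambda>J. diam c (L J)"
  shows "AE \<omega> in M. eventually (\<lambda>J. \<forall>H\<in>tuples (D J) (L J powr c). \<forall>e\<in>{0, D J}. \<forall>u\<le>4 ^ J.
           \<bar>deviation H (\<lambda>p. a p \<omega>) e (2 ^ J) u\<bar> \<le> (2 * real J + 1) * X J powr (c + 5 * \<delta>)) sequentially"
proof -
  interpret prob_space M by fact
  define t where "t = (\<lambda>J. X J powr (c + 5 * \<delta>))"
  define \<H> where "\<H> = (\<lambda>J. tuples (D J) (L J powr c))"
  \<comment> \<open>Blocks are cut off at \<open>2 ^ J\<close>, so that every \<open>n\<close>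
    involved exceeds \<open>exp 2\<close>; a block entirely below that point has deviation
    0.\<close>
  define E where "E = (\<lambda>J H e i m. {\<omega> \<in> space M. t J \<le> \<bar>deviation H (\<lambda>p. a p \<omega>) e (max (m * 2 ^ i) (2 ^ J)) ((m + 1) * 2 ^ i)\<bar>})"
  define Bad where "Bad = (\<lambda>J. \<Union>x\<in>\<H> J \<times> {0, D J}. \<Union>i\<in>{..2 * J}. \<Union>m\<in>{..<2 ^ (2 * J - i)}. E J (fst x) (snd x) i m)"
  have X: "X J > 0" "X J \<ge> 1" "X J = exp (L J)" for J by (auto simp: X_def L_def exp_of_nat_mult)
  have t: "t J > 0" for J using X(1)[of J] by (simp add: t_def)
  have \<H>D: "finite H" "admissible H" "H \<subseteq> {0..int (D J)}" "real (card H) \<le> L J powr c" if "H \<in> \<H> J" for H J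
    using that by (auto simp: \<H>_def tuples_def)
  have E_sets: "E J H e i m \<in> sets M" if "H \<in> \<H> J" for J H e i m
    unfolding E_def deviation_def using that \<H>D by (intro sets_block_deviation M) auto
  have fin: "finite (\<H> J \<times> {0, D J})" for J by (auto simp: \<H>_def finite_tuples)
  have Bad_sets: "Bad J \<in> sets M" for J
    unfolding Bad_def using E_sets fin[of J] by (intro sets.finite_UN) auto
  have Ltop: "filterlim L at_top sequentially" unfolding L_def by real_asymp
  have ev: "eventually (\<lambda>J. measure M (Bad J) \<le> (4 powr (- 4 * \<delta>)) ^ J) sequentially"
    using eventually_compose_filterlim[OF eventually_parameters[OF c \<delta>] Ltop] eventually_ge_at_top[of 3]
  proof eventually_elim
    case (elim J)
    note params = elim(1)
    have LJ: "L J > 1" using elim(1) ln_ge_one_4 by linarith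
    have J: "J \<ge> 3" by fact
    have DJ: "D J + 2 \<le> 4 ^ J"
    proof -
      have "real (D J) + 2 \<le> exp (L J / 4)" using params by (simp add: D_def)
      also have "\<dots> \<le> exp (L J)" using LJ by simp
      also have "\<dots> = real (4 ^ J)" using X(3)[of J] by (simp add: X_def)
      finally show ?thesis by linarith
    qed
    have e8: "exp 2 \<le> real (2 ^ J)"
    proof -
      have "(2::real) ^ 3 \<le> 2 ^ J" using J by (intro power_increasing) auto
      thus ?thesis using exp_2_less_8 by simp
    qed
    define W where "W = X J powr (2 * c - 1 + 3 * \<delta>) * X J powr \<delta>"
    have W: "measure M (E J H e i m) \<le> real (2 ^ i) * W / (t J)\<^sup>2"
      if H: "H \<in> \<H> J" and e: "e \<in> {0, D J}" and i: "i \<le> 2 * J" and m: "m < 2 ^ (2 * J - i)" for H e i m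
    proof -
      have le: "(m + 1) * 2 ^ i \<le> 4 ^ J"
      proof -
        have "(m + 1) * 2 ^ i \<le> 2 ^ (2 * J - i) * 2 ^ i" using m by (intro mult_right_mono) auto
        also have "\<dots> = (2::nat) ^ (2 * J)" using i by (simp add: power_add[symmetric])
        finally show ?thesis by (simp add: power_mult)
      qed
      have N: "real (2 ^ i) \<le> exp (L J)"
      proof -
        have "(2::real) ^ i \<le> 2 ^ (2 * J)" using i by (intro power_increasing) auto
        also have "\<dots> = exp (L J)" using X(3)[of J] by (simp add: X_def power_mult)
        finally show ?thesis by simp
      qed
      have "measure M (E J H e i m) \<le> real (2 ^ i) * exp ((2 * c - 1 + 3 * \<delta>) * L J) * exp (\<delta> * L J) / (t J)\<^sup>2"
        unfolding E_def
      proof (rule prob_deviation_le[where D = "D J" and J = J])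
        have "real (2 ^ J) \<le> real (max (m * 2 ^ i) (2 ^ J))" by (intro of_nat_mono) simp
        thus "exp 2 \<le> real (max (m * 2 ^ i) (2 ^ J))" using e8 by linarith
        show "(corr_bound_sum (card H) (2 * 4 ^ J) (real (2 ^ i))) \<le> exp ((2 * c - 1 + 3 * \<delta>) * L J)"
          using params \<H>D[OF H] N by auto
        have "2 * real J \<le> 2 * L J" unfolding L_def using ln_ge_one_4 by (simp add: mult_le_cancel_left1)
        moreover have "ln (2 * 4 ^ J) = ln (2 * exp (L J))" using X(3)[of J] by (simp add: X_def)
        ultimately have "1 + 2 * ((2 * real (card H)) ^ 4 + 4 * (real (card H))\<^sup>2 * (2 * real J + 3 + ln (2 * 4 ^ J))) + 2 * (real (card H))\<^sup>2 \<le>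
          1 + 2 * ((2 * real (card H)) ^ 4 + 4 * (real (card H))\<^sup>2 * (2 * L J + 3 + ln (2 * exp (L J)))) + 6 * (real (card H))\<^sup>2"
          by (intro add_mono mult_left_mono mult_right_mono order.refl) auto
        thus "1 + 2 * ((2 * real (card H)) ^ 4 + 4 * (real (card H))\<^sup>2 * (2 * real J + 3 + ln (2 * 4 ^ J))) + 2 * (real (card H))\<^sup>2 \<le> exp (\<delta> * L J)"
          using params \<H>D(4)[OF H] by (meson order_trans)
      qed (use M \<H>D[OF H] le e DJ t in auto)
      thus ?thesis unfolding W_def X(3) by (simp add: exp_powr_real mult.commute mult.left_commute)
    qed
    \<comment> \<open>There are \<open>2 ^ (2 * J - i)\<close> blocks of length
      \<open>2 ^ i\<close>; since the variance bound is linear in the length, every \<open>i\<close>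
      contributes the same amount.\<close>
    have 1: "measure M (\<Union>m\<in>{..<2 ^ (2 * J - i)}. E J H e i m) \<le> X J * W / (t J)\<^sup>2"
      if H: "H \<in> \<H> J" and e: "e \<in> {0, D J}" and i: "i \<le> 2 * J" for H e i
    proof -
      have "measure M (\<Union>m\<in>{..<2 ^ (2 * J - i)}. E J H e i m) \<le> real (card {..<2 ^ (2 * J - i) :: nat}) * (real (2 ^ i) * W / (t J)\<^sup>2)"
        using E_sets[OF H] W[OF H e i] by (intro measure_UN_le_card) auto
      also have "\<dots> = real (2 ^ (2 * J - i) * 2 ^ i) * W / (t J)\<^sup>2" by simp
      also have "(2::nat) ^ (2 * J - i) * 2 ^ i = 4 ^ J" using i by (simp add: power_add[symmetric] power_mult)
      finally show ?thesis by (simp add: X_def)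
    qed
    have 2: "measure M (\<Union>i\<in>{..2 * J}. \<Union>m\<in>{..<2 ^ (2 * J - i)}. E J H e i m) \<le> real (2 * J + 1) * (X J * W / (t J)\<^sup>2)"
      if H: "H \<in> \<H> J" and e: "e \<in> {0, D J}" for H e
    proof -
      have "measure M (\<Union>i\<in>{..2 * J}. \<Union>m\<in>{..<2 ^ (2 * J - i)}. E J H e i m) \<le> real (card {..2 * J}) * (X J * W / (t J)\<^sup>2)"
        using E_sets[OF H] 1[OF H e] by (intro measure_UN_le_card sets.finite_UN) auto
      thus ?thesis by simp
    qed
    have "measure M (Bad J) \<le> real (card (\<H> J \<times> {0, D J})) * (real (2 * J + 1) * (X J * W / (t J)\<^sup>2))"
      unfolding Bad_def
    proof (rule measure_UN_le_card[OF fin])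
      fix x assume x: "x \<in> \<H> J \<times> {0, D J}"
      show "measure M (\<Union>i\<in>{..2 * J}. \<Union>m\<in>{..<2 ^ (2 * J - i)}. E J (fst x) (snd x) i m) \<le> real (2 * J + 1) * (X J * W / (t J)\<^sup>2)"
        using x by (intro 2) auto
      show "(\<Union>i\<in>{..2 * J}. \<Union>m\<in>{..<2 ^ (2 * J - i)}. E J (fst x) (snd x) i m) \<in> sets M"
        using x E_sets by (intro sets.finite_UN) auto
    qed
    also have "\<dots> \<le> (4 * X J powr \<delta>) * ((2 * L J + 1) * (X J * W / (t J)\<^sup>2))"
    proof (intro mult_mono)
      have "card (\<H> J) \<le> 1 + (D J + 1) ^ nat \<lfloor>L J powr c\<rfloor>" unfolding \<H>_def by (intro card_tuples_le) auto
      hence "real (card (\<H> J)) \<le> real (1 + (D J + 1) ^ nat \<lfloor>L J powr c\<rfloor>)" by (rule of_nat_mono)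
      also have "\<dots> = 1 + (real (D J) + 1) ^ nat \<lfloor>L J powr c\<rfloor>" by (simp add: add.commute)
      also have "\<dots> \<le> exp (\<delta> * L J) + exp (\<delta> * L J)"
      proof (intro add_mono)
        show "1 \<le> exp (\<delta> * L J)" using \<delta> LJ by simp
        have "real (nat \<lfloor>L J powr c\<rfloor>) \<le> L J powr c" by simp
        thus "(real (D J) + 1) ^ nat \<lfloor>L J powr c\<rfloor> \<le> exp (\<delta> * L J)" unfolding D_def using params by blast
      qed
      finally have c1: "real (card (\<H> J)) \<le> 2 * X J powr \<delta>" unfolding X(3) by (simp add: exp_powr_real mult.commute)
      have "card {0, D J} \<le> 2" by (simp add: card_insert_if)
      hence "real (card (\<H> J)) * real (card {0, D J}) \<le> (2 * X J powr \<delta>) * 2" by (intro mult_mono c1) auto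
      thus "real (card (\<H> J \<times> {0, D J})) \<le> 4 * X J powr \<delta>" by (simp add: card_cartesian_product)
      show "real (2 * J + 1) \<le> 2 * L J + 1" unfolding L_def using ln_ge_one_4 by (simp add: mult_le_cancel_left1)
    qed (use LJ X(1)[of J] in \<open>auto simp: W_def\<close>)
    also have "\<dots> = (4 * (2 * L J + 1)) * (X J powr \<delta> * (X J powr 1 * (X J powr (2 * c - 1 + 3 * \<delta>) * X J powr \<delta>)) / (X J powr (c + 5 * \<delta>))\<^sup>2)"
      unfolding W_def t_def using X(1)[of J] by simp
    also have "X J powr \<delta> * (X J powr 1 * (X J powr (2 * c - 1 + 3 * \<delta>) * X J powr \<delta>)) / (X J powr (c + 5 * \<delta>))\<^sup>2 = X J powr (- 5 * \<delta>)"
      using X(1)[of J] by (simp only: power2_eq_square powr_add[symmetric] powr_diff[symmetric]) (simp add: algebra_simps)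
    also have "(4 * (2 * L J + 1)) * X J powr (- 5 * \<delta>) \<le> X J powr \<delta> * X J powr (- 5 * \<delta>)"
    proof (intro mult_right_mono)
      show "4 * (2 * L J + 1) \<le> X J powr \<delta>" unfolding X(3) using params by (simp add: exp_powr_real mult.commute)
    qed auto
    also have "\<dots> = X J powr (- 4 * \<delta>)" by (simp add: powr_add[symmetric])
    also have "\<dots> = (4 powr (- 4 * \<delta>)) ^ J" unfolding X_def by (simp add: powr_realpow[symmetric] powr_powr mult.commute)
    finally show ?case .
  qed
  have summ: "summable (\<lambda>J. measure M (Bad J))"
  proof (rule summable_comparison_test_ev)
    show "eventually (\<lambda>J. norm (measure M (Bad J)) \<le> (4 powr (- 4 * \<delta>)) ^ J) sequentially" using ev by simp
    have "(4::real) powr (- 4 * \<delta>) < 4 powr 0" using \<delta> by (intro powr_less_mono) auto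
    thus "summable (\<lambda>J. (4 powr (- 4 * \<delta>)) ^ J)" by (intro summable_geometric) auto
  qed
  have "AE \<omega> in M. eventually (\<lambda>J. \<omega> \<in> space M - Bad J) sequentially"
    by (rule borel_cantelli_AE1[OF Bad_sets _ summ]) (simp add: emeasure_eq_measure)
  thus ?thesis
  proof eventually_elim
    case (elim \<omega>)
    thus ?case
    proof eventually_elim
      case (elim J)
      show ?case
      proof (intro ballI allI impI)
        fix H e and u :: nat
        assume H: "H \<in> tuples (D J) (L J powr c)" and e: "e \<in> {0, D J}" and u: "u \<le> 4 ^ J"
        \<comment> \<open>Extending the summand by 0 below \<open>2 ^ J\<close> allows the dyadic
          decomposition to start at 0.\<close>
        define f where "f = (\<lambda>n. if n < 2 ^ J then 0 else of_bool (survives H (\<lambda>p. a p \<omega>) (level e n) n) - sieve_density H (level e n) :: real)"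
        have f_sum: "(\<Sum>n\<in>{k..<l}. f n) = deviation H (\<lambda>p. a p \<omega>) e (max k (2 ^ J)) l" for k l
        proof -
          have "deviation H (\<lambda>p. a p \<omega>) e (max k (2 ^ J)) l = (\<Sum>n\<in>{max k (2 ^ J)..<l}. f n)"
            unfolding deviation_def f_def by (intro sum.cong) auto
          also have "\<dots> = (\<Sum>n\<in>{k..<l}. f n)" by (intro sum.mono_neutral_left) (auto simp: f_def)
          finally show ?thesis ..
        qed
        have "\<bar>\<Sum>n<u. f n\<bar> \<le> (real (2 * J) + 1) * t J"
        proof (rule dyadic_prefix_sum_le)
          fix i m :: nat assume i: "i \<le> 2 * J" and m: "(m + 1) * 2 ^ i \<le> 2 ^ (2 * J)"
          have "2 ^ (2 * J) = 2 ^ (2 * J - i) * (2::nat) ^ i" using i by (simp add: power_add[symmetric])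
          hence "(m + 1) * 2 ^ i \<le> 2 ^ (2 * J - i) * 2 ^ i" using m by simp
          hence "m + 1 \<le> 2 ^ (2 * J - i)" by (rule mult_right_le_imp_le) simp
          hence m': "m \<in> {..<2 ^ (2 * J - i)}" by auto
          have "\<omega> \<notin> E J H e i m" using elim H e i m' unfolding Bad_def \<H>_def by fastforce
          hence "\<bar>deviation H (\<lambda>p. a p \<omega>) e (max (m * 2 ^ i) (2 ^ J)) ((m + 1) * 2 ^ i)\<bar> < t J"
            using elim unfolding E_def by auto
          thus "\<bar>\<Sum>n\<in>{m * 2 ^ i..<(m + 1) * 2 ^ i}. f n\<bar> \<le> t J" unfolding f_sum by simp
        qed (use u in \<open>simp add: power_mult\<close>)
        thus "\<bar>deviation H (\<lambda>p. a p \<omega>) e (2 ^ J) u\<bar> \<le> (2 * real J + 1) * X J powr (c + 5 * \<delta>)"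
          using f_sum[of 0 u] by (simp add: t_def atLeast0LessThan)
      qed
    qed
  qed
qed

section \<open>The count of prime-like tuples\<close>

definition good_level :: "real \<Rightarrow> bool" where
  "good_level t \<longleftrightarrow> (\<exists>q. prime q \<and> q > sieve_level t \<and> (\<forall>p. prime p \<longrightarrow> p > sieve_level t \<longrightarrow> p \<ge> q) \<and>
      real q \<ge> sqrt t \<and> 1 / ln t \<le> Theta (sieve_level t) \<and> Theta (sieve_level t) * (1 - 1 / q) \<le> 1 / ln t)"

lemma sieve_level_density_approx:
  assumes H: "finite H" "admissible H" "H \<subseteq> {0..int D}" and t: "t > 1" "good_level t" "real D < sqrt t"
  shows "singular_series H / ln t ^ card H \<le> sieve_density H (sieve_level t)"
    "sieve_density H (sieve_level t) \<le> singular_series H / ln t ^ card H + 3 * real (card H) ^ 2 / sqrt t"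
    "singular_series H \<ge> 0"
proof -
  obtain q where q: "prime q" "\<And>p. prime p \<Longrightarrow> p > sieve_level t \<Longrightarrow> p \<ge> q" "real q \<ge> sqrt t"
      "1 / ln t \<le> Theta (sieve_level t)" "Theta (sieve_level t) * (1 - 1 / q) \<le> 1 / ln t"
    using t(2) unfolding good_level_def by blast
  have "D < q" using t(3) q(3) by linarith
  note * = sieve_density_approx[OF H _ q(1,2) this q(4,5)]
  show "singular_series H / ln t ^ card H \<le> sieve_density H (sieve_level t)" "singular_series H \<ge> 0"
    using * t by auto
  have "3 * real (card H) ^ 2 / real q \<le> 3 * real (card H) ^ 2 / sqrt t"
    using q(3) t by (intro divide_left_mono mult_pos_pos) auto
  thus "sieve_density H (sieve_level t) \<le> singular_series H / ln t ^ card H + 3 * real (card H) ^ 2 / sqrt t"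
    using *(2) t by fastforce
qed

text \<open>Each \<open>n\<close> contributes an error \<open>3 * k ^ 2 / sqrt n\<close>, and these
  sum to the square root term. The model density \<open>S / ln t ^ k\<close> lies below a
  probability, hence is at most 1; at \<open>t = n0\<close> this is the bound on
  \<open>S\<close>.\<close>

lemma expected_sum_approx:
  assumes H: "finite H" "admissible H" "H \<subseteq> {0..int D}"
    and n0: "n0 \<ge> 2" and good: "\<And>t. t \<ge> real n0 \<Longrightarrow> good_level t" and D: "real D < sqrt (real n0)"
    and x: "real n0 \<le> x"
  defines "S \<equiv> singular_series H" and "k \<equiv> card H"
  shows "0 \<le> S" "S \<le> ln (real n0) ^ k"
    "\<bar>(\<Sum>n=n0..<nat \<lfloor>x\<rfloor> + 1. sieve_density H (level e n)) - S * integral {real n0..x} (\<lambda>t. 1 / ln t ^ k)\<bar>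
       \<le> 6 * real k ^ 2 * sqrt x + real e + 2"
proof -
  define f where "f = (\<lambda>t. S / ln t ^ k)"
  have approx: "f t \<le> sieve_density H (sieve_level t)" "sieve_density H (sieve_level t) \<le> f t + 3 * real k ^ 2 / sqrt t" "S \<ge> 0"
    if t: "t \<ge> real n0" for t
  proof -
    have "real D < sqrt t" using D t by (smt (verit) real_sqrt_le_mono)
    thus "f t \<le> sieve_density H (sieve_level t)" "sieve_density H (sieve_level t) \<le> f t + 3 * real k ^ 2 / sqrt t" "S \<ge> 0"
      using sieve_level_density_approx[OF H, of t] t n0 good[OF t] unfolding f_def S_def k_def by auto
  qed
  show S: "S \<ge> 0" using approx(3)[of "real n0"] by simp
  have lnpos: "ln t > 0" if "t \<ge> real n0" for t using that n0 by simp
  have f01: "0 \<le> f t \<and> f t \<le> 1" if t: "t \<ge> real n0" for t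
  proof
    show "0 \<le> f t" unfolding f_def using S lnpos[OF t] by simp
    show "f t \<le> 1" using approx(1)[OF t] sieve_density_bounds(2)[OF H(1,2), of "sieve_level t"] by linarith
  qed
  show "S \<le> ln (real n0) ^ k"
  proof -
    have "ln (real n0) ^ k > 0" using lnpos[of "real n0"] by simp
    thus ?thesis using f01[of "real n0"] by (simp add: f_def field_simps)
  qed
  have anti: "f t \<le> f s" if st: "real n0 \<le> s" "s \<le> t" for s t
  proof -
    have "ln s \<le> ln t" using st n0 by (intro ln_mono) auto
    hence "ln s ^ k \<le> ln t ^ k" using lnpos[OF st(1)] by (intro power_mono) auto
    thus ?thesis unfolding f_def using S lnpos[OF st(1)] lnpos[of t] st by (intro divide_left_mono mult_pos_pos) auto
  qed
  have cont: "continuous_on {real n0..} f" unfolding f_def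
    using n0 by (intro continuous_intros) auto
  let ?u = "nat \<lfloor>x\<rfloor> + 1"
  have sum1: "\<bar>(\<Sum>n=n0..<?u. sieve_density H (level e n)) - (\<Sum>n=n0..<?u. f (real (n + e)))\<bar> \<le> 6 * real k ^ 2 * sqrt x"
  proof -
    have "\<bar>(\<Sum>n=n0..<?u. sieve_density H (level e n)) - (\<Sum>n=n0..<?u. f (real (n + e)))\<bar> \<le> (\<Sum>n=n0..<?u. \<bar>sieve_density H (level e n) - f (real (n + e))\<bar>)"
      unfolding sum_subtractf[symmetric] by (rule sum_abs)
    also have "\<dots> \<le> (\<Sum>n=n0..<?u. 3 * real k ^ 2 * (1 / sqrt (real n)))"
    proof (rule sum_mono)
      fix n assume "n \<in> {n0..<?u}"
      hence n: "real n0 \<le> real n" by simp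
      have "3 * real k ^ 2 / sqrt (real (n + e)) \<le> 3 * real k ^ 2 / sqrt (real n)"
        using n n0 by (intro divide_left_mono mult_pos_pos) auto
      thus "\<bar>sieve_density H (level e n) - f (real (n + e))\<bar> \<le> 3 * real k ^ 2 * (1 / sqrt (real n))"
        using approx[of "real (n + e)"] n unfolding level_def by simp
    qed
    also have "\<dots> \<le> (\<Sum>n=1..nat \<lfloor>x\<rfloor>. 3 * real k ^ 2 * (1 / sqrt (real n)))"
      using n0 by (intro sum_mono2) auto
    also have "\<dots> = 3 * real k ^ 2 * (\<Sum>n=1..nat \<lfloor>x\<rfloor>. 1 / sqrt (real n))" by (simp only: sum_distrib_left)
    also have "\<dots> \<le> 3 * real k ^ 2 * (2 * sqrt x)"
    proof (rule mult_left_mono)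
      have "real (nat \<lfloor>x\<rfloor>) \<le> x" using x n0 by simp
      hence "2 * sqrt (real (nat \<lfloor>x\<rfloor>)) \<le> 2 * sqrt x" by simp
      thus "(\<Sum>n=1..nat \<lfloor>x\<rfloor>. 1 / sqrt (real n)) \<le> 2 * sqrt x"
        using sum_inverse_sqrt_le[of "nat \<lfloor>x\<rfloor>"] by linarith
    qed simp
    finally show ?thesis by simp
  qed
  have "\<bar>(\<Sum>n=n0..<?u. f (real (n + e))) - integral {real n0..x} f\<bar> \<le> real e + 2"
    by (rule shifted_sum_integral_diff_le[OF anti cont f01 x])
  moreover have "integral {real n0..x} f = S * integral {real n0..x} (\<lambda>t. 1 / ln t ^ k)"
    unfolding f_def by (simp flip: integral_mult_right)
  ultimately show "\<bar>(\<Sum>n=n0..<?u. sieve_density H (level e n)) - S * integral {real n0..x} (\<lambda>t. 1 / ln t ^ k)\<bar>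
       \<le> 6 * real k ^ 2 * sqrt x + real e + 2"
    using sum1 by linarith
qed

lemma sieved_antimono: "y \<le> z \<Longrightarrow> sieved a z \<subseteq> sieved a y"
  unfolding sieved_def by auto

text \<open>Between \<open>n\<close> and \<open>n + D\<close> the sieving level may jump; replacing it by its value at either end
  traps the count between two processes with a single level per \<open>n\<close>.\<close>

lemma count_sandwich:
  fixes x :: real and H :: "int set" and a :: "nat \<Rightarrow> int"
  defines "A \<equiv> {n::nat. 0 < n \<and> real n \<le> x \<and> (\<forall>h\<in>H. int n + h \<in> random_set a)}"
  assumes HD: "H \<subseteq> {0..int D}" and n0: "exp 2 \<le> real n0" and x: "x \<ge> 0"
  shows "real (card A) \<le> real n0 + (\<Sum>n=n0..<nat \<lfloor>x\<rfloor> + 1. of_bool (survives H a (level 0 n) n))"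
    "(\<Sum>n=n0..<nat \<lfloor>x\<rfloor> + 1. of_bool (survives H a (level D n) n)) \<le> real (card A)"
proof -
  let ?I = "{n0..<nat \<lfloor>x\<rfloor> + 1}"
  have "finite I \<Longrightarrow> (\<Sum>n\<in>I. of_bool (Q n)) = real (card {n\<in>I. Q n})" for I :: "nat set" and Q
    by (simp add: Int_def)
  from this[of ?I] have cnt: "(\<Sum>n\<in>?I. of_bool (Q n)) = real (card {n\<in>?I. Q n})" for Q
    by blast
  have nI: "n \<in> ?I \<longleftrightarrow> n0 \<le> n \<and> real n \<le> x" for n using x by (auto simp: less_Suc_eq_le le_nat_floor) linarith
  have n0': "n0 > 0" using n0 exp_gt_zero[of "2::real"] by (cases n0) auto
  have finA: "finite A" by (rule finite_subset[of _ "{..nat \<lfloor>x\<rfloor>}"]) (auto simp: A_def le_nat_floor)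
  have lower: "survives H a (level D n) n \<Longrightarrow> \<forall>h\<in>H. int n + h \<in> random_set a"
    and upper: "\<forall>h\<in>H. int n + h \<in> random_set a \<Longrightarrow> survives H a (level 0 n) n" if n: "n0 \<le> n" for n
  proof -
    have lev: "real (level 0 n) \<le> real (sieve_level (real_of_int (int n + h)))" 
       "real (sieve_level (real_of_int (int n + h))) \<le> real (level D n)" "exp 2 \<le> real_of_int (int n + h)" if h: "h \<in> H" for h
    proof -
      have hD: "0 \<le> h" "h \<le> int D" using h HD by auto
      show e: "exp 2 \<le> real_of_int (int n + h)" using hD n n0 by simp
      show "real (level 0 n) \<le> real (sieve_level (real_of_int (int n + h)))"
        unfolding level_def using hD n n0 by (intro of_nat_mono sieve_level_mono) auto
      show "real (sieve_level (real_of_int (int n + h))) \<le> real (level D n)"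
        unfolding level_def using hD e by (intro of_nat_mono sieve_level_mono) auto
    qed
    show "\<forall>h\<in>H. int n + h \<in> random_set a" if "survives H a (level D n) n"
      using that lev sieved_antimono unfolding survives_iff random_set_def by blast
    show "survives H a (level 0 n) n" if "\<forall>h\<in>H. int n + h \<in> random_set a"
      using that lev sieved_antimono unfolding survives_iff random_set_def by blast
  qed
  have "n \<in> {..<n0} \<union> {n\<in>?I. survives H a (level 0 n) n}" if n: "n \<in> A" for n
  proof (cases "n < n0")
    case False
    hence "n0 \<le> n" "n \<in> ?I" using n unfolding nI A_def by auto
    thus ?thesis using upper[of n] n unfolding A_def by blast
  qed simp
  hence "A \<subseteq> {..<n0} \<union> {n\<in>?I. survives H a (level 0 n) n}" by blast
  hence "card A \<le> card ({..<n0} \<union> {n\<in>?I. survives H a (level 0 n) n})" by (intro card_mono) auto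
  also have "\<dots> \<le> n0 + card {n\<in>?I. survives H a (level 0 n) n}"
    by (rule order_trans[OF card_Un_le]) simp
  finally show "real (card A) \<le> real n0 + (\<Sum>n\<in>?I. of_bool (survives H a (level 0 n) n))" unfolding cnt by linarith
  have "n \<in> A" if n: "n \<in> ?I" "survives H a (level D n) n" for n
    using lower[of n] n n0' unfolding nI A_def by auto
  hence "{n\<in>?I. survives H a (level D n) n} \<subseteq> A" by blast
  hence "card {n\<in>?I. survives H a (level D n) n} \<le> card A" by (intro card_mono finA)
  thus "(\<Sum>n\<in>?I. of_bool (survives H a (level D n) n)) \<le> real (card A)" unfolding cnt by linarith
qed

text \<open>The integers below \<open>n0\<close> cost at most \<open>n0\<close>. The integral from 2
  to \<open>n0\<close> has no counterpart in the sum; multiplied by the singular series, which is at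
  most \<open>ln n0 ^ card H\<close>, it gives the last summand.\<close>

lemma count_error_le:
  fixes x B :: real and H :: "int set" and a :: "nat \<Rightarrow> int"
  defines "A \<equiv> {n::nat. 0 < n \<and> real n \<le> x \<and> (\<forall>h\<in>H. int n + h \<in> random_set a)}"
  assumes H: "finite H" "admissible H" "H \<subseteq> {0..int D}"
    and n0: "exp 2 \<le> real n0" and good: "\<And>t. t \<ge> real n0 \<Longrightarrow> good_level t" and D: "real D < sqrt (real n0)"
    and x: "real n0 \<le> x"
    and dev: "\<And>e. e \<in> {0, D} \<Longrightarrow> \<bar>deviation H a e n0 (nat \<lfloor>x\<rfloor> + 1)\<bar> \<le> B"
  shows "\<bar>real (card A) - singular_series H * integral {2..x} (\<lambda>t. 1 / ln t ^ card H)\<bar> \<le>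
    B + 6 * real (card H) ^ 2 * sqrt x + real D + 2 + real n0 + (2 * ln (real n0)) ^ card H * real n0"
proof -
  let ?k = "card H" and ?S = "singular_series H" and ?u = "nat \<lfloor>x\<rfloor> + 1"
  let ?I1 = "integral {2..real n0} (\<lambda>t. 1 / ln t ^ ?k)" and ?I2 = "integral {real n0..x} (\<lambda>t. 1 / ln t ^ ?k)"
  have "exp 2 \<ge> (1 + 2 :: real)" by (rule exp_ge_add_one_self)
  hence n2: "n0 \<ge> 2" using n0 by linarith
  have "(\<lambda>t. 1 / ln t ^ ?k) integrable_on {2..x}"
    by (intro integrable_continuous_real continuous_intros) auto
  hence split: "integral {2..x} (\<lambda>t. 1 / ln t ^ ?k) = ?I1 + ?I2"
    using n2 x by (intro Henstock_Kurzweil_Integration.integral_combine[symmetric]) auto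
  note exp = expected_sum_approx[OF H n2 good D x]
  have S1: "0 \<le> ?S * ?I1" "?S * ?I1 \<le> (2 * ln (real n0)) ^ ?k * real n0"
  proof -
    show "0 \<le> ?S * ?I1" using exp(1) integral_inverse_ln_power_le(2)[OF n2] by simp
    have "?S * ?I1 \<le> ln (real n0) ^ ?k * (real n0 * 2 ^ ?k)"
      using exp(1,2) integral_inverse_ln_power_le(2,3)[OF n2] by (intro mult_mono) auto
    thus "?S * ?I1 \<le> (2 * ln (real n0)) ^ ?k * real n0" by (simp add: power_mult_distrib mult_ac)
  qed
  have *: "\<bar>(\<Sum>n=n0..<?u. of_bool (survives H a (level e n) n)) - ?S * ?I2\<bar> \<le> B + 6 * real ?k ^ 2 * sqrt x + real D + 2"
    if e: "e \<in> {0, D}" for e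
  proof -
    have "(\<Sum>n=n0..<?u. of_bool (survives H a (level e n) n)) = deviation H a e n0 ?u + (\<Sum>n=n0..<?u. sieve_density H (level e n))"
      unfolding deviation_def sum_subtractf by simp
    moreover have "real e \<le> real D" using e by auto
    ultimately show ?thesis using dev[OF e] exp(3)[of e] by linarith
  qed
  have "x \<ge> 0" using x by linarith
  note sw = count_sandwich[OF H(3) n0 this, of a, folded A_def]
  show ?thesis unfolding split distrib_left
    using sw *[OF insertI1] *[OF insertI2[OF insertI1]] S1 of_nat_0_le_iff[of n0, where 'a = real] by linarith
qed

text \<open>Equality holds at \<open>c = 1 / 2\<close>; for larger \<open>c\<close> the fluctuation
  exponent \<open>c\<close> is strictly below the claimed one.\<close>

lemma main_exponent_ge:
  assumes "1 / 2 \<le> c" "c < (1::real)"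
  shows "c \<le> 1 - (1 - c) / (8 * c\<^sup>2 - 2 * c)"
proof -
  have "8 * c\<^sup>2 - 2 * c - 1 = (2 * c - 1) * (4 * c + 1)" by (simp add: power2_eq_square algebra_simps)
  moreover have "\<dots> \<ge> 0" using assms by simp
  ultimately have "8 * c\<^sup>2 - 2 * c \<ge> 1" by linarith
  hence "(1 - c) / (8 * c\<^sup>2 - 2 * c) \<le> (1 - c) / 1" using assms by (intro divide_left_mono) auto
  thus ?thesis by simp
qed

theorem theorem1p3:
  fixes M :: "'w measure" and a :: "nat \<Rightarrow> 'w \<Rightarrow> int" and c \<epsilon> :: real
  assumes "prob_space M"
    and "prob_space.indep_vars M (\<lambda>_. count_space UNIV) a {p. prime p}"
    and "\<And>p. prime p \<Longrightarrow>
           distr M (count_space UNIV) (a p) = measure_pmf (pmf_of_set {0..<int p})"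
    and "1 / 2 \<le> c" and "c < 1" and "\<epsilon> > 0"
  shows "AE \<omega> in M. \<exists>B::real. \<forall>\<^sub>F x::real in at_top. \<forall>H::int set.
           finite H \<longrightarrow> admissible H \<longrightarrow>
           real (card H) \<le> ln x powr c \<longrightarrow>
           real_of_int ` H \<subseteq> {0..exp (ln x powr (1 - c) / ln (ln x))} \<longrightarrow>
           \<bar>real (card {n::nat. 0 < n \<and> real n \<le> x \<and>
                          (\<forall>h\<in>H. int n + h \<in> random_set (\<lambda>p. a p \<omega>))})
             - singular_series H * integral {2..x} (\<lambda>t. 1 / ln t ^ card H)\<bar>
           \<le> B * x powr (1 - (1 - c) / (8 * c\<^sup>2 - 2 * c) + \<epsilon>)"
proof -
  \<comment> \<open>Five \<delta> stand in the exponent of the deviation bound; the sixth absorbs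
    the remaining factors of size X^o(1).\<close>
  define \<delta> where "\<delta> = min 1 (\<epsilon> / 6)"
  have \<delta>: "0 < \<delta>" "\<delta> \<le> 1" "6 * \<delta> \<le> \<epsilon>" using assms(6) by (auto simp: \<delta>_def)
  define X where "X = (\<lambda>J::nat. (4::real) ^ J)"
  define L where "L = (\<lambda>J::nat. real J * ln 4)"
  define D where "D = (\<lambda>J. diam c (L J))"
  define \<alpha> where "\<alpha> = c + 6 * \<delta>"
  have XL: "X J = exp (L J)" for J by (simp add: X_def L_def exp_of_nat_mult)
  have Ltop: "filterlim L at_top sequentially" unfolding L_def by real_asymp
  obtain t0 where t0: "\<And>t. t \<ge> t0 \<Longrightarrow> good_level t"
    using eventually_sieve_level_next_prime unfolding good_level_def[symmetric] eventually_at_top_linorder by blast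
  have "eventually (\<lambda>J::nat. t0 \<le> 2 ^ J) sequentially" by real_asymp
  note evs = this eventually_compose_filterlim[OF eventually_parameters[OF assms(4,5) \<delta>(1,2)] Ltop] eventually_ge_at_top[of "3::nat"]
  \<comment> \<open>This gives \<open>4 ^ (J x - 1) \<le> x < 4 ^ J x\<close>; all \<open>x\<close>
    in such a range are served by the single event at scale \<open>J x\<close>.\<close>
  define J where "J = (\<lambda>x::real. nat \<lfloor>ln x / ln 4\<rfloor> + 1)"
  have Jtop: "filterlim J sequentially at_top"
    unfolding J_def by real_asymp
  have "AE \<omega> in M. eventually (\<lambda>J. \<forall>H\<in>tuples (D J) (L J powr c). \<forall>e\<in>{0, D J}. \<forall>u\<le>4 ^ J.
           \<bar>deviation H (\<lambda>p. a p \<omega>) e (2 ^ J) u\<bar> \<le> (2 * real J + 1) * X J powr (c + 5 * \<delta>)) sequentially"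
    unfolding X_def L_def D_def by (rule AE_deviation_le[OF assms(1,2) _ assms(4,5) \<delta>(1,2)]) (rule assms(3))
  thus ?thesis
  proof eventually_elim
    case (elim \<omega>)
    let ?a = "\<lambda>p. a p \<omega>"
    have "eventually (\<lambda>J. \<forall>H\<in>tuples (D J) (L J powr c). \<forall>e\<in>{0, D J}. \<forall>u\<le>4 ^ J.
           \<bar>deviation H ?a e (2 ^ J) u\<bar> \<le> (2 * real J + 1) * X J powr (c + 5 * \<delta>)) sequentially"
      using elim .
    note ev = eventually_compose_filterlim[OF this Jtop] eventually_compose_filterlim[OF evs(1) Jtop]
      eventually_compose_filterlim[OF evs(2) Jtop] eventually_compose_filterlim[OF evs(3) Jtop]
    show ?case
    \<comment> \<open>The five error terms, each at most \<open>X j powr \<alpha>\<close>, fit under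
      the 6; the factor \<open>4 powr \<alpha>\<close> comes from
      \<open>X j \<le> 4 * x\<close>.\<close>
    proof (intro exI[of _ "6 * 4 powr \<alpha>"])
      show "\<forall>\<^sub>F x in at_top. \<forall>H. finite H \<longrightarrow> admissible H \<longrightarrow> real (card H) \<le> ln x powr c \<longrightarrow>
           real_of_int ` H \<subseteq> {0..exp (ln x powr (1 - c) / ln (ln x))} \<longrightarrow>
           \<bar>real (card {n. 0 < n \<and> real n \<le> x \<and> (\<forall>h\<in>H. int n + h \<in> random_set ?a)})
             - singular_series H * integral {2..x} (\<lambda>t. 1 / ln t ^ card H)\<bar>
           \<le> 6 * 4 powr \<alpha> * x powr (1 - (1 - c) / (8 * c\<^sup>2 - 2 * c) + \<epsilon>)"
        using ev eventually_ge_at_top[of 1]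
      proof eventually_elim
        case (elim x)
        define j where "j = J x"
        note dev = elim(1)[folded j_def] and params = elim(3)[folded j_def]
        have x1: "x \<ge> 1" by fact
        have par: "L j > ln 4 + 1" "real (D j) + 2 \<le> exp (L j / 4)" "t0 \<le> 2 ^ j" "j \<ge> 3" "4 * (2 * L j + 1) \<le> exp (\<delta> * L j)"
          using elim(2,4) params unfolding D_def j_def by auto
        have par_k: "1 + 2 * ((2 * real k) ^ 4 + 4 * (real k)\<^sup>2 * (2 * L j + 3 + ln (2 * exp (L j)))) + 6 * (real k)\<^sup>2 \<le> exp (\<delta> * L j)"
          "(2 * L j) ^ k \<le> exp (\<delta> * L j)" if "real k \<le> L j powr c" for k :: nat using params that by blast+
        have ln4: "ln (4::real) \<ge> 1" by (rule ln_ge_one_4)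
        have lnx: "L j - ln 4 \<le> ln x" "ln x < L j"
        proof -
          have "0 \<le> ln x / ln 4" using x1 by simp
          hence "real (nat \<lfloor>ln x / ln 4\<rfloor>) = real_of_int \<lfloor>ln x / ln 4\<rfloor>" by simp
          hence "real (nat \<lfloor>ln x / ln 4\<rfloor>) \<le> ln x / ln 4" "ln x / ln 4 < real (nat \<lfloor>ln x / ln 4\<rfloor>) + 1"
            using of_int_floor_le[of "ln x / ln 4"] real_of_int_floor_add_one_gt[of "ln x / ln 4"] by simp_all
          moreover have "real j = real (nat \<lfloor>ln x / ln 4\<rfloor>) + 1" unfolding j_def J_def by (simp only: of_nat_add of_nat_1)
          ultimately have "real j - 1 \<le> ln x / ln 4" "ln x / ln 4 < real j" by linarith+
          thus "L j - ln 4 \<le> ln x" "ln x < L j" using ln4 unfolding L_def by (auto simp: field_simps)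
        qed
        have xX: "X j \<le> 4 * x" "x < X j"
        proof -
          have "exp (L j) \<le> exp (ln 4 + ln x)" using lnx by simp
          thus "X j \<le> 4 * x" using x1 by (simp add: XL exp_add)
          have "exp (ln x) < exp (L j)" using lnx by simp
          thus "x < X j" using x1 by (simp add: XL)
        qed
        have X1: "X j \<ge> 1" by (simp add: X_def)
        show ?case
        proof (intro allI impI)
          fix H :: "int set"
          assume H: "finite H" "admissible H" "real (card H) \<le> ln x powr c"
            "real_of_int ` H \<subseteq> {0..exp (ln x powr (1 - c) / ln (ln x))}"
          let ?k = "card H"
          have k: "real ?k \<le> L j powr c"
          proof -
            have "ln x powr c \<le> L j powr c" using lnx x1 assms(4) by (intro powr_mono2) auto
            thus ?thesis using H(3) by linarith
          qed
          have HD: "H \<subseteq> {0..int (D j)}"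
          proof
            fix h assume h: "h \<in> H"
            hence h0: "0 \<le> real_of_int h" "real_of_int h \<le> exp (ln x powr (1 - c) / ln (ln x))" using H(4) by auto
            have "ln x powr (1 - c) \<le> L j powr (1 - c)" using lnx x1 assms(5) by (intro powr_mono2) auto
            moreover have "0 < ln (L j - ln 4)" "ln (L j - ln 4) \<le> ln (ln x)" using par(1) lnx by (auto intro!: ln_mono)
            ultimately have "ln x powr (1 - c) / ln (ln x) \<le> L j powr (1 - c) / ln (L j - ln 4)"
              by (intro frac_le) auto
            hence "real_of_int h \<le> exp (L j powr (1 - c) / ln (L j - ln 4))" using h0 by (smt (verit) exp_le_cancel_iff)
            hence "h \<le> \<lfloor>exp (L j powr (1 - c) / ln (L j - ln 4))\<rfloor>" by (simp add: le_floor_iff)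
            thus "h \<in> {0..int (D j)}" using h0 unfolding D_def diam_def by simp
          qed
          have Ht: "H \<in> tuples (D j) (L j powr c)" using H HD k by (simp add: tuples_def)
          have sq: "sqrt (X j) = 2 ^ j" 
          proof -
            have "X j = (2 ^ j)\<^sup>2" by (simp add: X_def power2_eq_square flip: power_mult_distrib)
            thus ?thesis by (simp add: real_sqrt_unique)
          qed
          have pw: "X j powr \<beta> = exp (\<beta> * L j)" for \<beta> by (simp add: XL exp_powr_real mult.commute)
          have half: "(2::real) ^ j = X j powr (1 / 2)" using sq X1 by (simp add: powr_half_sqrt)
          have xj: "2 ^ j \<le> x"
          proof -
            have "(2::real) ^ 3 \<le> 2 ^ j" using par(4) by (intro power_increasing) auto
            hence "4 * 2 ^ j \<le> 2 ^ j * (2 ^ j :: real)" by simp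
            also have "\<dots> = X j" by (simp add: X_def flip: power_mult_distrib)
            finally show ?thesis using xX by linarith
          qed
          have "\<bar>real (card {n. 0 < n \<and> real n \<le> x \<and> (\<forall>h\<in>H. int n + h \<in> random_set ?a)})
             - singular_series H * integral {2..x} (\<lambda>t. 1 / ln t ^ card H)\<bar> \<le>
             (2 * real j + 1) * X j powr (c + 5 * \<delta>) + 6 * real ?k ^ 2 * sqrt x + real (D j) + 2 + real (2 ^ j) + (2 * ln (real (2 ^ j))) ^ ?k * real (2 ^ j)"
          proof (rule count_error_le[OF H(1,2) HD])
            have "(2::real) ^ 3 \<le> 2 ^ j" using par(4) by (intro power_increasing) auto
            thus "exp 2 \<le> real (2 ^ j)" using exp_2_less_8 by simp
            show "good_level t" if "t \<ge> real (2 ^ j)" for t using that par(3) by (intro t0) simp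
            \<comment> \<open>\<open>count_error_le\<close> requires \<open>D < sqrt n0\<close> with
              \<open>n0 = 2 ^ j = sqrt (X j)\<close>; this fourth root of \<open>X j\<close> is the
              origin of \<open>L / 4\<close> in the parameters.\<close>
            have "exp (L j / 4) = sqrt (2 ^ j)"
            proof -
              have "sqrt (2 ^ j) = (X j powr (1 / 2)) powr (1 / 2)" unfolding half by (simp add: powr_half_sqrt)
              also have "\<dots> = X j powr (1 / 4)" by (simp only: powr_powr) simp
              finally show ?thesis by (simp add: pw)
            qed
            thus "real (D j) < sqrt (real (2 ^ j))" using par(2) by simp
            show "real (2 ^ j) \<le> x" using xj by simp
            fix e assume e: "e \<in> {0, D j}"
            have "real (nat \<lfloor>x\<rfloor>) \<le> x" using x1 by simp
            moreover have "x < real (4 ^ j)" using xX unfolding X_def by simp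
            ultimately have "real (nat \<lfloor>x\<rfloor>) < real (4 ^ j)" by (rule le_less_trans)
            hence "nat \<lfloor>x\<rfloor> + 1 \<le> 4 ^ j" by linarith
            thus "\<bar>deviation H ?a e (2 ^ j) (nat \<lfloor>x\<rfloor> + 1)\<bar> \<le> (2 * real j + 1) * X j powr (c + 5 * \<delta>)"
              using dev Ht e by blast
          qed
          also have "\<dots> \<le> 6 * X j powr \<alpha>"
          proof -
            have e1: "1 \<le> exp (\<delta> * L j)" using \<delta> par(1) ln4 by simp
            have mono: "X j powr \<beta> \<le> X j powr \<alpha>" if "\<beta> \<le> \<alpha>" for \<beta> using that X1 by (intro powr_mono) auto
            have half\<alpha>: "1 / 2 + \<delta> \<le> \<alpha>" using assms(4) \<delta> by (simp add: \<alpha>_def)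
            have a1: "(2 * real j + 1) * X j powr (c + 5 * \<delta>) \<le> X j powr \<alpha>"
            proof -
              have "real j \<le> L j" unfolding L_def using ln4 by (simp add: mult_le_cancel_left1)
              hence "2 * real j + 1 \<le> 2 * L j + 1" by simp
              also have "\<dots> \<le> 4 * (2 * L j + 1)" using par(1) ln4 by simp
              also have "\<dots> \<le> exp (\<delta> * L j)" by (rule par(5))
              finally have "2 * real j + 1 \<le> exp (\<delta> * L j)" .
              hence "(2 * real j + 1) * X j powr (c + 5 * \<delta>) \<le> exp (\<delta> * L j) * X j powr (c + 5 * \<delta>)"
                by (intro mult_right_mono) auto
              also have "\<dots> = X j powr \<alpha>" unfolding pw \<alpha>_def by (simp add: exp_add[symmetric] algebra_simps)
              finally show ?thesis .
            qed
            have a2: "6 * real ?k ^ 2 * sqrt x \<le> X j powr \<alpha>"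
            proof -
              \<comment> \<open>The parameter bound carries \<open>6 * k ^ 2\<close>, although the
                variance uses only \<open>2 * k ^ 2\<close>, so that this term can be read off from
                it by dropping nonnegative summands.\<close>
              have "ln (2 * exp (L j)) \<ge> 0" using par(1) ln4 one_le_exp_iff[of "L j"] by (intro ln_ge_zero) linarith
              hence "0 \<le> 2 * ((2 * real ?k) ^ 4 + 4 * (real ?k)\<^sup>2 * (2 * L j + 3 + ln (2 * exp (L j))))"
                using par(1) ln4 by (intro mult_nonneg_nonneg add_nonneg_nonneg) auto
              hence "6 * real ?k ^ 2 \<le> exp (\<delta> * L j)" using par_k(1)[OF k] by linarith
              moreover have "sqrt x \<le> sqrt (X j)" using xX by simp
              ultimately have "6 * real ?k ^ 2 * sqrt x \<le> exp (\<delta> * L j) * sqrt (X j)" using x1 by (intro mult_mono) auto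
              also have "\<dots> = X j powr (1 / 2 + \<delta>)" using X1 by (simp add: powr_add powr_half_sqrt pw[of \<delta>])
              also have "\<dots> \<le> X j powr \<alpha>" by (rule mono[OF half\<alpha>])
              finally show ?thesis .
            qed
            have a3: "real (2 ^ j) \<le> X j powr \<alpha>" using mono[of "1 / 2"] half half\<alpha> \<delta> by simp
            have a4: "real (D j) + 2 \<le> X j powr \<alpha>"
            proof -
              have "real (D j) + 2 \<le> X j powr (1 / 4)" using par(2) by (simp add: pw)
              also have "\<dots> \<le> X j powr \<alpha>" using half\<alpha> \<delta> by (intro mono) auto
              finally show ?thesis .
            qed
            \<comment> \<open>The power has only \<open>card H \<le> L j powr c\<close> factors,
              each at most \<open>2 * L j\<close>, and so is of size X^o(1).\<close>
            have a5: "(2 * ln (real (2 ^ j))) ^ ?k * real (2 ^ j) \<le> X j powr \<alpha>"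
            proof -
              have "ln (real (2 ^ j)) = real j * ln 2" by (simp add: ln_realpow)
              also have "\<dots> \<le> L j" unfolding L_def by (intro mult_left_mono) auto
              finally have "(2 * ln (real (2 ^ j))) ^ ?k \<le> (2 * L j) ^ ?k"
                by (intro power_mono mult_left_mono) auto
              also have "\<dots> \<le> exp (\<delta> * L j)" by (rule par_k(2)[OF k])
              finally have "(2 * ln (real (2 ^ j))) ^ ?k * real (2 ^ j) \<le> exp (\<delta> * L j) * real (2 ^ j)"
                by (intro mult_right_mono) auto
              also have "\<dots> = X j powr (1 / 2 + \<delta>)" using half by (simp add: powr_add pw[of \<delta>])
              also have "\<dots> \<le> X j powr \<alpha>" by (rule mono[OF half\<alpha>])
              finally show ?thesis .
            qed
            show ?thesis using a1 a2 a3 a4 a5 powr_ge_zero[of "X j" \<alpha>] by linarith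
          qed
          also have "\<dots> \<le> 6 * (4 * x) powr \<alpha>" using xX X1 assms(4) \<delta> by (intro mult_left_mono powr_mono2) (auto simp: \<alpha>_def)
          also have "\<dots> = 6 * 4 powr \<alpha> * x powr \<alpha>" using x1 by (simp add: powr_mult)
          also have "\<dots> \<le> 6 * 4 powr \<alpha> * x powr (1 - (1 - c) / (8 * c\<^sup>2 - 2 * c) + \<epsilon>)"
            using x1 main_exponent_ge[OF assms(4,5)] \<delta> by (intro mult_mono powr_mono) (auto simp: \<alpha>_def)
          finally show "\<bar>real (card {n. 0 < n \<and> real n \<le> x \<and> (\<forall>h\<in>H. int n + h \<in> random_set ?a)})
             - singular_series H * integral {2..x} (\<lambda>t. 1 / ln t ^ card H)\<bar>
           \<le> 6 * 4 powr \<alpha> * x powr (1 - (1 - c) / (8 * c\<^sup>2 - 2 * c) + \<epsilon>)" .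
        qed
      qed
    qed
  qed
qed

end
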